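(* Let $p\in\mathbb{N}$ and let $(X_i,\varepsilon_i)_{i=1}^n$ be independent copies of $(X,\varepsilon)$ with $X\in[0,1]^p$, $\varepsilon\in\mathbb{R}$, $\mathbb{E}[\varepsilon\mid X]=0$. Assume $X$ has a density $f_X$ with $0<c_X\le f_X\le C_X$ on $[0,1]^p$ and $\sigma^2(x)=\mathrm{Var}(\varepsilon\mid X=x)$ satisfies $0<c_{\sigma^2}\le\sigma^2\le C_{\sigma^2}$. Let $\delta=\delta_n\to0$ with $\delta^{-1}\in\mathbb{N}$ and $\log\delta^{-1}=\mathcal{O}(\log n)$. Assume $\sup_{x\in[0,1]^p}\mathbb{E}[|\varepsilon|^3\mid X=x]<\infty$ and $\mathbb{E}[|\varepsilon|^\nu]<\infty$ for some $\nu\in[4,\infty)$. Define $p_\delta(x)=\mathbb{P}(X\in A_\delta(x))$, $\tau_\delta(x)=p_\delta(x)^2/\mathbb{E}[\sigma^2(X)\mathbb{I}_{A_\delta(x)}(X)]$ and $$\tilde m^{(\varepsilon)}(x)=\frac1n\sum_{j=1}^n\varepsilon_j\,p_\delta(x)^{-1}\mathbb{I}\{X_j\in A_\delta(x)\}.$$ Then there exists a sequence of random variables $\mathbf{S}_\delta$ with $\mathbf{S}_\delta\overset{d}{=}\max_{j=1,\dots,\delta^{-p}}|Z_j|$ for independent standard normal $(Z_j)_{j\in\mathbb{N}}$ such that $$\Big|\sqrt n\sup_{x\in[0,1]^p}|\tau_\delta(x)^{1/2}\tilde m^{(\varepsilon)}(x)|-\mathbf{S}_\delta\Big|=\mathcal{O}_{\mathbb{P}}\Big(\frac{(\log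 n)^{3/2}}{\delta^{p/2}n^{1/2-1/\nu}}+\frac{(\log n)^{5/4}}{\delta^{p/4}n^{1/4}}+\frac{\log n}{\delta^{p/6}n^{1/6}}\Big).$$
   Context: For $\delta^{-1}\in\mathbb{N}$, $[0,1]^p$ is partitioned by the equidistant grid of edge length $\delta$ into $\delta^{-p}$ hypercubes of volume $\delta^p$; $A_\delta(x)$ denotes the hypercube of this partition containing $x$. The random variables $\mathbf{S}_\delta$ may be constructed on a (possibly enlarged) probability space together with the data. *)

theory Defs
  imports "HOL-Probability.Probability" "HOL-Library.Landau_Symbols"
begin

definition unit_cube :: "(real^'p) set" where
  "unit_cube = {x. \<forall>i. 0 \<le> x$i \<and> x$i \<le> 1}"

text \<open>Index (0..k-1) of the grid interval of edge length 1/k containing t in [0,1];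
  intervals are [a/k,(a+1)/k), the last one closed.\<close>
definition cell_index :: "nat \<Rightarrow> real \<Rightarrow> nat" where
  "cell_index k t = min (nat \<lfloor>t * real k\<rfloor>) (k - 1)"

text \<open>A_delta(x) for delta = 1/k: the grid hypercube of the partition containing x.\<close>
definition cell :: "nat \<Rightarrow> real^'p \<Rightarrow> (real^'p) set" where
  "cell k x = {y \<in> unit_cube. \<forall>i. cell_index k (y$i) = cell_index k (x$i)}"

definition p_delta :: "'a measure \<Rightarrow> ('a \<Rightarrow> real^'p) \<Rightarrow> nat \<Rightarrow> real^'p \<Rightarrow> real" where
  "p_delta M X k x = measure M {\<omega> \<in> space M. X \<omega> \<in> cell k x}"

definition tau_delta ::
  "'a measure \<Rightarrow> ('a \<Rightarrow> real^'p) \<Rightarrow> (real^'p \<Rightarrow> real) \<Rightarrow> nat \<Rightarrow> real^'p \<Rightarrow> real" where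
  "tau_delta M X sigma2 k x =
     (p_delta M X k x)\<^sup>2 / (\<integral>\<omega>. sigma2 (X \<omega>) * indicator (cell k x) (X \<omega>) \<partial>M)"

definition m_tilde ::
  "nat \<Rightarrow> (nat \<Rightarrow> real^'p) \<Rightarrow> (nat \<Rightarrow> real) \<Rightarrow> nat \<Rightarrow> (real^'p \<Rightarrow> real) \<Rightarrow> real^'p \<Rightarrow> real" where
  "m_tilde n Xs es k pd x =
     (1 / real n) * (\<Sum>j<n. es j * inverse (pd x) * indicator (cell k x) (Xs j))"

definition max_abs_normal_law :: "nat \<Rightarrow> real measure" where
  "max_abs_normal_law N =
     distr (PiM {..<N} (\<lambda>_. density lborel (\<lambda>z. ennreal (std_normal_density z)))) borel
       (\<lambda>z. Max ((\<lambda>j. \<bar>z j\<bar>) ` {..<N}))"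

definition bigO_P :: "(nat \<Rightarrow> 'a measure) \<Rightarrow> (nat \<Rightarrow> 'a \<Rightarrow> real) \<Rightarrow> (nat \<Rightarrow> real) \<Rightarrow> bool" where
  "bigO_P Q D r \<longleftrightarrow>
     (\<forall>\<eta>>0. \<exists>K. \<exists>N. \<forall>n\<ge>N.
        measure (Q n) {\<omega> \<in> space (Q n). \<bar>D n \<omega>\<bar> > K * r n} < \<eta>)"

end

theory Submission
  imports Defs
begin

text \<open>
  The grid cells are disjoint, so the normalised cell sums
  \<open>W\<^sub>a = (\<Sum>\<^sub>j \<epsilon>\<^sub>j 1{X\<^sub>j \<in> A\<^sub>a}) / (s\<^sub>a sqrt n)\<close>, where \<open>s\<^sub>a\<^sup>2 = E[\<sigma>\<^sup>2(X) 1{X \<in> A\<^sub>a}]\<close>, are centred with identity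
  covariance, and the statistic is \<open>T = max |W\<^sub>a|\<close>. The maximum is replaced by
  \<open>ln (\<Sum>cosh (\<beta> W\<^sub>a)) / \<beta>\<close> and a Lindeberg argument exchanges the summands for Gaussian vectors. A
  summand moves a single coordinate only; the third derivative in that coordinate carries the
  soft-max weight of the coordinate, and these weights add up to one, so the one-step error is
  uniform in the current state. This gives \<open>P(T \<in> A) \<le> P(S \<in> A\<^sup>r) + o(1)\<close> for all Borel sets \<open>A\<close>, with
  \<open>r\<close> the claimed rate, because the rate has logarithmic factors to spare. Strassen's theorem on the
  line then yields the coupling; after discretisation it is a greedy transport argument.
\<close>

section \<open>Smooth approximation of indicators and maxima\<close>

text \<open>Write N for the number of cells, l = ln (2 N) and r for the rate. The choice \<beta> = l
  / r puts the soft maximum within r of the true one, and the test function of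
  \<open>lncosh\<close>, being smooth at scale l, has derivatives of order 1 / l. Since s_a^2 is at
  least of order 1 / N, the third absolute moment of a normalised summand is O(sqrt N). With
  \<kappa> = l / (r sqrt n), n exchanges therefore cost n \<kappa>^3 sqrt N / l = l^2 sqrt N / (r^3
  sqrt n), which is O(1 / log n) once r is at least log n (N / n)^(1/6). The soft-max weights stay
  comparable along a move only if the move has size at most one. Larger moves are paid for by the
  \<nu>-th moment; as the cells are disjoint, its sum over all cells is O(N^(\<nu>/2)), and this
  produces the first term of the rate. A Gaussian replacement moves all coordinates at once, so its
  weight gain is lost; but the third moment of the maximum of N normals is at most the square root
  of the summed sixth moments, again O(sqrt N).\<close>

lemma unit_average:
  fixes f :: "real \<Rightarrow> real"
  assumes "continuous_on UNIV f"
  obtains h where "\<And>x. (h has_real_derivative (f (x + 1) - f x)) (at x)"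
    and "\<And>x. \<exists>y\<in>{x..x+1}. h x = f y"
proof -
  have "\<exists>F. \<forall>x. - \<infinity> < ereal x \<longrightarrow> ereal x < \<infinity> \<longrightarrow> (F has_vector_derivative f x) (at x)"
    by (rule einterval_antiderivative) (use assms in \<open>auto simp: continuous_on_eq_continuous_at\<close>)
  then obtain F where F: "\<And>x. (F has_real_derivative f x) (at x)"
    by (auto simp: has_real_derivative_iff_has_vector_derivative)
  have F1: "((\<lambda>x. F (x + 1)) has_real_derivative f (x + 1)) (at x)" for x
    using DERIV_shift[of F "f (x+1)" x 1] F by simp
  \<comment> \<open>The witness is the mean of \<open>f\<close> over [x, x+1], written through an
    antiderivative. The mean value theorem turns each mean into a value of \<open>f\<close>, so
    bounds on \<open>f\<close> and its support carry over to the mean.\<close>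
  show ?thesis
  proof
    show "((\<lambda>x. F (x + 1) - F x) has_real_derivative (f (x + 1) - f x)) (at x)" for x
      by (intro DERIV_diff F1 F)
    show "\<exists>y\<in>{x..x+1}. F (x + 1) - F x = f y" for x
      using MVT2[of x "x+1" F f] F by force
  qed
qed

text \<open>Averaging a Lipschitz cut-off three times over unit intervals turns its derivatives into
  finite differences, so all derivative bounds are immediate.\<close>
lemma smooth_indicator:
  fixes A :: "real set"
  obtains g g1 g2 g3 :: "real \<Rightarrow> real"
  where "\<And>x. (g has_real_derivative g1 x) (at x)" "\<And>x. (g1 has_real_derivative g2 x) (at x)"
    "\<And>x. (g2 has_real_derivative g3 x) (at x)"
    "\<And>x. \<bar>g1 x\<bar> \<le> 8" "\<And>x. \<bar>g2 x\<bar> \<le> 8" "\<And>x. \<bar>g3 x\<bar> \<le> 8"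
    "\<And>x. 0 \<le> g x" "\<And>x. g x \<le> 1" "\<And>x. x \<in> A \<Longrightarrow> g x = 1"
    "\<And>x. g x \<noteq> 0 \<Longrightarrow> \<exists>a\<in>A. \<bar>x - a\<bar> \<le> 8"
proof (cases "A = {}")
  case True
  show ?thesis by (rule that[of "\<lambda>_. 0" "\<lambda>_. 0" "\<lambda>_. 0" "\<lambda>_. 0"]) (auto simp: True)
next
  case False
  \<comment> \<open>This is 1 up to distance 3 from \<open>A\<close> and 0 from distance 4 on. Three
    averages look at most 3 to the right, so a plateau of width 3 keeps the value 1 on
    \<open>A\<close>; the final radius 8 is 3 for the shift plus 5 for the support, with
    slack.\<close>
  define h0 where "h0 x = max 0 (1 - max 0 (infdist x A - 3))" for x
  have c0: "continuous_on UNIV h0"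
    unfolding h0_def by (intro continuous_intros)
  obtain h1 where h1: "\<And>x. (h1 has_real_derivative (h0 (x + 1) - h0 x)) (at x)"
      "\<And>x. \<exists>y\<in>{x..x+1}. h1 x = h0 y"
    using unit_average[OF c0] by metis
  have "continuous_on UNIV h1"
    using h1(1) by (meson DERIV_isCont continuous_at_imp_continuous_on)
  then obtain h2 where h2: "\<And>x. (h2 has_real_derivative (h1 (x + 1) - h1 x)) (at x)"
      "\<And>x. \<exists>y\<in>{x..x+1}. h2 x = h1 y"
    using unit_average by metis
  have "continuous_on UNIV h2"
    using h2(1) by (meson DERIV_isCont continuous_at_imp_continuous_on)
  then obtain h3 where h3: "\<And>x. (h3 has_real_derivative (h2 (x + 1) - h2 x)) (at x)"
      "\<And>x. \<exists>y\<in>{x..x+1}. h3 x = h2 y"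
    using unit_average by metis
  have b0: "0 \<le> h0 x" "h0 x \<le> 1" for x by (auto simp: h0_def)
  have b1: "0 \<le> h1 x" "h1 x \<le> 1" for x using h1(2)[of x] b0 by auto
  have b2: "0 \<le> h2 x" "h2 x \<le> 1" for x using h2(2)[of x] b1 by auto
  have b3: "0 \<le> h3 x" "h3 x \<le> 1" for x using h3(2)[of x] b2 by auto
  have sh: "((\<lambda>x. f (x + c)) has_real_derivative f' (x + c)) (at x)"
    if "\<And>x. (f has_real_derivative f' x) (at x)" for f f' :: "real \<Rightarrow> real" and x c
    using DERIV_shift[of f "f' (x+c)" x c] that by simp
  have val: "\<exists>y\<in>{x..x+3}. h3 x = h0 y" for x
  proof -
    obtain y where y: "y \<in> {x..x+1}" "h3 x = h2 y" using h3(2) by blast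
    obtain y' where y': "y' \<in> {y..y+1}" "h2 y = h1 y'" using h2(2) by blast
    obtain y'' where y'': "y'' \<in> {y'..y'+1}" "h1 y' = h0 y''" using h1(2) by blast
    show ?thesis using y y' y'' by (intro bexI[of _ y'']) auto
  qed
  show ?thesis
  proof (rule that[of h3 "\<lambda>x. h2 (x+1) - h2 x"
        "\<lambda>x. (h1 (x+1+1) - h1 (x+1)) - (h1 (x+1) - h1 x)"
        "\<lambda>x. ((h0 (x+2+1) - h0 (x+2)) - (h0 (x+1+1) - h0 (x+1)))
            - ((h0 (x+1+1) - h0 (x+1)) - (h0 (x+1) - h0 x))"])
    fix x
    show "(h3 has_real_derivative h2 (x + 1) - h2 x) (at x)" by (rule h3)
    show "((\<lambda>x. h2 (x+1) - h2 x) has_real_derivative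
        (h1 (x+1+1) - h1 (x+1)) - (h1 (x+1) - h1 x)) (at x)"
      by (intro DERIV_diff h2 sh[of h2 "\<lambda>x. h1 (x+1) - h1 x"])
    have "((\<lambda>x. (h1 (x+2) - h1 (x+1)) - (h1 (x+1) - h1 x)) has_real_derivative
        ((h0 (x+2+1) - h0 (x+2)) - (h0 (x+1+1) - h0 (x+1)))
            - ((h0 (x+1+1) - h0 (x+1)) - (h0 (x+1) - h0 x))) (at x)"
      by (intro DERIV_diff h1 sh[of h1 "\<lambda>x. h0 (x+1) - h0 x"])
    then show "((\<lambda>x. (h1 (x+1+1) - h1 (x+1)) - (h1 (x+1) - h1 x)) has_real_derivative
        ((h0 (x+2+1) - h0 (x+2)) - (h0 (x+1+1) - h0 (x+1)))
            - ((h0 (x+1+1) - h0 (x+1)) - (h0 (x+1) - h0 x))) (at x)"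
      by (simp add: add.assoc)
    show "\<bar>h2 (x + 1) - h2 x\<bar> \<le> 8" using b2[of x] b2[of "x+1"] by linarith
    show "\<bar>(h1 (x+1+1) - h1 (x+1)) - (h1 (x+1) - h1 x)\<bar> \<le> 8"
      using b1[of x] b1[of "x+1"] b1[of "x+1+1"] by linarith
    show "\<bar>((h0 (x+2+1) - h0 (x+2)) - (h0 (x+1+1) - h0 (x+1)))
            - ((h0 (x+1+1) - h0 (x+1)) - (h0 (x+1) - h0 x))\<bar> \<le> 8"
      using b0[of x] b0[of "x+1"] b0[of "x+1+1"] b0[of "x+2"] b0[of "x+2+1"] by linarith
    show "0 \<le> h3 x" "h3 x \<le> 1" by (rule b3)+
    show "h3 x = 1" if "x \<in> A"
    proof -
      obtain y where y: "y \<in> {x..x+3}" "h3 x = h0 y" using val by blast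
      have "infdist y A \<le> dist y x" by (rule infdist_le[OF that])
      also have "\<dots> \<le> 3" using y by (auto simp: dist_real_def)
      finally show ?thesis by (simp add: y h0_def)
    qed
    show "\<exists>a\<in>A. \<bar>x - a\<bar> \<le> 8" if nz: "h3 x \<noteq> 0"
    proof -
      obtain y where y: "y \<in> {x..x+3}" "h3 x = h0 y" using val by blast
      have "infdist y A < 5" using nz by (auto simp: y h0_def max_def split: if_splits)
      then obtain a where "a \<in> A" "dist y a < 5"
        by (auto simp: infdist_def False cINF_less_iff split: if_splits)
      then show ?thesis using y by (intro bexI[of _ a]) (auto simp: dist_real_def)
    qed
  qed
qed

text \<open>Up to the constant ln 2 this is the log-sum-exp of the numbers z_a and -z_a, hence a
  smooth proxy for the maximum of the absolute values. The inverse temperature is not a parameter;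
  it enters by scaling the argument.\<close>

definition lncosh :: "'i set \<Rightarrow> ('i \<Rightarrow> real) \<Rightarrow> real" where
  "lncosh I z = ln (\<Sum>a\<in>I. cosh (z a))"

lemma sum_cosh_pos: "finite I \<Longrightarrow> I \<noteq> {} \<Longrightarrow> 0 < (\<Sum>a\<in>I. cosh (z a :: real))"
  by (intro sum_pos) (auto simp: cosh_real_pos)

lemma measurable_lncosh:
  assumes "\<And>a. a \<in> I \<Longrightarrow> (\<lambda>x. f x a) \<in> borel_measurable M"
  shows "(\<lambda>x. lncosh I (f x)) \<in> borel_measurable M"
proof -
  have "(\<lambda>x. cosh (f x a)) \<in> borel_measurable M" if "a \<in> I" for a
    unfolding cosh_field_def using assms[OF that] by measurable
  then show ?thesis unfolding lncosh_def by measurable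
qed

lemma abs_sinh_le_cosh: "\<bar>sinh (x::real)\<bar> \<le> cosh x"
  by (simp add: sinh_field_def cosh_field_def abs_le_iff field_simps)

text \<open>That is, ln cosh is 1-Lipschitz. Applied in both directions it keeps soft-max weights
  within a constant factor under a bounded move.\<close>

lemma cosh_add_le: "cosh (x + y :: real) \<le> exp \<bar>y\<bar> * cosh x"
proof -
  have "cosh (x + y) = (exp x * exp y + exp (-x) * exp (-y)) / 2"
    by (simp add: cosh_field_def mult_exp_exp)
  also have "\<dots> \<le> (exp x * exp \<bar>y\<bar> + exp (-x) * exp \<bar>y\<bar>) / 2"
    by (intro divide_right_mono add_mono mult_left_mono) auto
  also have "\<dots> = exp \<bar>y\<bar> * cosh x" by (simp add: cosh_field_def field_simps)
  finally show ?thesis .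
qed

text \<open>With m the maximum, the maximising summand alone contributes at least exp m / 2, and
  every summand is at most exp m. The two errors ln 2 and ln (card I) are merged into one symmetric
  bound.\<close>

lemma lncosh_approx_Max:
  assumes fin: "finite I" and ne: "I \<noteq> {}"
  shows "\<bar>lncosh I z - Max ((\<lambda>a. \<bar>z a\<bar>) ` I)\<bar> \<le> ln (2 * real (card I))"
proof -
  define m where "m = Max ((\<lambda>a. \<bar>z a\<bar>) ` I)"
  have le: "\<bar>z a\<bar> \<le> m" if "a \<in> I" for a unfolding m_def using fin that by auto
  have "m \<in> (\<lambda>a. \<bar>z a\<bar>) ` I" unfolding m_def by (intro Max_in) (use fin ne in auto)
  then obtain b where b: "b \<in> I" "m = \<bar>z b\<bar>" by auto
  have c1: "1 \<le> card I" using fin ne by (simp add: Suc_leI card_gt_0_iff)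
  have "exp m / 2 \<le> cosh (z b)"
    using b by (auto simp: cosh_field_def abs_if add_increasing add_increasing2)
  also have "\<dots> \<le> (\<Sum>a\<in>I. cosh (z a))"
    by (rule member_le_sum) (use b fin in \<open>auto simp: cosh_real_nonneg\<close>)
  finally have "ln (exp m / 2) \<le> lncosh I z"
    unfolding lncosh_def by (subst ln_le_cancel_iff) (auto simp: sum_cosh_pos fin ne)
  then have 1: "m - ln 2 \<le> lncosh I z" by (simp add: ln_div)
  have "cosh (z a) \<le> exp m" if "a \<in> I" for a
  proof -
    have "cosh (z a) \<le> exp \<bar>z a\<bar>" using cosh_add_le[of 0 "z a"] by simp
    also have "\<dots> \<le> exp m" using le[OF that] by simp
    finally show ?thesis .
  qed
  then have "(\<Sum>a\<in>I. cosh (z a)) \<le> real (card I) * exp m"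
    using sum_bounded_above[of I "\<lambda>a. cosh (z a)" "exp m"] by simp
  then have "lncosh I z \<le> ln (real (card I) * exp m)"
    unfolding lncosh_def using sum_cosh_pos[OF fin ne, of z] c1
    by (subst ln_le_cancel_iff) auto
  then have 2: "lncosh I z \<le> ln (real (card I)) + m"
    using c1 by (subst (asm) ln_mult) auto
  have "ln (2 * real (card I)) = ln 2 + ln (real (card I))" using c1 by (subst ln_mult) auto
  moreover have "0 \<le> ln (2::real)" "0 \<le> ln (real (card I))" using c1 by auto
  ultimately show ?thesis using 1 2 unfolding m_def[symmetric] by linarith
qed

text \<open>The second-order Taylor polynomial at 0, evaluated at 1, of s \<mapsto> H (lncosh I (z +
  s d)): l / u is the first derivative of \<open>lncosh\<close> along \<open>d\<close>, and the
  factor after the second \<open>H1 L\<close> is its second derivative. It is a polynomial of degree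
  two in \<open>d\<close>, so its expectation sees only means and covariances.\<close>

definition taylor2 :: "'i set \<Rightarrow> (real \<Rightarrow> real) \<Rightarrow> (real \<Rightarrow> real) \<Rightarrow> (real \<Rightarrow> real)
    \<Rightarrow> ('i \<Rightarrow> real) \<Rightarrow> ('i \<Rightarrow> real) \<Rightarrow> real" where
  "taylor2 I H H1 H2 z d =
    (let L = lncosh I z; u = \<Sum>a\<in>I. cosh (z a); l = \<Sum>a\<in>I. d a * sinh (z a) in
      H L + H1 L * (l / u)
      + (H2 L * (l / u)\<^sup>2 + H1 L * ((\<Sum>a\<in>I. (d a)\<^sup>2 * cosh (z a)) / u - (l / u)\<^sup>2)) / 2)"

text \<open>The weight \<open>q\<close> records how much of the mass of the sum sits on the coordinates that move.\<close>
lemma taylor_lncosh: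
  fixes H H1 H2 H3 :: "real \<Rightarrow> real" and z d :: "'i \<Rightarrow> real"
  assumes fin: "finite I" and ne: "I \<noteq> {}"
    and H: "\<And>x. (H has_real_derivative H1 x) (at x)" "\<And>x. (H1 has_real_derivative H2 x) (at x)"
      "\<And>x. (H2 has_real_derivative H3 x) (at x)"
    and D: "\<And>x. \<bar>H1 x\<bar> \<le> D" "\<And>x. \<bar>H2 x\<bar> \<le> D" "\<And>x. \<bar>H3 x\<bar> \<le> D"
    and q: "\<And>s. 0 \<le> s \<Longrightarrow> s \<le> 1 \<Longrightarrow> 0 \<le> q s" "\<And>s. 0 \<le> s \<Longrightarrow> s \<le> 1 \<Longrightarrow> q s \<le> 1"
      "\<And>s. 0 \<le> s \<Longrightarrow> s \<le> 1 \<Longrightarrow> q s \<le> Q"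
    and m: "0 \<le> m" "\<And>s k. 0 \<le> s \<Longrightarrow> s \<le> 1 \<Longrightarrow> k \<in> {1,2,3::nat} \<Longrightarrow>
      (\<Sum>a\<in>I. \<bar>d a\<bar> ^ k * cosh (z a + s * d a)) \<le> m ^ k * q s * (\<Sum>a\<in>I. cosh (z a + s * d a))"
  shows "\<bar>H (lncosh I (\<lambda>a. z a + d a)) - taylor2 I H H1 H2 z d\<bar> \<le> 13 / 6 * D * Q * m ^ 3"
proof -
  define v where "v s = (\<Sum>a\<in>I. cosh (z a + s * d a))" for s
  define v1 where "v1 s = (\<Sum>a\<in>I. d a * sinh (z a + s * d a))" for s
  define v2 where "v2 s = (\<Sum>a\<in>I. d a ^ 2 * cosh (z a + s * d a))" for s
  define v3 where "v3 s = (\<Sum>a\<in>I. d a ^ 3 * sinh (z a + s * d a))" for s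
  have vpos: "0 < v s" for s unfolding v_def by (rule sum_cosh_pos[OF fin ne])
  have dv: "(v has_real_derivative v1 s) (at s)" for s
    unfolding v_def[abs_def] v1_def by (auto intro!: derivative_eq_intros sum.cong)
  have dv1: "(v1 has_real_derivative v2 s) (at s)" for s
    unfolding v1_def[abs_def] v2_def
    by (auto intro!: derivative_eq_intros sum.cong simp: power2_eq_square)
  have dv2: "(v2 has_real_derivative v3 s) (at s)" for s
    unfolding v2_def[abs_def] v3_def
    by (auto intro!: derivative_eq_intros sum.cong simp: power2_eq_square power3_eq_cube)
  \<comment> \<open>\<open>R\<close>, \<open>R1\<close> and \<open>R2\<close> are the first three
    derivatives of ln v; they have the shape of cumulants built from the ratios v1 / v, v2 / v and
    v3 / v.\<close>
  define R where "R s = v1 s / v s" for s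
  define R1 where "R1 s = v2 s / v s - R s ^ 2" for s
  define R2 where "R2 s = v3 s / v s - 3 * R s * (v2 s / v s) + 2 * R s ^ 3" for s
  have dL: "((\<lambda>s. ln (v s)) has_real_derivative R s) (at s)" for s
    unfolding R_def using dv[of s] vpos[of s] by (auto intro!: derivative_eq_intros)
  have dR: "(R has_real_derivative R1 s) (at s)" for s
    unfolding R_def[abs_def] R1_def
    using dv[of s] dv1[of s] vpos[of s]
    by (auto intro!: derivative_eq_intros simp: field_simps power2_eq_square)
  have dR1: "(R1 has_real_derivative R2 s) (at s)" for s
  proof -
    have "((\<lambda>s. v2 s / v s) has_real_derivative v3 s / v s - R s * (v2 s / v s)) (at s)"
      using dv[of s] dv2[of s] vpos[of s]
      by (auto intro!: derivative_eq_intros simp: field_simps power2_eq_square R_def)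
    from DERIV_diff[OF this DERIV_power[OF dR, of 2]]
    show ?thesis unfolding R1_def[abs_def] R2_def
      by (simp add: R1_def algebra_simps power2_eq_square power3_eq_cube)
  qed
  define diff where "diff k s = (if k = 0 then H (ln (v s))
     else if k = 1 then H1 (ln (v s)) * R s
     else if k = 2 then H2 (ln (v s)) * R s ^ 2 + H1 (ln (v s)) * R1 s
     else H3 (ln (v s)) * R s ^ 3 + 3 * H2 (ln (v s)) * R s * R1 s + H1 (ln (v s)) * R2 s)"
    for k :: nat and s
  have dH: "((\<lambda>s. H (ln (v s))) has_real_derivative H1 (ln (v s)) * R s) (at s)"
    "((\<lambda>s. H1 (ln (v s))) has_real_derivative H2 (ln (v s)) * R s) (at s)"
    "((\<lambda>s. H2 (ln (v s))) has_real_derivative H3 (ln (v s)) * R s) (at s)" for s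
    using DERIV_chain2[OF H(1) dL] DERIV_chain2[OF H(2) dL] DERIV_chain2[OF H(3) dL] by auto
  have d0: "(diff 0 has_real_derivative diff 1 s) (at s)" for s
    unfolding diff_def[abs_def] using dH(1)[of s] by simp
  have d1: "(diff 1 has_real_derivative diff 2 s) (at s)" for s
    unfolding diff_def[abs_def]
    using DERIV_mult[OF dH(2)[of s] dR[of s]] by (simp add: power2_eq_square algebra_simps)
  have d2: "(diff 2 has_real_derivative diff 3 s) (at s)" for s
    unfolding diff_def[abs_def]
    using DERIV_add[OF DERIV_mult[OF dH(3)[of s] DERIV_power[OF dR[of s], of 2]]
        DERIV_mult[OF dH(2)[of s] dR1[of s]]]
    by (simp add: power2_eq_square power3_eq_cube algebra_simps)
  have "\<forall>k t. k < 3 \<and> 0 \<le> t \<and> t \<le> 1 \<longrightarrow> (diff k has_real_derivative diff (Suc k) t) (at t)"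
  proof (intro allI impI)
    fix k :: nat and t :: real assume "k < 3 \<and> 0 \<le> t \<and> t \<le> 1"
    then have "k = 0 \<or> k = 1 \<or> k = 2" by auto
    then show "(diff k has_real_derivative diff (Suc k) t) (at t)"
      using d0[of t] d1[of t] d2[of t] by (auto simp: numeral_2_eq_2 numeral_3_eq_3)
  qed
  then obtain s where s: "0 < s" "s < 1"
    and eq: "diff 0 1 = (\<Sum>k<3. diff k 0 / fact k * 1 ^ k) + diff 3 s / fact 3 * 1 ^ 3"
    using Maclaurin[of 1 3 diff "diff 0"] by auto
  have s01: "0 \<le> s" "s \<le> 1" using s by auto
  note q' = q(1)[OF s01] q(2)[OF s01]
  have bnd: "\<bar>(\<Sum>a\<in>I. d a ^ k * w a) / v s\<bar> \<le> m ^ k * q s"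
    if k: "k \<in> {1,2,3}" and w: "\<And>a. \<bar>w a\<bar> \<le> cosh (z a + s * d a)" for k w
  proof -
    have "\<bar>\<Sum>a\<in>I. d a ^ k * w a\<bar> \<le> (\<Sum>a\<in>I. \<bar>d a\<bar> ^ k * cosh (z a + s * d a))"
      by (rule order_trans[OF sum_abs]) (auto intro!: sum_mono mult_left_mono w simp: abs_mult power_abs)
    also have "\<dots> \<le> m ^ k * q s * v s" unfolding v_def by (rule m(2)[OF s01 k])
    finally show ?thesis using vpos[of s] by (simp add: abs_divide pos_divide_le_eq)
  qed
  have b1: "\<bar>R s\<bar> \<le> m * q s"
    using bnd[of 1 "\<lambda>a. sinh (z a + s * d a)"] abs_sinh_le_cosh by (simp add: R_def v1_def)
  have b2: "\<bar>v2 s / v s\<bar> \<le> m ^ 2 * q s"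
    using bnd[of 2 "\<lambda>a. cosh (z a + s * d a)"] by (simp add: v2_def cosh_real_nonneg)
  have b3: "\<bar>v3 s / v s\<bar> \<le> m ^ 3 * q s"
    using bnd[of 3 "\<lambda>a. sinh (z a + s * d a)"] abs_sinh_le_cosh by (simp add: v3_def)
  \<comment> \<open>A product of several ratios would carry q^2 or q^3. Using
    \<open>q s \<le> 1\<close> on all factors but one leaves every third-order term linear in q, the
    form in which the weights can later be summed to one.\<close>
  have mq: "m * q s \<le> m" using mult_left_mono[OF q'(2) m(1)] by simp
  have b1': "\<bar>R s\<bar> \<le> m" using b1 mq by linarith
  have "R s ^ 2 \<le> m * (m * q s)"
    unfolding power2_eq_square using mult_mono[OF b1' b1] m(1) by (simp add: abs_mult[symmetric])
  then have b1sq: "\<bar>R s ^ 2\<bar> \<le> m ^ 2 * q s" by (simp add: power2_eq_square mult.assoc)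
  have m2q: "m ^ 2 * q s \<le> m ^ 2" using mult_left_mono[OF q'(2), of "m ^ 2"] by simp
  have b1cu: "\<bar>R s ^ 3\<bar> \<le> m ^ 3 * q s"
    using mult_mono[OF b1' b1sq] m(1) by (simp add: abs_mult power3_eq_cube power2_eq_square mult.assoc)
  have r1: "\<bar>R1 s\<bar> \<le> 2 * (m ^ 2 * q s)" using b2 b1sq unfolding R1_def by linarith
  have r12: "\<bar>R s * R1 s\<bar> \<le> 2 * (m ^ 3 * q s)"
    using mult_mono[OF b1' r1] m(1) by (simp add: abs_mult power3_eq_cube power2_eq_square mult_ac)
  have r13: "\<bar>R s * (v2 s / v s)\<bar> \<le> m ^ 3 * q s"
    using mult_mono[OF b1' b2] m(1) by (simp add: abs_mult power3_eq_cube power2_eq_square mult_ac)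
  have r2: "\<bar>R2 s\<bar> \<le> 6 * (m ^ 3 * q s)"
    using b3 r13 b1cu unfolding R2_def mult.assoc[of 3] by linarith
  have D0: "0 \<le> D" using D(1)[of 0] by linarith
  have M0: "0 \<le> m ^ 3 * q s" using m(1) q' by simp
  \<comment> \<open>The three terms of the third derivative contribute 1, 3 * 2 and 6 (the last is 1
    + 3 + 2 from \<open>R2\<close>), so 13 in total; division by 3! gives the constant 13/6.\<close>
  have "\<bar>H3 (ln (v s)) * R s ^ 3\<bar> \<le> D * (m ^ 3 * q s)"
    unfolding abs_mult[of "H3 _"] by (intro mult_mono D b1cu D0) auto
  moreover have "\<bar>H2 (ln (v s)) * (R s * R1 s)\<bar> \<le> D * (2 * (m ^ 3 * q s))"
    unfolding abs_mult[of "H2 _"] by (intro mult_mono D r12 D0) auto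
  moreover have "\<bar>H1 (ln (v s)) * R2 s\<bar> \<le> D * (6 * (m ^ 3 * q s))"
    unfolding abs_mult[of "H1 _"] by (intro mult_mono D r2 D0) auto
  ultimately have "\<bar>diff 3 s\<bar> \<le> 13 * (D * (m ^ 3 * q s))"
    unfolding diff_def by (simp add: mult.assoc abs_le_iff)
  also have "\<dots> \<le> 13 * (D * (m ^ 3 * Q))"
    using q(3)[OF s01] D0 m(1) by (intro mult_left_mono) auto
  finally have fin3: "\<bar>diff 3 s / 6\<bar> \<le> 13 / 6 * D * Q * m ^ 3" by (simp add: field_simps)
  have e0: "v 0 = (\<Sum>a\<in>I. cosh (z a))" "v1 0 = (\<Sum>a\<in>I. d a * sinh (z a))"
    "v2 0 = (\<Sum>a\<in>I. (d a)\<^sup>2 * cosh (z a))" "ln (\<Sum>a\<in>I. cosh (z a)) = lncosh I z"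
    "ln (v 1) = lncosh I (\<lambda>a. z a + d a)"
    by (simp_all add: v_def v1_def v2_def lncosh_def)
  have "diff 0 1 - (diff 0 0 + diff 1 0 + diff 2 0 / 2) = diff 3 s / 6"
    unfolding eq by (simp add: eval_nat_numeral)
  moreover have "diff 0 1 = H (lncosh I (\<lambda>a. z a + d a))"
    "diff 0 0 + diff 1 0 + diff 2 0 / 2 = taylor2 I H H1 H2 z d"
    by (simp_all add: diff_def e0 R_def R1_def taylor2_def Let_def)
  ultimately show ?thesis using fin3 by linarith
qed

text \<open>If only coordinate \<open>b\<close> moves, the weight q is its soft-max weight along the
  segment. For a move of size at most one it is comparable to the initial weight, which gives the
  weighted cubic term. For a larger move q is bounded by one and the cube by the power
  \<open>nu\<close>, so the higher moment is charged for large moves only.\<close>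

lemma taylor_lncosh_single:
  fixes H H1 H2 H3 :: "real \<Rightarrow> real" and z d :: "'i \<Rightarrow> real"
  assumes fin: "finite I" and b: "b \<in> I" and d: "\<And>a. a \<in> I \<Longrightarrow> a \<noteq> b \<Longrightarrow> d a = 0"
    and H: "\<And>x. (H has_real_derivative H1 x) (at x)" "\<And>x. (H1 has_real_derivative H2 x) (at x)"
      "\<And>x. (H2 has_real_derivative H3 x) (at x)"
    and D: "\<And>x. \<bar>H1 x\<bar> \<le> D" "\<And>x. \<bar>H2 x\<bar> \<le> D" "\<And>x. \<bar>H3 x\<bar> \<le> D"
    and nu: "3 \<le> nu"
  shows "\<bar>H (lncosh I (\<lambda>a. z a + d a)) - taylor2 I H H1 H2 z d\<bar>
    \<le> 20 * D * (cosh (z b) / (\<Sum>a\<in>I. cosh (z a)) * \<bar>d b\<bar> ^ 3 + \<bar>d b\<bar> powr nu)"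
proof -
  have ne: "I \<noteq> {}" using b by auto
  define v where "v s = (\<Sum>a\<in>I. cosh (z a + s * d a))" for s
  have vpos: "0 < v s" for s unfolding v_def by (rule sum_cosh_pos[OF fin ne])
  define q where "q s = cosh (z b + s * d b) / v s" for s
  have q0: "0 \<le> q s" for s using vpos[of s] by (simp add: q_def cosh_real_nonneg)
  have q1: "q s \<le> 1" for s
    using vpos[of s] member_le_sum[of b I "\<lambda>a. cosh (z a + s * d a)"] b fin
    by (simp add: q_def v_def cosh_real_nonneg divide_le_eq)
  have sm: "(\<Sum>a\<in>I. \<bar>d a\<bar> ^ k * cosh (z a + s * d a)) \<le> \<bar>d b\<bar> ^ k * q s * (\<Sum>a\<in>I. cosh (z a + s * d a))"
    if "k \<in> {1,2,3::nat}" for k s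
  proof -
    have "(\<Sum>a\<in>I. \<bar>d a\<bar> ^ k * cosh (z a + s * d a)) = (\<Sum>a\<in>{b}. \<bar>d a\<bar> ^ k * cosh (z a + s * d a))"
      using d that b fin by (intro sum.mono_neutral_right) auto
    also have "\<dots> = \<bar>d b\<bar> ^ k * q s * v s" using vpos[of s] by (simp add: q_def)
    finally show ?thesis by (simp add: v_def)
  qed
  have D0: "0 \<le> D" using D(1)[of 0] by linarith
  note T = taylor_lncosh[where I=I and H=H and ?H1.0=H1 and ?H2.0=H2 and ?H3.0=H3 and D=D and q=q
      and m="\<bar>d b\<bar>" and z=z and d=d, OF fin ne H D q0 q1 _ abs_ge_zero sm]
  let ?p = "cosh (z b) / (\<Sum>a\<in>I. cosh (z a))"
  have p0: "0 \<le> ?p" by (simp add: cosh_real_nonneg sum_nonneg)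
  show ?thesis
  proof (cases "\<bar>d b\<bar> \<le> 1")
    case True
    \<comment> \<open>A factor e \<le> 3 is lost in the numerator and another in the denominator.
      The resulting constant 13/6 * 9 = 39/2 is rounded up to 20.\<close>
    have "q s \<le> 9 * ?p" if s: "0 \<le> s" "s \<le> 1" for s
    proof -
      have sd: "exp \<bar>s * d a\<bar> \<le> 3" if "a \<in> I" for a
      proof -
        have "\<bar>d a\<bar> \<le> 1" using True d[OF that] by (cases "a = b") auto
        then have "\<bar>s * d a\<bar> \<le> 1" using s mult_mono[of "\<bar>s\<bar>" 1 "\<bar>d a\<bar>" 1] by (simp add: abs_mult)
        then have "exp \<bar>s * d a\<bar> \<le> exp 1" by simp
        then show ?thesis using exp_le by linarith
      qed
      have "cosh (z b + s * d b) \<le> exp \<bar>s * d b\<bar> * cosh (z b)" by (rule cosh_add_le)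
      also have "\<dots> \<le> 3 * cosh (z b)" by (intro mult_right_mono sd b) (simp add: cosh_real_nonneg)
      finally have 1: "cosh (z b + s * d b) \<le> 3 * cosh (z b)" .
      have "cosh (z a) \<le> 3 * cosh (z a + s * d a)" if "a \<in> I" for a
      proof -
        have "cosh (z a) \<le> exp \<bar>s * d a\<bar> * cosh (z a + s * d a)"
          using cosh_add_le[of "z a + s * d a" "- (s * d a)"] by simp
        also have "\<dots> \<le> 3 * cosh (z a + s * d a)"
          by (intro mult_right_mono sd that) (simp add: cosh_real_nonneg)
        finally show ?thesis .
      qed
      then have "(\<Sum>a\<in>I. cosh (z a)) \<le> 3 * v s"
        unfolding v_def sum_distrib_left by (intro sum_mono)
      then have "q s \<le> (3 * cosh (z b)) / ((\<Sum>a\<in>I. cosh (z a)) / 3)"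
        unfolding q_def using 1 sum_cosh_pos[OF fin ne, of z]
        by (intro frac_le) (auto simp: cosh_real_nonneg)
      then show ?thesis by simp
    qed
    from T[OF this]
    have "\<bar>H (lncosh I (\<lambda>a. z a + d a)) - taylor2 I H H1 H2 z d\<bar> \<le> 13 / 6 * D * (9 * ?p) * \<bar>d b\<bar> ^ 3"
      by auto
    also have "\<dots> = 39 / 2 * (D * (?p * \<bar>d b\<bar> ^ 3))" by simp
    also have "\<dots> \<le> 20 * (D * (?p * \<bar>d b\<bar> ^ 3 + \<bar>d b\<bar> powr nu))"
    proof -
      have "0 \<le> ?p * \<bar>d b\<bar> ^ 3" by (intro mult_nonneg_nonneg p0) simp
      then have "0 \<le> D * (?p * \<bar>d b\<bar> ^ 3)" by (rule mult_nonneg_nonneg[OF D0])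
      moreover have "D * (?p * \<bar>d b\<bar> ^ 3) \<le> D * (?p * \<bar>d b\<bar> ^ 3 + \<bar>d b\<bar> powr nu)"
        by (intro mult_left_mono D0) simp
      ultimately show ?thesis by linarith
    qed
    finally show ?thesis by (simp add: mult.assoc)
  next
    case False
    have "\<bar>d b\<bar> ^ 3 = \<bar>d b\<bar> powr 3" using False by simp
    also have "\<dots> \<le> \<bar>d b\<bar> powr nu" using False nu by (intro powr_mono) auto
    finally have le: "\<bar>d b\<bar> ^ 3 \<le> \<bar>d b\<bar> powr nu" .
    have "\<bar>H (lncosh I (\<lambda>a. z a + d a)) - taylor2 I H H1 H2 z d\<bar> \<le> 13 / 6 * D * 1 * \<bar>d b\<bar> ^ 3"
      using T[OF q1] by auto
    also have "\<dots> = 13 / 6 * (D * \<bar>d b\<bar> ^ 3)" by simp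
    also have "\<dots> \<le> 20 * (D * (?p * \<bar>d b\<bar> ^ 3 + \<bar>d b\<bar> powr nu))"
    proof -
      have "0 \<le> ?p * \<bar>d b\<bar> ^ 3" by (intro mult_nonneg_nonneg p0) simp
      with le show ?thesis by (intro mult_mono mult_left_mono D0) (auto simp: D0)
    qed
    finally show ?thesis by (simp add: mult.assoc)
  qed
qed

text \<open>When all coordinates move, q = 1 and m is the largest move. Its cube is not a sum over
  coordinates, so it is split by 2 m^3 \<le> m^6 / c + c and m^6 is bounded by the sum of sixth
  powers, whose Gaussian expectation is explicit. The parameter \<open>c\<close> is left free for
  balancing.\<close>

lemma taylor_lncosh_full:
  fixes H H1 H2 H3 :: "real \<Rightarrow> real" and z d :: "'i \<Rightarrow> real"
  assumes fin: "finite I" and ne: "I \<noteq> {}"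
    and H: "\<And>x. (H has_real_derivative H1 x) (at x)" "\<And>x. (H1 has_real_derivative H2 x) (at x)"
      "\<And>x. (H2 has_real_derivative H3 x) (at x)"
    and D: "\<And>x. \<bar>H1 x\<bar> \<le> D" "\<And>x. \<bar>H2 x\<bar> \<le> D" "\<And>x. \<bar>H3 x\<bar> \<le> D"
    and c: "0 < c"
  shows "\<bar>H (lncosh I (\<lambda>a. z a + d a)) - taylor2 I H H1 H2 z d\<bar> \<le> 2 * D * ((\<Sum>a\<in>I. d a ^ 6) / c + c)"
proof -
  define m where "m = Max ((\<lambda>a. \<bar>d a\<bar>) ` I)"
  have le: "\<bar>d a\<bar> \<le> m" if "a \<in> I" for a unfolding m_def using fin that by auto
  have "m \<in> (\<lambda>a. \<bar>d a\<bar>) ` I" unfolding m_def by (intro Max_in) (use fin ne in auto)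
  then obtain b where b: "b \<in> I" "m = \<bar>d b\<bar>" by auto
  have m0: "0 \<le> m" using b by simp
  have "\<bar>H (lncosh I (\<lambda>a. z a + d a)) - taylor2 I H H1 H2 z d\<bar> \<le> 13 / 6 * D * 1 * m ^ 3"
  proof (rule taylor_lncosh[OF fin ne H D, where q="\<lambda>_. 1"])
    show "(\<Sum>a\<in>I. \<bar>d a\<bar> ^ k * cosh (z a + s * d a)) \<le> m ^ k * 1 * (\<Sum>a\<in>I. cosh (z a + s * d a))" for s k
      unfolding mult_1_right sum_distrib_left
      by (intro sum_mono mult_right_mono power_mono le) (auto simp: cosh_real_nonneg)
  qed (use m0 in auto)
  also have "13 / 6 * D * 1 * m ^ 3 \<le> 2 * D * ((\<Sum>a\<in>I. d a ^ 6) / c + c)"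
  proof -
    have "m ^ 6 = d b ^ 6" unfolding b(2) by (simp add: power_even_abs)
    also have "\<dots> \<le> (\<Sum>a\<in>I. d a ^ 6)" by (rule member_le_sum) (use b fin in auto)
    finally have m6: "m ^ 6 \<le> (\<Sum>a\<in>I. d a ^ 6)" .
    have "0 \<le> (m ^ 3 - c)\<^sup>2" by simp
    then have "2 * m ^ 3 * c \<le> m ^ 6 + c\<^sup>2"
      by (simp add: power2_diff power_mult[symmetric] algebra_simps)
    then have "2 * m ^ 3 \<le> m ^ 6 / c + c" using c by (simp add: field_simps power2_eq_square)
    also have "\<dots> \<le> (\<Sum>a\<in>I. d a ^ 6) / c + c" using m6 c by (intro add_mono divide_right_mono) auto
    finally have *: "2 * m ^ 3 \<le> (\<Sum>a\<in>I. d a ^ 6) / c + c" .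
    have D0: "0 \<le> D" using D(1)[of 0] by linarith
    have "13 / 6 * D * 1 * m ^ 3 \<le> 2 * D * (2 * m ^ 3)"
      using D0 m0 by (simp add: mult_right_mono)
    also have "\<dots> \<le> 2 * D * ((\<Sum>a\<in>I. d a ^ 6) / c + c)" using * D0 by (intro mult_left_mono) auto
    finally show ?thesis .
  qed
  finally show ?thesis .
qed

section \<open>Lindeberg replacement by Gaussian vectors\<close>

text \<open>The linear term is centred, and with diagonal covariance the squared linear form keeps
  only its diagonal part. The value involves the law of \<open>xi\<close> through \<open>v\<close>
  alone, so two laws with the same \<open>v\<close> cancel.\<close>

lemma (in prob_space) expectation_taylor2:
  fixes xi :: "'a \<Rightarrow> 'i \<Rightarrow> real"
  assumes fin: "finite I" and ne: "I \<noteq> {}"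
    and i1: "\<And>a. a \<in> I \<Longrightarrow> integrable M (\<lambda>x. xi x a)"
    and i2: "\<And>a b. a \<in> I \<Longrightarrow> b \<in> I \<Longrightarrow> integrable M (\<lambda>x. xi x a * xi x b)"
    and m1: "\<And>a. a \<in> I \<Longrightarrow> expectation (\<lambda>x. xi x a) = 0"
    and m2: "\<And>a b. a \<in> I \<Longrightarrow> b \<in> I \<Longrightarrow> expectation (\<lambda>x. xi x a * xi x b) = (if a = b then v else 0)"
  shows "has_bochner_integral M (\<lambda>x. taylor2 I H H1 H2 z (xi x))
    (let L = lncosh I z; u = \<Sum>a\<in>I. cosh (z a); s = v * (\<Sum>a\<in>I. (sinh (z a))\<^sup>2) / u\<^sup>2 in
      H L + (H2 L * s + H1 L * (v - s)) / 2)"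
proof -
  define u where "u = (\<Sum>a\<in>I. cosh (z a))"
  have u: "0 < u" unfolding u_def by (rule sum_cosh_pos[OF fin ne])
  have hb: "has_bochner_integral M (\<lambda>x. xi x a) 0" if "a \<in> I" for a
    using i1[OF that] m1[OF that] by (simp add: has_bochner_integral_iff)
  have hb2: "has_bochner_integral M (\<lambda>x. xi x a * xi x b) (if a = b then v else 0)"
    if "a \<in> I" "b \<in> I" for a b
    using i2[OF that] m2[OF that] by (simp add: has_bochner_integral_iff)
  have l1: "has_bochner_integral M (\<lambda>x. \<Sum>a\<in>I. xi x a * sinh (z a)) (\<Sum>a\<in>I. 0 * sinh (z a))"
    by (intro has_bochner_integral_sum has_bochner_integral_mult_left hb)
  have l2: "has_bochner_integral M (\<lambda>x. \<Sum>a\<in>I. \<Sum>b\<in>I. xi x a * xi x b * (sinh (z a) * sinh (z b)))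
     (\<Sum>a\<in>I. \<Sum>b\<in>I. (if a = b then v else 0) * (sinh (z a) * sinh (z b)))"
    by (intro has_bochner_integral_sum has_bochner_integral_mult_left hb2)
  have e2: "(\<Sum>a\<in>I. \<Sum>b\<in>I. (if a = b then v else 0) * (sinh (z a) * sinh (z b)))
      = v * (\<Sum>a\<in>I. (sinh (z a))\<^sup>2)"
    unfolding sum_distrib_left
    by (intro sum.cong refl) (simp add: fin if_distrib[of "\<lambda>x. x * _"] sum.delta' power2_eq_square cong: if_cong)
  have sq: "(\<Sum>a\<in>I. \<Sum>b\<in>I. xi x a * xi x b * (sinh (z a) * sinh (z b))) = (\<Sum>a\<in>I. xi x a * sinh (z a))\<^sup>2" for x
    unfolding power2_eq_square sum_product by (intro sum.cong refl) simp
  have l3: "has_bochner_integral M (\<lambda>x. \<Sum>a\<in>I. xi x a * xi x a * cosh (z a))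
     (\<Sum>a\<in>I. (if a = a then v else 0) * cosh (z a))"
    by (intro has_bochner_integral_sum has_bochner_integral_mult_left hb2)
  have e3: "(\<Sum>a\<in>I. (if a = a then v else 0) * cosh (z a)) = v * u"
    by (simp add: u_def sum_distrib_left)
  let ?L = "lncosh I z"
  have "has_bochner_integral M (\<lambda>x. H ?L + H1 ?L * ((\<Sum>a\<in>I. xi x a * sinh (z a)) / u)
      + (H2 ?L * ((\<Sum>a\<in>I. xi x a * sinh (z a))\<^sup>2 / u\<^sup>2)
        + H1 ?L * ((\<Sum>a\<in>I. xi x a * xi x a * cosh (z a)) / u - (\<Sum>a\<in>I. xi x a * sinh (z a))\<^sup>2 / u\<^sup>2)) / 2)
     (H ?L + H1 ?L * (0 / u) + (H2 ?L * (v * (\<Sum>a\<in>I. (sinh (z a))\<^sup>2) / u\<^sup>2)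
        + H1 ?L * (v * u / u - v * (\<Sum>a\<in>I. (sinh (z a))\<^sup>2) / u\<^sup>2)) / 2)"
  proof (intro has_bochner_integral_add has_bochner_integral_mult_right
      has_bochner_integral_divide_zero has_bochner_integral_diff)
    show "has_bochner_integral M (\<lambda>x. H ?L) (H ?L)"
      by (simp add: has_bochner_integral_iff prob_space)
    show "has_bochner_integral M (\<lambda>x. \<Sum>a\<in>I. xi x a * sinh (z a)) 0" using l1 by simp
    show "has_bochner_integral M (\<lambda>x. (\<Sum>a\<in>I. xi x a * sinh (z a))\<^sup>2) (v * (\<Sum>a\<in>I. (sinh (z a))\<^sup>2))"
      using l2 unfolding e2 sq .
    then show "has_bochner_integral M (\<lambda>x. (\<Sum>a\<in>I. xi x a * sinh (z a))\<^sup>2) (v * (\<Sum>a\<in>I. (sinh (z a))\<^sup>2))" .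
    show "has_bochner_integral M (\<lambda>x. \<Sum>a\<in>I. xi x a * xi x a * cosh (z a)) (v * u)"
      using l3 unfolding e3 .
  qed
  then show ?thesis using u
    by (simp add: taylor2_def Let_def u_def[symmetric] power_divide power2_eq_square)
qed

text \<open>Random vectors with the same mean and covariance have the same expected second-order expansion,
  so only the remainders enter.\<close>
lemma lindeberg_step:
  fixes xi :: "'x \<Rightarrow> 'i \<Rightarrow> real" and ze :: "'y \<Rightarrow> 'i \<Rightarrow> real"
  assumes fin: "finite I" and ne: "I \<noteq> {}"
    and P: "prob_space P" and G: "prob_space G"
    and H: "H \<in> borel_measurable borel" "\<And>x. \<bar>H x\<bar> \<le> 1"
    and Pi1: "\<And>a. a \<in> I \<Longrightarrow> integrable P (\<lambda>x. xi x a)"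
    and Pi2: "\<And>a b. a \<in> I \<Longrightarrow> b \<in> I \<Longrightarrow> integrable P (\<lambda>x. xi x a * xi x b)"
    and Pm1: "\<And>a. a \<in> I \<Longrightarrow> (\<integral>x. xi x a \<partial>P) = 0"
    and Pm2: "\<And>a b. a \<in> I \<Longrightarrow> b \<in> I \<Longrightarrow> (\<integral>x. xi x a * xi x b \<partial>P) = (if a = b then v else 0)"
    and Gi1: "\<And>a. a \<in> I \<Longrightarrow> integrable G (\<lambda>x. ze x a)"
    and Gi2: "\<And>a b. a \<in> I \<Longrightarrow> b \<in> I \<Longrightarrow> integrable G (\<lambda>x. ze x a * ze x b)"
    and Gm1: "\<And>a. a \<in> I \<Longrightarrow> (\<integral>x. ze x a \<partial>G) = 0"
    and Gm2: "\<And>a b. a \<in> I \<Longrightarrow> b \<in> I \<Longrightarrow> (\<integral>x. ze x a * ze x b \<partial>G) = (if a = b then v else 0)"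
    and PB: "integrable P B" "\<And>x. \<bar>H (lncosh I (\<lambda>a. z a + xi x a)) - taylor2 I H H1 H2 z (xi x)\<bar> \<le> B x"
    and GB: "integrable G C" "\<And>x. \<bar>H (lncosh I (\<lambda>a. z a + ze x a)) - taylor2 I H H1 H2 z (ze x)\<bar> \<le> C x"
  shows "\<bar>(\<integral>x. H (lncosh I (\<lambda>a. z a + xi x a)) \<partial>P) - (\<integral>x. H (lncosh I (\<lambda>a. z a + ze x a)) \<partial>G)\<bar>
     \<le> (\<integral>x. B x \<partial>P) + (\<integral>x. C x \<partial>G)"
proof -
  interpret P: prob_space P by fact
  interpret G: prob_space G by fact
  define val where "val = (let L = lncosh I z; u = \<Sum>a\<in>I. cosh (z a);
      s = v * (\<Sum>a\<in>I. (sinh (z a))\<^sup>2) / u\<^sup>2 in H L + (H2 L * s + H1 L * (v - s)) / 2)"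
  have p: "has_bochner_integral P (\<lambda>x. taylor2 I H H1 H2 z (xi x)) val"
    unfolding val_def by (rule P.expectation_taylor2[OF fin ne Pi1 Pi2 Pm1 Pm2])
  have g: "has_bochner_integral G (\<lambda>x. taylor2 I H H1 H2 z (ze x)) val"
    unfolding val_def by (rule G.expectation_taylor2[OF fin ne Gi1 Gi2 Gm1 Gm2])
  have eq: "(\<integral>x. taylor2 I H H1 H2 z (xi x) \<partial>P) = (\<integral>x. taylor2 I H H1 H2 z (ze x) \<partial>G)"
    using has_bochner_integral_integral_eq[OF p] has_bochner_integral_integral_eq[OF g] by simp
  have "(\<lambda>x. lncosh I (\<lambda>a. z a + xi x a)) \<in> borel_measurable P"
    using Pi1 by (intro measurable_lncosh) auto
  then have ip: "integrable P (\<lambda>x. H (lncosh I (\<lambda>a. z a + xi x a)))"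
    using H by (intro P.integrable_const_bound[where B=1]) auto
  have "(\<lambda>x. lncosh I (\<lambda>a. z a + ze x a)) \<in> borel_measurable G"
    using Gi1 by (intro measurable_lncosh) auto
  then have ig: "integrable G (\<lambda>x. H (lncosh I (\<lambda>a. z a + ze x a)))"
    using H by (intro G.integrable_const_bound[where B=1]) auto
  have tp: "integrable P (\<lambda>x. taylor2 I H H1 H2 z (xi x))" using p by (simp add: has_bochner_integral_iff)
  have tg: "integrable G (\<lambda>x. taylor2 I H H1 H2 z (ze x))" using g by (simp add: has_bochner_integral_iff)
  have "\<bar>\<integral>x. H (lncosh I (\<lambda>a. z a + xi x a)) - taylor2 I H H1 H2 z (xi x) \<partial>P\<bar> \<le> (\<integral>x. B x \<partial>P)"
    by (rule order_trans[OF integral_abs_bound integral_mono])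
      (use ip tp PB in \<open>auto intro!: Bochner_Integration.integrable_diff\<close>)
  moreover have "\<bar>\<integral>x. H (lncosh I (\<lambda>a. z a + ze x a)) - taylor2 I H H1 H2 z (ze x) \<partial>G\<bar> \<le> (\<integral>x. C x \<partial>G)"
    by (rule order_trans[OF integral_abs_bound integral_mono])
      (use ig tg GB in \<open>auto intro!: Bochner_Integration.integrable_diff\<close>)
  ultimately show ?thesis using ip tp ig tg eq by simp
qed

section \<open>Products of standard normals: rotation invariance, moments, and the iterated
  exchange\<close>

abbreviation std_normal :: "real measure" where
  "std_normal \<equiv> density lborel (\<lambda>z. ennreal (std_normal_density z))"

lemma prob_space_std_normal: "prob_space std_normal"
  by (rule prob_space_normal_density) simp

text \<open>The two coordinates are independent, so the sum is normal with variance a^2 + b^2 = 1.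
  This is what splits one Gaussian off a Gaussian of larger scale.\<close>

lemma std_normal_rotate:
  assumes a: "0 < a" and b: "0 < b" and ab: "a\<^sup>2 + b\<^sup>2 = 1"
  shows "distr (std_normal \<Otimes>\<^sub>M std_normal) borel (\<lambda>(x, y). a * x + b * y) = std_normal"
proof -
  interpret N: prob_space std_normal by (rule prob_space_std_normal)
  interpret NN: pair_prob_space std_normal std_normal ..
  let ?P = "std_normal \<Otimes>\<^sub>M std_normal"
  have f: "distr ?P borel fst = std_normal"
  proof (rule measure_eqI)
    fix A assume "A \<in> sets (distr ?P borel fst)"
    then have A: "A \<in> sets borel" by simp
    have "fst -` A \<inter> space ?P = A \<times> UNIV" by (auto simp: space_pair_measure)
    then have "emeasure (distr ?P borel fst) A = emeasure ?P (A \<times> UNIV)"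
      using A by (subst emeasure_distr) auto
    also have "\<dots> = emeasure std_normal A"
      using A N.emeasure_space_1 by (subst N.emeasure_pair_measure_Times) auto
    finally show "emeasure (distr ?P borel fst) A = emeasure std_normal A" .
  qed simp
  have s: "distr ?P borel snd = std_normal"
  proof (rule measure_eqI)
    fix A assume "A \<in> sets (distr ?P borel snd)"
    then have A: "A \<in> sets borel" by simp
    have "snd -` A \<inter> space ?P = UNIV \<times> A" by (auto simp: space_pair_measure)
    then have "emeasure (distr ?P borel snd) A = emeasure ?P (UNIV \<times> A)"
      using A by (subst emeasure_distr) auto
    also have "\<dots> = emeasure std_normal A"
      using A N.emeasure_space_1 by (subst N.emeasure_pair_measure_Times) auto
    finally show "emeasure (distr ?P borel snd) A = emeasure std_normal A" .
  qed simp
  have id: "distr ?P (borel \<Otimes>\<^sub>M borel) (\<lambda>x. (fst x, snd x)) = ?P"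
    by (simp add: distr_id2 cong: sets_pair_measure_cong)
  have lb: "distr ?P lborel h = distr ?P borel h" for h :: "real \<times> real \<Rightarrow> real"
    by (rule distr_cong) auto
  have "NN.indep_var borel fst borel snd"
    unfolding NN.indep_var_distribution_eq f s id by auto
  then have ind: "NN.indep_var borel (\<lambda>p. 0 + a * fst p) borel (\<lambda>p. 0 + b * snd p)"
    using NN.indep_var_compose[of borel fst borel snd "\<lambda>x. 0 + a * x" borel "\<lambda>x. 0 + b * x" borel]
    by (simp add: comp_def)
  have "distributed ?P lborel fst (normal_density 0 1)"
    unfolding distributed_def using f lb by auto
  from NN.normal_density_affine[OF this, of a 0]
  have dx: "distributed ?P lborel (\<lambda>p. 0 + a * fst p) (normal_density 0 a)" using a by simp
  have "distributed ?P lborel snd (normal_density 0 1)"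
    unfolding distributed_def using s lb by auto
  from NN.normal_density_affine[OF this, of b 0]
  have dy: "distributed ?P lborel (\<lambda>p. 0 + b * snd p) (normal_density 0 b)" using b by simp
  from NN.add_indep_normal[OF ind a b dx dy] ab
  have "distributed ?P lborel (\<lambda>p. a * fst p + b * snd p) (normal_density 0 1)" by simp
  then show ?thesis
    unfolding distributed_def by (auto simp: split_beta' lb)
qed

text \<open>A finite product measure is determined by its values on boxes. There the indicator is a
  product over coordinates, and the iterated integral factors into one-dimensional instances of
  \<open>std_normal_rotate\<close>.\<close>

lemma PiM_std_normal_rotate:
  assumes fin: "finite I" and a: "0 < a" and b: "0 < b" and ab: "a\<^sup>2 + b\<^sup>2 = 1"
  defines "G \<equiv> PiM I (\<lambda>_. std_normal)"
  shows "distr (G \<Otimes>\<^sub>M G) G (\<lambda>(g, h). \<lambda>i\<in>I. a * g i + b * h i) = G"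
proof -
  interpret N: prob_space std_normal by (rule prob_space_std_normal)
  interpret NN: pair_prob_space std_normal std_normal ..
  interpret S: product_prob_space "\<lambda>_. std_normal" I ..
  interpret G: prob_space G unfolding G_def by (rule prob_space_PiM) (rule prob_space_std_normal)
  have m[measurable]: "(\<lambda>(g, h). \<lambda>i\<in>I. a * g i + b * h i) \<in> G \<Otimes>\<^sub>M G \<rightarrow>\<^sub>M G"
    unfolding G_def by measurable
  show ?thesis unfolding G_def
  proof (rule S.PiM_eqI[OF fin])
    fix A :: "'a \<Rightarrow> real set" assume A: "\<And>i. i \<in> I \<Longrightarrow> A i \<in> sets std_normal"
    have Am[measurable]: "\<And>i. i \<in> I \<Longrightarrow> A i \<in> sets borel" using A by simp
    have AG[measurable]: "Pi\<^sub>E I A \<in> sets G" unfolding G_def by (rule sets_PiM_I_finite[OF fin A])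
    have ind: "indicator (Pi\<^sub>E I A) (\<lambda>i\<in>I. f i) = (\<Prod>i\<in>I. indicator (A i) (f i) :: ennreal)" for f
    proof (cases "\<forall>i\<in>I. f i \<in> A i")
      case False
      then obtain i where "i \<in> I" "f i \<notin> A i" by auto
      then have "(\<Prod>i\<in>I. indicator (A i) (f i) :: ennreal) = 0"
        by (intro prod_zero[OF fin] bexI[of _ i]) auto
      moreover have "(\<lambda>i\<in>I. f i) \<notin> Pi\<^sub>E I A" using \<open>i \<in> I\<close> \<open>f i \<notin> A i\<close> by auto
      ultimately show ?thesis by simp
    qed (simp add: indicator_def)
    have "emeasure (distr (G \<Otimes>\<^sub>M G) G (\<lambda>(g, h). \<lambda>i\<in>I. a * g i + b * h i)) (Pi\<^sub>E I A)
       = (\<integral>\<^sup>+x. indicator (Pi\<^sub>E I A) x \<partial>distr (G \<Otimes>\<^sub>M G) G (\<lambda>(g, h). \<lambda>i\<in>I. a * g i + b * h i))"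
      by simp
    also have "\<dots> = (\<integral>\<^sup>+p. indicator (Pi\<^sub>E I A) (case p of (g, h) \<Rightarrow> \<lambda>i\<in>I. a * g i + b * h i) \<partial>(G \<Otimes>\<^sub>M G))"
      by (rule nn_integral_distr) measurable
    also have "\<dots> = (\<integral>\<^sup>+g. \<integral>\<^sup>+h. indicator (Pi\<^sub>E I A) (\<lambda>i\<in>I. a * g i + b * h i) \<partial>G \<partial>G)"
      by (subst G.nn_integral_fst[symmetric]) auto
    also have "\<dots> = (\<integral>\<^sup>+g. \<integral>\<^sup>+h. (\<Prod>i\<in>I. indicator (A i) (a * g i + b * h i)) \<partial>G \<partial>G)"
      unfolding ind ..
    also have "\<dots> = (\<integral>\<^sup>+g. (\<Prod>i\<in>I. \<integral>\<^sup>+y. indicator (A i) (a * g i + b * y) \<partial>std_normal) \<partial>G)"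
      unfolding G_def by (intro nn_integral_cong S.product_nn_integral_prod fin) measurable
    also have "\<dots> = (\<Prod>i\<in>I. \<integral>\<^sup>+x. \<integral>\<^sup>+y. indicator (A i) (a * x + b * y) \<partial>std_normal \<partial>std_normal)"
      unfolding G_def by (rule S.product_nn_integral_prod[OF fin]) measurable
    also have "\<dots> = (\<Prod>i\<in>I. emeasure std_normal (A i))"
    proof (rule prod.cong[OF refl])
      fix i assume i: "i \<in> I"
      note [measurable] = Am[OF i]
      have "(\<integral>\<^sup>+x. \<integral>\<^sup>+y. indicator (A i) (a * x + b * y) \<partial>std_normal \<partial>std_normal)
        = (\<integral>\<^sup>+p. indicator (A i) (case p of (x, y) \<Rightarrow> a * x + b * y) \<partial>(std_normal \<Otimes>\<^sub>M std_normal))"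
        by (subst N.nn_integral_fst[symmetric]) auto
      also have "\<dots> = (\<integral>\<^sup>+x. indicator (A i) x \<partial>distr (std_normal \<Otimes>\<^sub>M std_normal) borel (\<lambda>(x, y). a * x + b * y))"
        by (rule nn_integral_distr[symmetric]) measurable
      also have "\<dots> = emeasure std_normal (A i)"
        unfolding std_normal_rotate[OF a b ab] by simp
      finally show "(\<integral>\<^sup>+x. \<integral>\<^sup>+y. indicator (A i) (a * x + b * y) \<partial>std_normal \<partial>std_normal)
        = emeasure std_normal (A i)" .
    qed
    finally show "emeasure (distr (Pi\<^sub>M I (\<lambda>_. std_normal) \<Otimes>\<^sub>M Pi\<^sub>M I (\<lambda>_. std_normal)) (Pi\<^sub>M I (\<lambda>_. std_normal))
        (\<lambda>(g, h). \<lambda>i\<in>I. a * g i + b * h i)) (Pi\<^sub>E I A) = (\<Prod>i\<in>I. emeasure std_normal (A i))"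
      unfolding G_def .
  qed simp
qed

text \<open>The first two items match the moments of the data vectors; the sixth moment 15 = 5 * 3 *
  1 serves the remainder in \<open>taylor_lncosh_full\<close>.\<close>

lemma PiM_std_normal_moments:
  assumes fin: "finite I"
  defines "G \<equiv> PiM I (\<lambda>_. std_normal)"
  shows "\<And>i. i \<in> I \<Longrightarrow> has_bochner_integral G (\<lambda>g. g i) 0"
    and "\<And>i j. i \<in> I \<Longrightarrow> j \<in> I \<Longrightarrow> has_bochner_integral G (\<lambda>g. g i * g j) (if i = j then 1 else 0)"
    and "\<And>i. i \<in> I \<Longrightarrow> has_bochner_integral G (\<lambda>g. g i ^ 6) 15"
proof -
  interpret N: prob_space std_normal by (rule prob_space_std_normal)
  interpret S: product_prob_space "\<lambda>_. std_normal" I ..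
  have N1: "has_bochner_integral std_normal (\<lambda>x. x) 0"
    using std_normal_moment_odd[of 0]
    by (simp add: has_bochner_integral_density)
  have N2: "has_bochner_integral std_normal (\<lambda>x. x * x) 1"
    using std_normal_moment_even[of 1]
    by (simp add: has_bochner_integral_density power2_eq_square)
  have N6: "has_bochner_integral std_normal (\<lambda>x. x ^ 6) 15"
    using std_normal_moment_even[of 3]
    by (simp add: has_bochner_integral_density fact_numeral)
  have comp: "has_bochner_integral G (\<lambda>g. f (g i)) v"
    if i: "i \<in> I" and f: "has_bochner_integral std_normal f v" for i v and f :: "real \<Rightarrow> real"
  proof -
    have d: "distr G std_normal (\<lambda>g. g i) = std_normal"
      unfolding G_def by (rule distr_PiM_component[OF prob_space_std_normal i])
    have m: "(\<lambda>g. g i) \<in> G \<rightarrow>\<^sub>M std_normal" unfolding G_def using i by measurable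
    have "f \<in> borel_measurable std_normal" using f by (auto simp: has_bochner_integral_iff)
    with integrable_distr_eq[OF m, of f] integral_distr[OF m, of f] f show ?thesis
      unfolding d by (simp add: has_bochner_integral_iff)
  qed
  show "has_bochner_integral G (\<lambda>g. g i) 0" if "i \<in> I" for i by (rule comp[OF that N1])
  show "has_bochner_integral G (\<lambda>g. g i ^ 6) 15" if "i \<in> I" for i by (rule comp[OF that N6])
  show "has_bochner_integral G (\<lambda>g. g i * g j) (if i = j then 1 else 0)" if ij: "i \<in> I" "j \<in> I" for i j
  proof (cases "i = j")
    case True
    then show ?thesis using comp[OF ij(1) N2] by simp
  next
    case False
    \<comment> \<open>Padding with the constant 1 outside {i, j} writes the mixed moment as a
      product over all of \<open>I\<close>, so that the product formula for integrals applies and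
      the factor at \<open>i\<close> vanishes.\<close>
    define f :: "'a \<Rightarrow> real \<Rightarrow> real" where "f k = (if k = i \<or> k = j then (\<lambda>x. x) else (\<lambda>_. 1))" for k
    have int: "integrable std_normal (f k)" for k using N1 by (auto simp: f_def has_bochner_integral_iff)
    have pr: "(\<Prod>k\<in>I. f k (g k)) = g i * g j" for g
    proof -
      have "(\<Prod>k\<in>I. f k (g k)) = (\<Prod>k\<in>{i, j}. f k (g k))"
        using ij fin by (intro prod.mono_neutral_right) (auto simp: f_def)
      then show ?thesis using False by (simp add: f_def)
    qed
    have "(\<integral>g. (\<Prod>k\<in>I. f k (g k)) \<partial>G) = (\<Prod>k\<in>I. \<integral>x. f k x \<partial>std_normal)"
      unfolding G_def by (rule S.product_integral_prod[OF fin int])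
    also have "\<dots> = 0"
      using N1 ij by (intro prod_zero[OF fin] bexI[of _ i]) (auto simp: f_def has_bochner_integral_iff)
    finally have "(\<integral>g. g i * g j \<partial>G) = 0" unfolding pr .
    moreover have "integrable G (\<lambda>g. g i * g j)"
      using S.product_integrable_prod[of I f, OF fin int] unfolding pr G_def .
    ultimately show ?thesis using False by (simp add: has_bochner_integral_iff)
  qed
qed

text \<open>Induction on the number of summands with \<open>z\<close> arbitrary. With the other
  summands frozen into the base point, the last one is exchanged at cost \<open>e\<close>; the
  induction hypothesis then applies at the base point shifted by the new Gaussian. Uniformity of
  \<open>step\<close> in \<open>z\<close> is what makes both moves legitimate.\<close>

lemma lindeberg_iterate:
  fixes xi :: "'x \<Rightarrow> 'i \<Rightarrow> real" and H :: "real \<Rightarrow> real"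
  assumes fin: "finite I" and P: "prob_space P"
    and xi: "\<And>a. a \<in> I \<Longrightarrow> (\<lambda>x. xi x a) \<in> borel_measurable P"
    and H: "H \<in> borel_measurable borel" "\<And>x. \<bar>H x\<bar> \<le> 1"
  defines "G \<equiv> PiM I (\<lambda>_. std_normal)"
  assumes step: "\<And>z. \<bar>(\<integral>x. H (lncosh I (\<lambda>a. z a + xi x a)) \<partial>P)
      - (\<integral>g. H (lncosh I (\<lambda>a. z a + \<kappa> * g a)) \<partial>G)\<bar> \<le> e"
  shows "\<bar>(\<integral>x. H (lncosh I (\<lambda>a. z a + (\<Sum>j<n. xi (x j) a))) \<partial>PiM {..<n} (\<lambda>_. P))
      - (\<integral>g. H (lncosh I (\<lambda>a. z a + \<kappa> * sqrt (real n) * g a)) \<partial>G)\<bar> \<le> real n * e"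
proof (induction n arbitrary: z)
  case 0
  interpret P: prob_space P by fact
  interpret S: product_prob_space "\<lambda>_. P" "{}" ..
  interpret G: prob_space G unfolding G_def by (rule prob_space_PiM) (rule prob_space_std_normal)
  show ?case by (simp add: G.prob_space S.P.prob_space)
next
  case (Suc n)
  interpret P: prob_space P by fact
  interpret S: product_prob_space "\<lambda>_. P" "{..<Suc n}" ..
  interpret G: prob_space G unfolding G_def by (rule prob_space_PiM) (rule prob_space_std_normal)
  define X where "X = PiM {..<n} (\<lambda>_. P)"
  interpret X: prob_space X unfolding X_def by (rule prob_space_PiM) (rule P)
  interpret XG: pair_prob_space X G ..
  interpret GG: pair_prob_space G G ..
  define F where "F z = H (lncosh I z)" for z
  have Fm: "(\<lambda>x. F (f x)) \<in> borel_measurable M"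
    if "\<And>a. a \<in> I \<Longrightarrow> (\<lambda>x. f x a) \<in> borel_measurable M" for f :: "'y \<Rightarrow> 'i \<Rightarrow> real" and M
    unfolding F_def using measurable_compose[OF measurable_lncosh[OF that] H(1)] .
  have Fb: "\<bar>F z\<bar> \<le> 1" for z unfolding F_def by (rule H)
  note [measurable] = xi
  define s where "s x a = (\<Sum>j<n. xi (x j) a)" for x a
  have sm[measurable]: "(\<lambda>x. s x a) \<in> borel_measurable X" if "a \<in> I" for a
    unfolding s_def X_def using that by measurable
  have gm[measurable]: "(\<lambda>g. g a) \<in> borel_measurable G" if "a \<in> I" for a
    unfolding G_def using measurable_component_singleton[OF that, of "\<lambda>_. std_normal"] by simp
  have "(\<integral>x. F (\<lambda>a. z a + (\<Sum>j<Suc n. xi (x j) a)) \<partial>PiM {..<Suc n} (\<lambda>_. P))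
      = (\<integral>x. (\<integral>y. F (\<lambda>a. z a + (\<Sum>j<Suc n. xi ((x(n := y)) j) a)) \<partial>P) \<partial>X)"
    unfolding lessThan_Suc X_def
  proof (rule S.product_integral_insert)
    interpret Y: prob_space "PiM (insert n {..<n}) (\<lambda>_. P)" by (rule prob_space_PiM) (rule P)
    show "integrable (PiM (insert n {..<n}) (\<lambda>_. P)) (\<lambda>x. F (\<lambda>a. z a + (\<Sum>j\<in>insert n {..<n}. xi (x j) a)))"
      by (rule Y.integrable_const_bound[where B=1]) (use Fb in \<open>auto intro!: Fm\<close>)
  qed auto
  also have "\<dots> = (\<integral>x. (\<integral>y. F (\<lambda>a. (z a + s x a) + xi y a) \<partial>P) \<partial>X)"
    by (simp add: s_def add.assoc)
  finally have data: "(\<integral>x. F (\<lambda>a. z a + (\<Sum>j<Suc n. xi (x j) a)) \<partial>PiM {..<Suc n} (\<lambda>_. P))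
      = (\<integral>x. (\<integral>y. F (\<lambda>a. (z a + s x a) + xi y a) \<partial>P) \<partial>X)" .
  have gauss: "(\<integral>g. F (\<lambda>a. z a + \<kappa> * sqrt (real (Suc n)) * g a) \<partial>G)
     = (\<integral>h. (\<integral>g. F (\<lambda>a. (z a + \<kappa> * h a) + \<kappa> * sqrt (real n) * g a) \<partial>G) \<partial>G)"
  \<comment> \<open>\<open>PiM_std_normal_rotate\<close> wants positive coefficients, whereas a = 0
    for n = 0. In general the weights are a^2 = n / (n+1) and b^2 = 1 / (n+1).\<close>
  proof (cases "n = 0")
    case True
    then show ?thesis by (simp add: G.prob_space)
  next
    case False
    define a where "a = sqrt (real n) / sqrt (real (Suc n))"
    define b where "b = 1 / sqrt (real (Suc n))"
    have ab: "0 < a" "0 < b" "a\<^sup>2 + b\<^sup>2 = 1"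
      using False by (auto simp: a_def b_def power_divide add_divide_distrib[symmetric])
    have "(\<integral>g. F (\<lambda>i. z i + \<kappa> * sqrt (real (Suc n)) * g i) \<partial>G)
      = (\<integral>g. F (\<lambda>i. z i + \<kappa> * sqrt (real (Suc n)) * g i)
          \<partial>distr (G \<Otimes>\<^sub>M G) G (\<lambda>(g, h). \<lambda>i\<in>I. b * g i + a * h i))"
      unfolding G_def using ab by (subst PiM_std_normal_rotate[OF fin]) (auto simp: add.commute)
    also have "\<dots> = (\<integral>p. F (\<lambda>i. z i + \<kappa> * sqrt (real (Suc n)) * ((case p of (g, h) \<Rightarrow> \<lambda>i\<in>I. b * g i + a * h i) i)) \<partial>(G \<Otimes>\<^sub>M G))"
    proof (rule integral_distr)
      show "(\<lambda>(g, h). \<lambda>i\<in>I. b * g i + a * h i) \<in> G \<Otimes>\<^sub>M G \<rightarrow>\<^sub>M G"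
        unfolding G_def by measurable
    qed (intro Fm, measurable)
    also have "\<dots> = (\<integral>p. (case p of (h, g) \<Rightarrow> F (\<lambda>i. (z i + \<kappa> * h i) + \<kappa> * sqrt (real n) * g i)) \<partial>(G \<Otimes>\<^sub>M G))"
    proof (intro Bochner_Integration.integral_cong refl)
      fix p :: "('i \<Rightarrow> real) \<times> ('i \<Rightarrow> real)"
      \<comment> \<open>The rotated vector is restricted to \<open>I\<close>, so the two arguments
        agree only there; \<open>lncosh I\<close> reads no other coordinate.\<close>
      have eqc: "cosh (z i + \<kappa> * sqrt (real (Suc n)) * ((case p of (g, h) \<Rightarrow> \<lambda>i\<in>I. b * g i + a * h i) i))
         = cosh ((z i + \<kappa> * fst p i) + \<kappa> * sqrt (real n) * snd p i)" if "i \<in> I" for i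
      proof -
        have "sqrt (real (Suc n)) * b = 1" "sqrt (real (Suc n)) * a = sqrt (real n)"
          by (simp_all add: a_def b_def)
        then have "\<kappa> * sqrt (real (Suc n)) * (b * fst p i + a * snd p i)
            = \<kappa> * fst p i + \<kappa> * sqrt (real n) * snd p i"
          by (metis (no_types, opaque_lifting) distrib_left mult.assoc mult.left_neutral)
        then show ?thesis using that by (simp add: split_beta add.assoc)
      qed
      show "F (\<lambda>i. z i + \<kappa> * sqrt (real (Suc n)) * ((case p of (g, h) \<Rightarrow> \<lambda>i\<in>I. b * g i + a * h i) i))
        = (case p of (h, g) \<Rightarrow> F (\<lambda>i. (z i + \<kappa> * h i) + \<kappa> * sqrt (real n) * g i))"
        unfolding F_def lncosh_def split_beta
        by (rule arg_cong[where f="\<lambda>t. H (ln t)"], rule sum.cong[OF refl],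
            use eqc in \<open>simp only: split_beta\<close>)
    qed
    also have "\<dots> = (\<integral>h. (\<integral>g. F (\<lambda>a. (z a + \<kappa> * h a) + \<kappa> * sqrt (real n) * g a) \<partial>G) \<partial>G)"
      unfolding split_beta'
      by (subst GG.integral_fst'[symmetric])
        (use Fb in \<open>auto intro!: Fm GG.integrable_const_bound[where B=1]\<close>)
    finally show ?thesis .
  qed
  \<comment> \<open>With the Gaussian as the outer variable, the inner integral is over the
    \<open>n\<close> remaining summands, which is the form of the induction hypothesis.\<close>
  have swap: "(\<integral>x. (\<integral>g. F (\<lambda>a. (z a + s x a) + \<kappa> * g a) \<partial>G) \<partial>X)
     = (\<integral>g. (\<integral>x. F (\<lambda>a. (z a + \<kappa> * g a) + s x a) \<partial>X) \<partial>G)"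
  proof -
    have "integrable (X \<Otimes>\<^sub>M G) (\<lambda>(x, g). F (\<lambda>a. (z a + s x a) + \<kappa> * g a))"
      unfolding split_beta' using Fb by (intro XG.integrable_const_bound[where B=1] Fm AE_I2) auto
    from XG.Fubini_integral[OF this] show ?thesis by (simp add: add_ac)
  qed
  have b1: "\<bar>(\<integral>x. (\<integral>y. F (\<lambda>a. (z a + s x a) + xi y a) \<partial>P) \<partial>X)
      - (\<integral>x. (\<integral>g. F (\<lambda>a. (z a + s x a) + \<kappa> * g a) \<partial>G) \<partial>X)\<bar> \<le> e"
  proof -
    have m1: "(\<lambda>x. \<integral>y. F (\<lambda>a. (z a + s x a) + xi y a) \<partial>P) \<in> borel_measurable X"
      by (intro P.borel_measurable_lebesgue_integral) (auto simp: split_beta' intro!: Fm)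
    have i1: "integrable X (\<lambda>x. \<integral>y. F (\<lambda>a. (z a + s x a) + xi y a) \<partial>P)"
    proof (rule X.integrable_const_bound[where B=1, OF AE_I2 m1])
      fix x
      have "integrable P (\<lambda>y. F (\<lambda>a. (z a + s x a) + xi y a))"
        using Fb by (intro P.integrable_const_bound[where B=1] Fm AE_I2) auto
      then show "norm (\<integral>y. F (\<lambda>a. (z a + s x a) + xi y a) \<partial>P) \<le> 1"
        using P.integral_le_const[of "\<lambda>y. \<bar>F (\<lambda>a. (z a + s x a) + xi y a)\<bar>" 1] Fb
        by (intro order_trans[OF integral_norm_bound]) auto
    qed
    have m2: "(\<lambda>x. \<integral>g. F (\<lambda>a. (z a + s x a) + \<kappa> * g a) \<partial>G) \<in> borel_measurable X"
      by (intro G.borel_measurable_lebesgue_integral) (auto simp: split_beta' intro!: Fm)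
    have i2: "integrable X (\<lambda>x. \<integral>g. F (\<lambda>a. (z a + s x a) + \<kappa> * g a) \<partial>G)"
    proof (rule X.integrable_const_bound[where B=1, OF AE_I2 m2])
      fix x
      have "integrable G (\<lambda>g. F (\<lambda>a. (z a + s x a) + \<kappa> * g a))"
        using Fb by (intro G.integrable_const_bound[where B=1] Fm AE_I2) auto
      then show "norm (\<integral>g. F (\<lambda>a. (z a + s x a) + \<kappa> * g a) \<partial>G) \<le> 1"
        using G.integral_le_const[of "\<lambda>g. \<bar>F (\<lambda>a. (z a + s x a) + \<kappa> * g a)\<bar>" 1] Fb
        by (intro order_trans[OF integral_norm_bound]) auto
    qed
    let ?d = "\<lambda>x. (\<integral>y. F (\<lambda>a. (z a + s x a) + xi y a) \<partial>P) - (\<integral>g. F (\<lambda>a. (z a + s x a) + \<kappa> * g a) \<partial>G)"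
    have "\<bar>\<integral>x. ?d x \<partial>X\<bar> \<le> (\<integral>x. \<bar>?d x\<bar> \<partial>X)" by (rule integral_abs_bound)
    also have "\<dots> \<le> e"
      using i1 i2 step by (intro X.integral_le_const) (auto simp: F_def)
    finally show ?thesis using i1 i2 by simp
  qed
  have b2: "\<bar>(\<integral>g. (\<integral>x. F (\<lambda>a. (z a + \<kappa> * g a) + s x a) \<partial>X) \<partial>G)
      - (\<integral>h. (\<integral>g. F (\<lambda>a. (z a + \<kappa> * h a) + \<kappa> * sqrt (real n) * g a) \<partial>G) \<partial>G)\<bar> \<le> real n * e"
  proof -
    have m1: "(\<lambda>g. \<integral>x. F (\<lambda>a. (z a + \<kappa> * g a) + s x a) \<partial>X) \<in> borel_measurable G"
      by (intro X.borel_measurable_lebesgue_integral) (auto simp: split_beta' intro!: Fm)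
    have i1: "integrable G (\<lambda>g. \<integral>x. F (\<lambda>a. (z a + \<kappa> * g a) + s x a) \<partial>X)"
    proof (rule G.integrable_const_bound[where B=1, OF AE_I2 m1])
      fix g
      have "integrable X (\<lambda>x. F (\<lambda>a. (z a + \<kappa> * g a) + s x a))"
        using Fb by (intro X.integrable_const_bound[where B=1] Fm AE_I2) auto
      then show "norm (\<integral>x. F (\<lambda>a. (z a + \<kappa> * g a) + s x a) \<partial>X) \<le> 1"
        using X.integral_le_const[of "\<lambda>x. \<bar>F (\<lambda>a. (z a + \<kappa> * g a) + s x a)\<bar>" 1] Fb
        by (intro order_trans[OF integral_norm_bound]) auto
    qed
    have m2: "(\<lambda>h. \<integral>g. F (\<lambda>a. (z a + \<kappa> * h a) + \<kappa> * sqrt (real n) * g a) \<partial>G) \<in> borel_measurable G"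
      by (intro G.borel_measurable_lebesgue_integral) (auto simp: split_beta' intro!: Fm)
    have i2: "integrable G (\<lambda>h. \<integral>g. F (\<lambda>a. (z a + \<kappa> * h a) + \<kappa> * sqrt (real n) * g a) \<partial>G)"
    proof (rule G.integrable_const_bound[where B=1, OF AE_I2 m2])
      fix h
      have "integrable G (\<lambda>g. F (\<lambda>a. (z a + \<kappa> * h a) + \<kappa> * sqrt (real n) * g a))"
        using Fb by (intro G.integrable_const_bound[where B=1] Fm AE_I2) auto
      then show "norm (\<integral>g. F (\<lambda>a. (z a + \<kappa> * h a) + \<kappa> * sqrt (real n) * g a) \<partial>G) \<le> 1"
        using G.integral_le_const[of "\<lambda>g. \<bar>F (\<lambda>a. (z a + \<kappa> * h a) + \<kappa> * sqrt (real n) * g a)\<bar>" 1] Fb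
        by (intro order_trans[OF integral_norm_bound]) auto
    qed
    let ?d = "\<lambda>g. (\<integral>x. F (\<lambda>a. (z a + \<kappa> * g a) + s x a) \<partial>X)
      - (\<integral>h. F (\<lambda>a. (z a + \<kappa> * g a) + \<kappa> * sqrt (real n) * h a) \<partial>G)"
    have IH: "\<bar>?d g\<bar> \<le> real n * e" for g
      using Suc.IH[of "\<lambda>a. z a + \<kappa> * g a"] by (simp add: F_def s_def X_def)
    have "\<bar>\<integral>g. ?d g \<partial>G\<bar> \<le> (\<integral>g. \<bar>?d g\<bar> \<partial>G)" by (rule integral_abs_bound)
    also have "\<dots> \<le> real n * e"
      using i1 i2 IH by (intro G.integral_le_const) auto
    finally show ?thesis using i1 i2 by simp
  qed
  have "\<bar>(\<integral>x. F (\<lambda>a. z a + (\<Sum>j<Suc n. xi (x j) a)) \<partial>PiM {..<Suc n} (\<lambda>_. P))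
      - (\<integral>g. F (\<lambda>a. z a + \<kappa> * sqrt (real (Suc n)) * g a) \<partial>G)\<bar> \<le> real (Suc n) * e"
    using b1 b2 unfolding data gauss swap by (simp add: algebra_simps)
  then show ?case unfolding F_def .
qed

text \<open>The summands are scaled by \<open>\<kappa>\<close>, so that n of them add up to (l / r)
  times the normalised sum. Dividing \<open>lncosh\<close> by \<open>l\<close> then measures
  everything in units of \<open>r\<close>, with soft-max error at most one unit. The additive term
  is n times the one-step error.\<close>

lemma gaussian_comparison_max:
  fixes ze :: "'x \<Rightarrow> 'i \<Rightarrow> real"
  assumes fin: "finite I" and ne: "I \<noteq> {}" and P: "prob_space P"
    and zm: "\<And>a. a \<in> I \<Longrightarrow> (\<lambda>x. ze x a) \<in> borel_measurable P"
    and single: "\<And>x. \<exists>b\<in>I. \<forall>a\<in>I. a \<noteq> b \<longrightarrow> ze x a = 0"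
    and i1: "\<And>a. a \<in> I \<Longrightarrow> integrable P (\<lambda>x. ze x a)"
    and i2: "\<And>a. a \<in> I \<Longrightarrow> integrable P (\<lambda>x. (ze x a)\<^sup>2)"
    and i3: "\<And>a. a \<in> I \<Longrightarrow> integrable P (\<lambda>x. \<bar>ze x a\<bar> ^ 3)"
    and inu: "\<And>a. a \<in> I \<Longrightarrow> integrable P (\<lambda>x. \<bar>ze x a\<bar> powr nu)"
    and m1: "\<And>a. a \<in> I \<Longrightarrow> (\<integral>x. ze x a \<partial>P) = 0"
    and m2: "\<And>a. a \<in> I \<Longrightarrow> (\<integral>x. (ze x a)\<^sup>2 \<partial>P) = 1"
    and m3: "\<And>a. a \<in> I \<Longrightarrow> (\<integral>x. \<bar>ze x a\<bar> ^ 3 \<partial>P) \<le> M3"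
    and mnu: "(\<Sum>a\<in>I. \<integral>x. \<bar>ze x a\<bar> powr nu \<partial>P) \<le> Mnu"
    and nu: "3 \<le> nu" and n: "0 < n" and r: "0 < r" and l1: "1 \<le> ln (2 * real (card I))"
  defines "l \<equiv> ln (2 * real (card I))"
  defines "\<kappa> \<equiv> l / (r * sqrt (real n))"
  defines "T \<equiv> \<lambda>x. Max ((\<lambda>a. \<bar>(\<Sum>j<n. ze (x j) a) / sqrt (real n)\<bar>) ` I)"
  defines "S \<equiv> \<lambda>g. Max ((\<lambda>a. \<bar>g a\<bar>) ` I)"
  defines "X \<equiv> PiM {..<n} (\<lambda>_. P)" and "G \<equiv> PiM I (\<lambda>_. std_normal)"
  assumes A1: "{x\<in>space X. T x \<in> A} \<in> sets X" and A2: "{g\<in>space G. \<exists>a\<in>A. \<bar>S g - a\<bar> \<le> 10 * r} \<in> sets G"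
  shows "measure X {x\<in>space X. T x \<in> A} \<le> measure G {g\<in>space G. \<exists>a\<in>A. \<bar>S g - a\<bar> \<le> 10 * r}
    + real n * (8 / l) * (20 * (M3 * \<kappa> ^ 3 + Mnu * \<kappa> powr nu) + 32 * (\<kappa> ^ 3 * sqrt (real (card I))))"
proof -
  interpret P: prob_space P by fact
  interpret G: prob_space G unfolding G_def by (rule prob_space_PiM) (rule prob_space_std_normal)
  interpret X: prob_space X unfolding X_def by (rule prob_space_PiM) (rule P)
  have l: "1 \<le> l" using l1 by (simp add: l_def)
  have sn: "0 < sqrt (real n)" using n by simp
  have k0: "0 < \<kappa>" using l r sn by (simp add: \<kappa>_def)
  define N where "N = real (card I)"
  have N0: "0 < N" using fin ne by (simp add: N_def card_gt_0_iff)
  \<comment> \<open>\<open>A\<close> in units of \<open>r\<close>, enlarged by the soft-max error: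
    if T x lies in \<open>A\<close>, the rescaled soft maximum lies in \<open>B\<close>, where
    \<open>g\<close> equals 1.\<close>
  define B where "B = {y. \<exists>a\<in>A. \<bar>y - a / r\<bar> \<le> 1}"
  obtain g g1 g2 g3 where
    g: "\<And>x. (g has_real_derivative g1 x) (at x)" "\<And>x. (g1 has_real_derivative g2 x) (at x)"
      "\<And>x. (g2 has_real_derivative g3 x) (at x)"
    and gb: "\<And>x. \<bar>g1 x\<bar> \<le> 8" "\<And>x. \<bar>g2 x\<bar> \<le> 8" "\<And>x. \<bar>g3 x\<bar> \<le> 8"
    and g01: "\<And>x. 0 \<le> g x" "\<And>x. g x \<le> 1" and gB: "\<And>x. x \<in> B \<Longrightarrow> g x = 1"
    and gnB: "\<And>x. g x \<noteq> 0 \<Longrightarrow> \<exists>a\<in>B. \<bar>x - a\<bar> \<le> 8"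
    using smooth_indicator[of B] by blast
  define D where "D = 8 / l"
  have D0: "0 \<le> D" using l by (simp add: D_def)
  \<comment> \<open>Each derivative brings a factor 1 / l; as l \<ge> 1, the single constant D = 8 /
    l bounds all three.\<close>
  define H where "H x = g (x / l)" for x
  define H1 where "H1 x = g1 (x / l) / l" for x
  define H2 where "H2 x = g2 (x / l) / l / l" for x
  define H3 where "H3 x = g3 (x / l) / l / l / l" for x
  have ch: "((\<lambda>x. f (x / l)) has_real_derivative f' (x / l) / l) (at x)"
    if "\<And>x. (f has_real_derivative f' x) (at x)" for f f' :: "real \<Rightarrow> real" and x
  proof -
    have "((\<lambda>x. x / l) has_real_derivative 1 / l) (at x)" using l by (auto intro!: derivative_eq_intros)
    from DERIV_chain2[where f=f and g="\<lambda>x. x / l", OF that this] show ?thesis by simp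
  qed
  have H: "(H has_real_derivative H1 x) (at x)" "(H1 has_real_derivative H2 x) (at x)"
    "(H2 has_real_derivative H3 x) (at x)" for x
    unfolding H_def[abs_def] H1_def[abs_def] H2_def[abs_def] H3_def
    using ch[OF g(1)] DERIV_cdivide[OF ch[OF g(2)], of l] DERIV_cdivide[OF DERIV_cdivide[OF ch[OF g(3)], of l], of l]
    by simp_all
  have dl: "\<bar>y / l\<bar> \<le> \<bar>y\<bar>" for y using l by (simp add: divide_le_eq mult_le_cancel_left1)
  have Db1: "\<bar>H1 x\<bar> \<le> D" for x using gb(1)[of "x / l"] l by (simp add: H1_def D_def divide_right_mono)
  have Db2: "\<bar>H2 x\<bar> \<le> D" for x
  proof -
    have "\<bar>H2 x\<bar> \<le> \<bar>g2 (x / l) / l\<bar>" unfolding H2_def by (rule dl)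
    also have "\<dots> \<le> D" using gb(2)[of "x / l"] l by (simp add: D_def divide_right_mono)
    finally show ?thesis .
  qed
  have Db3: "\<bar>H3 x\<bar> \<le> D" for x
  proof -
    have "\<bar>H3 x\<bar> \<le> \<bar>g3 (x / l) / l / l\<bar>" unfolding H3_def by (rule dl)
    also have "\<dots> \<le> \<bar>g3 (x / l) / l\<bar>" by (rule dl)
    also have "\<dots> \<le> D" using gb(3)[of "x / l"] l by (simp add: D_def divide_right_mono)
    finally show ?thesis .
  qed
  have "continuous_on UNIV H"
    using H(1) by (meson DERIV_isCont continuous_at_imp_continuous_on)
  then have Hm: "H \<in> borel_measurable borel" by (rule borel_measurable_continuous_onI)
  have Hb: "\<bar>H x\<bar> \<le> 1" for x using g01[of "x / l"] by (simp add: H_def)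
  define xi where "xi x a = \<kappa> * ze x a" for x a
  have xim: "(\<lambda>x. xi x a) \<in> borel_measurable P" if "a \<in> I" for a
    unfolding xi_def using zm[OF that] by measurable
  have cross: "ze x a * ze x b = 0" if "a \<in> I" "b \<in> I" "a \<noteq> b" for x a b
    using single[of x] that by (metis mult_eq_0_iff)
  \<comment> \<open>At most one coordinate of \<open>ze x\<close> is nonzero, so off-diagonal
    products vanish pointwise and the covariance is exactly a multiple of the identity.\<close>
  have pr: "xi x a * xi x b = \<kappa>\<^sup>2 * (if a = b then (ze x a)\<^sup>2 else 0)" if "a \<in> I" "b \<in> I" for x a b
    using cross[of a b x] that by (auto simp: xi_def power2_eq_square)
  note gmom = PiM_std_normal_moments[OF fin, folded G_def]
  \<comment> \<open>This balances the two terms of \<open>taylor_lncosh_full\<close>: since c^2 =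
    \<kappa>^6 N, the expected sum of sixth powers divided by c is 15 c, and the total is 2 D (15 c
    + c) = 32 D c.\<close>
  define c where "c = \<kappa> ^ 3 * sqrt N"
  have c0: "0 < c" using k0 N0 by (simp add: c_def)
  have step: "\<bar>(\<integral>x. H (lncosh I (\<lambda>a. z a + xi x a)) \<partial>P) - (\<integral>g. H (lncosh I (\<lambda>a. z a + \<kappa> * g a)) \<partial>G)\<bar>
     \<le> D * (20 * (M3 * \<kappa> ^ 3 + Mnu * \<kappa> powr nu) + 32 * c)" (is "_ \<le> ?e") for z
  proof -
    define w where "w a = cosh (z a) / (\<Sum>b\<in>I. cosh (z b))" for a
    have w0: "0 \<le> w a" for a by (simp add: w_def cosh_real_nonneg sum_nonneg)
    have w1: "sum w I = 1"
      using sum_cosh_pos[OF fin ne, of z] by (simp add: w_def sum_divide_distrib[symmetric])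
    \<comment> \<open>The moving coordinate depends on x; summing over all coordinates removes this
      dependence. In the cubic part the weights make the sum cost no more than the largest third
      moment, while the \<open>nu\<close> part is summed over all coordinates without
      weights.\<close>
    define Bp where "Bp x = 20 * D * ((\<Sum>a\<in>I. w a * \<bar>xi x a\<bar> ^ 3) + (\<Sum>a\<in>I. \<bar>xi x a\<bar> powr nu))" for x
    define Bg where "Bg y = 2 * D * ((\<Sum>a\<in>I. (\<kappa> * y a) ^ 6) / c + c)" for y
    have "\<bar>(\<integral>x. H (lncosh I (\<lambda>a. z a + xi x a)) \<partial>P) - (\<integral>g. H (lncosh I (\<lambda>a. z a + \<kappa> * g a)) \<partial>G)\<bar>
       \<le> (\<integral>x. Bp x \<partial>P) + (\<integral>y. Bg y \<partial>G)"
    proof (rule lindeberg_step[where xi=xi and ze="\<lambda>g a. \<kappa> * g a" and v="\<kappa>\<^sup>2" and ?H1.0=H1 and ?H2.0=H2, OF fin ne P G.prob_space_axioms Hm Hb])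
      show "integrable P (\<lambda>x. xi x a)" if "a \<in> I" for a unfolding xi_def using i1[OF that] by simp
      show "integrable P (\<lambda>x. xi x a * xi x b)" if "a \<in> I" "b \<in> I" for a b
        unfolding pr[OF that] using i2[OF that(1)] by (cases "a = b") simp_all
      show "(\<integral>x. xi x a \<partial>P) = 0" if "a \<in> I" for a unfolding xi_def using m1[OF that] by simp
      show "(\<integral>x. xi x a * xi x b \<partial>P) = (if a = b then \<kappa>\<^sup>2 else 0)" if "a \<in> I" "b \<in> I" for a b
        unfolding pr[OF that] using m2[OF that(1)] by (cases "a = b") simp_all
      show "integrable G (\<lambda>g. \<kappa> * g a)" "(\<integral>g. \<kappa> * g a \<partial>G) = 0" if "a \<in> I" for a
        using gmom(1)[OF that] by (auto simp: has_bochner_integral_iff)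
      have e: "\<kappa> * g a * (\<kappa> * g b) = \<kappa>\<^sup>2 * (g a * g b)" for g :: "'i \<Rightarrow> real" and a b
        by (simp add: power2_eq_square)
      show "integrable G (\<lambda>g. \<kappa> * g a * (\<kappa> * g b))"
        "(\<integral>g. \<kappa> * g a * (\<kappa> * g b) \<partial>G) = (if a = b then \<kappa>\<^sup>2 else 0)" if "a \<in> I" "b \<in> I" for a b
        unfolding e using gmom(2)[OF that] by (auto simp: has_bochner_integral_iff)
      have "integrable P (\<lambda>x. \<bar>xi x a\<bar> ^ 3)" "integrable P (\<lambda>x. \<bar>xi x a\<bar> powr nu)" if "a \<in> I" for a
        using i3[OF that] inu[OF that] k0 by (simp_all add: xi_def abs_mult power_mult_distrib powr_mult)
      then show "integrable P Bp" unfolding Bp_def by auto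
      show "integrable G Bg" unfolding Bg_def power_mult_distrib
        using gmom(3) by (auto simp: has_bochner_integral_iff)
      show "\<bar>H (lncosh I (\<lambda>a. z a + xi x a)) - taylor2 I H H1 H2 z (xi x)\<bar> \<le> Bp x" for x
      proof -
        obtain b where b: "b \<in> I" "\<And>a. a \<in> I \<Longrightarrow> a \<noteq> b \<Longrightarrow> xi x a = 0"
          using single[of x] by (auto simp: xi_def)
        have "\<bar>H (lncosh I (\<lambda>a. z a + xi x a)) - taylor2 I H H1 H2 z (xi x)\<bar>
            \<le> 20 * D * (w b * \<bar>xi x b\<bar> ^ 3 + \<bar>xi x b\<bar> powr nu)"
          unfolding w_def by (rule taylor_lncosh_single[OF fin b H Db1 Db2 Db3 nu])
        also have "\<dots> \<le> Bp x" unfolding Bp_def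
          by (intro mult_left_mono add_mono member_le_sum[of b I "\<lambda>a. w a * \<bar>xi x a\<bar> ^ 3"] member_le_sum[of b I "\<lambda>a. \<bar>xi x a\<bar> powr nu"])
            (use b fin w0 D0 in auto)
        finally show ?thesis .
      qed
      show "\<bar>H (lncosh I (\<lambda>a. z a + \<kappa> * y a)) - taylor2 I H H1 H2 z (\<lambda>a. \<kappa> * y a)\<bar> \<le> Bg y" for y
        unfolding Bg_def by (rule taylor_lncosh_full[OF fin ne H Db1 Db2 Db3 c0])
    qed
    moreover have "(\<integral>x. Bp x \<partial>P) \<le> D * (20 * (M3 * \<kappa> ^ 3 + Mnu * \<kappa> powr nu))"
    proof -
      have "(\<integral>x. Bp x \<partial>P) = 20 * D * ((\<Sum>a\<in>I. w a * (\<kappa> ^ 3 * (\<integral>x. \<bar>ze x a\<bar> ^ 3 \<partial>P)))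
          + (\<Sum>a\<in>I. \<kappa> powr nu * (\<integral>x. \<bar>ze x a\<bar> powr nu \<partial>P)))"
        unfolding Bp_def xi_def using i3 inu k0
        by (simp add: abs_mult power_mult_distrib powr_mult)
      also have "\<dots> \<le> 20 * D * ((\<Sum>a\<in>I. w a * (\<kappa> ^ 3 * M3)) + \<kappa> powr nu * Mnu)"
        unfolding sum_distrib_left[symmetric, of "\<kappa> powr nu"]
        using D0 w0 k0 m3 mnu by (intro mult_left_mono add_mono sum_mono) auto
      also have "(\<Sum>a\<in>I. w a * (\<kappa> ^ 3 * M3)) = \<kappa> ^ 3 * M3"
        unfolding sum_distrib_right[symmetric] w1 by simp
      finally show ?thesis by (simp add: mult_ac)
    qed
    moreover have "(\<integral>y. Bg y \<partial>G) = D * (32 * c)"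
    proof -
      have "(\<integral>y. Bg y \<partial>G) = 2 * D * ((\<Sum>a\<in>I. \<kappa> ^ 6 * 15) / c + c)"
        unfolding Bg_def power_mult_distrib using gmom(3)
        by (simp add: has_bochner_integral_iff G.prob_space)
      moreover have "(\<Sum>a\<in>I. \<kappa> ^ 6 * 15) / c = 15 * c"
      proof -
        have "c * c = \<kappa> ^ 6 * N" using N0 by (simp add: c_def algebra_simps power_add[symmetric] real_sqrt_mult_self)
        then show ?thesis using c0 by (simp add: N_def[symmetric] field_simps)
      qed
      ultimately show ?thesis by simp
    qed
    ultimately show ?thesis by (simp add: distrib_left)
  qed
  have kn: "\<kappa> * sqrt (real n) = l / r" using sn by (simp add: \<kappa>_def)
  have iter: "\<bar>(\<integral>x. H (lncosh I (\<lambda>a. 0 + (\<Sum>j<n. xi (x j) a))) \<partial>X)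
      - (\<integral>g. H (lncosh I (\<lambda>a. 0 + \<kappa> * sqrt (real n) * g a)) \<partial>G)\<bar> \<le> real n * ?e"
    unfolding X_def G_def
    by (rule lindeberg_iterate[where z="\<lambda>_. 0", OF fin P xim Hm Hb step[unfolded G_def]])
  have Max_scale: "Max ((\<lambda>a. \<bar>s * f a\<bar>) ` I) = s * Max ((\<lambda>a. \<bar>f a\<bar>) ` I)" if "0 < s" for s :: real and f
  proof -
    have "mono (\<lambda>x. s * x)" using that by (auto intro!: monoI mult_left_mono)
    then have "s * Max ((\<lambda>a. \<bar>f a\<bar>) ` I) = Max ((\<lambda>x. s * x) ` (\<lambda>a. \<bar>f a\<bar>) ` I)"
      using fin ne by (intro mono_Max_commute) auto
    then show ?thesis using that by (simp add: image_image abs_mult)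
  qed
  have close: "\<bar>lncosh I (\<lambda>a. l / r * f a) / l - Max ((\<lambda>a. \<bar>f a\<bar>) ` I) / r\<bar> \<le> 1" for f
  proof -
    have "\<bar>lncosh I (\<lambda>a. l / r * f a) - l / r * Max ((\<lambda>a. \<bar>f a\<bar>) ` I)\<bar> \<le> l"
      using lncosh_approx_Max[OF fin ne, of "\<lambda>a. l / r * f a"] Max_scale[of "l / r" f] l r
      unfolding l_def[symmetric] by simp
    moreover have "lncosh I (\<lambda>a. l / r * f a) / l - Max ((\<lambda>a. \<bar>f a\<bar>) ` I) / r
      = (lncosh I (\<lambda>a. l / r * f a) - l / r * Max ((\<lambda>a. \<bar>f a\<bar>) ` I)) / l"
      using l by (simp add: diff_divide_distrib)
    ultimately show ?thesis using l by (simp add: abs_divide divide_le_eq)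
  qed
  have xiT: "(\<Sum>j<n. xi (x j) a) = l / r * ((\<Sum>j<n. ze (x j) a) / sqrt (real n))" for x a
    unfolding kn[symmetric] using sn by (simp add: xi_def sum_distrib_left[symmetric])
  have Xm: "(\<lambda>x. lncosh I (\<lambda>a. \<Sum>j<n. xi (x j) a)) \<in> borel_measurable X"
  proof -
    note [measurable] = xim
    show ?thesis unfolding X_def by (intro measurable_lncosh) measurable
  qed
  have Gm: "(\<lambda>g. lncosh I (\<lambda>a. l / r * g a)) \<in> borel_measurable G"
  proof (intro measurable_lncosh)
    fix a assume "a \<in> I"
    then have "(\<lambda>g. g a) \<in> borel_measurable G"
      unfolding G_def using measurable_component_singleton[of a I "\<lambda>_. std_normal"] by simp
    then show "(\<lambda>g. l / r * g a) \<in> borel_measurable G" by measurable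
  qed
  have "X.prob {x\<in>space X. T x \<in> A} = (\<integral>x. indicator {x\<in>space X. T x \<in> A} x \<partial>X)"
    using sets.Int_space_eq2[OF A1] by simp
  also have "\<dots> \<le> (\<integral>x. H (lncosh I (\<lambda>a. \<Sum>j<n. xi (x j) a)) \<partial>X)"
  proof (rule integral_mono)
    show "integrable X (indicator {x\<in>space X. T x \<in> A} :: _ \<Rightarrow> real)"
      by (rule integrable_real_indicator) (use A1 in \<open>auto simp: X.emeasure_eq_measure\<close>)
    show "integrable X (\<lambda>x. H (lncosh I (\<lambda>a. \<Sum>j<n. xi (x j) a)))"
      using Hb measurable_compose[OF Xm Hm] by (intro X.integrable_const_bound[where B=1]) auto
    fix x assume "x \<in> space X"
    show "indicator {x\<in>space X. T x \<in> A} x \<le> H (lncosh I (\<lambda>a. \<Sum>j<n. xi (x j) a))"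
    proof (cases "T x \<in> A")
      case True
      have "lncosh I (\<lambda>a. \<Sum>j<n. xi (x j) a) / l \<in> B"
        unfolding B_def xiT using True close[of "\<lambda>a. (\<Sum>j<n. ze (x j) a) / sqrt (real n)"]
        by (auto simp: T_def)
      then show ?thesis using gB by (simp add: H_def indicator_def)
    qed (use g01 in \<open>simp add: H_def\<close>)
  qed
  also have "\<dots> \<le> (\<integral>g. H (lncosh I (\<lambda>a. l / r * g a)) \<partial>G) + real n * ?e"
    using iter unfolding kn by simp
  also have "(\<integral>g. H (lncosh I (\<lambda>a. l / r * g a)) \<partial>G)
      \<le> (\<integral>g. indicator {g\<in>space G. \<exists>a\<in>A. \<bar>S g - a\<bar> \<le> 10 * r} g \<partial>G)"
  proof (rule integral_mono)
    show "integrable G (indicator {g\<in>space G. \<exists>a\<in>A. \<bar>S g - a\<bar> \<le> 10 * r} :: _ \<Rightarrow> real)"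
      by (rule integrable_real_indicator) (use A2 in \<open>auto simp: G.emeasure_eq_measure\<close>)
    show "integrable G (\<lambda>g. H (lncosh I (\<lambda>a. l / r * g a)))"
      using Hb measurable_compose[OF Gm Hm] by (intro G.integrable_const_bound[where B=1]) auto
    fix y assume y: "y \<in> space G"
    show "H (lncosh I (\<lambda>a. l / r * y a)) \<le> indicator {g\<in>space G. \<exists>a\<in>A. \<bar>S g - a\<bar> \<le> 10 * r} y"
    proof (cases "H (lncosh I (\<lambda>a. l / r * y a)) = 0")
      case False
      then obtain b where b: "b \<in> B" "\<bar>lncosh I (\<lambda>a. l / r * y a) / l - b\<bar> \<le> 8"
        using gnB by (auto simp: H_def)
      then obtain a where a: "a \<in> A" "\<bar>b - a / r\<bar> \<le> 1" by (auto simp: B_def)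
      \<comment> \<open>10 = 1 + 8 + 1: the enlargement in \<open>B\<close>, the support of the
        smooth indicator, and the soft-max error of \<open>S\<close>.\<close>
      have "\<bar>S y / r - a / r\<bar> \<le> 10" using a b close[of y] unfolding S_def by linarith
      moreover have "S y / r - a / r = (S y - a) / r" by (simp add: diff_divide_distrib)
      ultimately have "\<bar>S y - a\<bar> \<le> 10 * r" using r by (simp add: abs_divide divide_le_eq)
      then show ?thesis using y a g01 by (auto simp: indicator_def H_def)
    qed simp
  qed
  also have "\<dots> = G.prob {g\<in>space G. \<exists>a\<in>A. \<bar>S g - a\<bar> \<le> 10 * r}"
    using sets.Int_space_eq2[OF A2] by simp
  finally show ?thesis by (simp add: D_def c_def N_def mult.assoc)
qed

section \<open>Strassen couplings on the half-line\<close>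

text \<open>Columns are filled from the smallest upwards; the last clause records that everything
  below a used column is full. In the induction the new element \<open>b\<close> is the largest, so
  it receives mass only after all of \<open>R\<close> is filled.\<close>

lemma greedy_fill:
  fixes n :: "nat \<Rightarrow> real"
  assumes "finite R" "\<And>j. 0 \<le> n j" "0 \<le> a" "a \<le> sum n R"
  shows "\<exists>t. (\<forall>j. 0 \<le> t j \<and> t j \<le> n j) \<and> (\<forall>j. j \<notin> R \<longrightarrow> t j = 0) \<and> sum t R = a
    \<and> (\<forall>j\<in>R. \<forall>j'\<in>R. j < j' \<longrightarrow> 0 < t j' \<longrightarrow> t j = n j)"
  using assms
proof (induction R arbitrary: a rule: finite_linorder_max_induct)
  case empty
  then show ?case by (intro exI[of _ "\<lambda>_. 0"]) auto
next
  case (insert b R)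
  have bR: "b \<notin> R" using insert.hyps by auto
  show ?case
  proof (cases "a \<le> sum n R")
    case True
    then obtain t where t: "\<forall>j. 0 \<le> t j \<and> t j \<le> n j" "\<forall>j. j \<notin> R \<longrightarrow> t j = 0" "sum t R = a"
        "\<forall>j\<in>R. \<forall>j'\<in>R. j < j' \<longrightarrow> 0 < t j' \<longrightarrow> t j = n j"
      using insert.IH[OF insert.prems(1,2)] by blast
    then show ?thesis using bR insert.hyps by (intro exI[of _ t]) auto
  next
    case False
    define t where "t j = (if j \<in> R then n j else if j = b then a - sum n R else 0)" for j
    have "sum t R = sum n R" by (auto simp: t_def)
    then show ?thesis
      using False insert bR by (intro exI[of _ t]) (auto simp: t_def)
  qed
qed

text \<open>Processing the rows in increasing order and always
  using the smallest available columns keeps Hall's condition intact, because the admissible columns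
  of later rows are closed upwards within those of the current row.\<close>
lemma fractional_hall:
  fixes mu nu :: "nat \<Rightarrow> real" and R :: "nat \<Rightarrow> nat set"
  assumes "finite I" "finite J" "\<And>i. i \<in> I \<Longrightarrow> R i \<subseteq> J"
    and "\<And>i i' j j'. i \<in> I \<Longrightarrow> i' \<in> I \<Longrightarrow> i < i' \<Longrightarrow> j \<in> R i \<Longrightarrow> j \<in> R i' \<Longrightarrow> j' \<in> R i
      \<Longrightarrow> j \<le> j' \<Longrightarrow> j' \<in> R i'"
    and "\<And>i. 0 \<le> mu i" "\<And>j. 0 \<le> nu j"
    and "\<And>A. A \<subseteq> I \<Longrightarrow> sum mu A \<le> sum nu (\<Union>(R ` A)) + eta"
  shows "\<exists>g. (\<forall>i j. 0 \<le> g i j) \<and> (\<forall>i j. g i j \<noteq> 0 \<longrightarrow> i \<in> I \<and> j \<in> R i)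
    \<and> (\<forall>i\<in>I. (\<Sum>j\<in>J. g i j) \<le> mu i) \<and> (\<forall>j\<in>J. (\<Sum>i\<in>I. g i j) \<le> nu j)
    \<and> sum mu I - eta \<le> (\<Sum>i\<in>I. \<Sum>j\<in>J. g i j)"
  using assms
proof (induction I arbitrary: nu eta rule: finite_linorder_min_induct)
  case empty
  then show ?case using empty.prems(6)[of "{}"] by (intro exI[of _ "\<lambda>_ _. 0"]) auto
next
  case (insert i0 I)
  note finI = insert.hyps(1) and min = insert.hyps(2)
  have i0: "i0 \<notin> I" using min by auto
  have Rfin: "finite (R i)" if "i \<in> insert i0 I" for i
    using insert.prems(1,2) that finite_subset by metis
  define a where "a = Min {mu i0, sum nu (R i0)}"
  have a: "0 \<le> a" "a \<le> sum nu (R i0)" "a \<le> mu i0"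
    using insert.prems(4,5) by (auto simp: a_def sum_nonneg)
  obtain t where t: "\<And>j. 0 \<le> t j" "\<And>j. t j \<le> nu j" "\<And>j. j \<notin> R i0 \<Longrightarrow> t j = 0" "sum t (R i0) = a"
    "\<And>j j'. j \<in> R i0 \<Longrightarrow> j' \<in> R i0 \<Longrightarrow> j < j' \<Longrightarrow> 0 < t j' \<Longrightarrow> t j = nu j"
    using greedy_fill[OF Rfin[of i0] insert.prems(5) a(1,2)] by blast
  define nu' where "nu' j = nu j - t j" for j
  \<comment> \<open>The mass that row \<open>i0\<close> cannot place is charged to the admissible
    deficiency.\<close>
  define eta' where "eta' = eta - (mu i0 - a)"
  have hall: "sum mu A \<le> sum nu' (\<Union>(R ` A)) + eta'" if A: "A \<subseteq> I" for A
  proof -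
    let ?RA = "\<Union>(R ` A)"
    have finRA: "finite ?RA" using A finI Rfin by (intro finite_UN_I) (auto intro: finite_subset)
    \<comment> \<open>If every column of \<open>R i0\<close> is exhausted or already wanted by
      \<open>A\<close>, then adding \<open>R i0\<close> to the columns does not change the remaining
      capacity, and the condition for \<open>insert i0 A\<close> yields the one for
      \<open>A\<close>.\<close>
    have key: ?thesis if cov: "\<And>j. j \<in> R i0 \<Longrightarrow> nu' j = 0 \<or> j \<in> ?RA"
    proof -
      have "sum nu' ?RA = sum nu' (?RA \<union> R i0)"
        using cov finRA Rfin[of i0] by (intro sum.mono_neutral_left) auto
      also have "\<dots> = sum nu (?RA \<union> R i0) - sum t (?RA \<union> R i0)"
        by (simp add: nu'_def sum_subtractf)
      also have "sum t (?RA \<union> R i0) = sum t (R i0)"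
        using t(3) finRA Rfin[of i0] by (intro sum.mono_neutral_right) auto
      finally have e: "sum nu' ?RA = sum nu (?RA \<union> R i0) - a" using t(4) by simp
      have "sum mu (insert i0 A) \<le> sum nu (\<Union>(R ` insert i0 A)) + eta"
        using A by (intro insert.prems(6)) auto
      moreover have "sum mu (insert i0 A) = mu i0 + sum mu A"
        using A i0 finI by (subst sum.insert) (auto intro: finite_subset)
      moreover have "\<Union>(R ` insert i0 A) = ?RA \<union> R i0" by auto
      ultimately show ?thesis using e unfolding eta'_def by simp
    qed
    show ?thesis
    \<comment> \<open>Either row \<open>i0\<close> exhausts all its columns, or it is fully served.
      In the second case, suppose it used a column j that a row i' of \<open>A\<close> also admits:
      columns below j are exhausted by the greedy rule, and those from j on belong to
      \<open>R i'\<close> by the closure hypothesis. If it used no column wanted by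
      \<open>A\<close>, the old condition for \<open>A\<close> is still intact and
      \<open>eta' = eta\<close>.\<close>
    proof (cases "a = sum nu (R i0)")
      case True
      have "sum nu' (R i0) = 0" using True t(4) by (simp add: nu'_def sum_subtractf)
      then have "nu' j = 0" if "j \<in> R i0" for j
        using sum_nonneg_eq_0_iff[OF Rfin[of i0], of nu'] t(2) that by (auto simp: nu'_def)
      then show ?thesis using key by auto
    next
      case False
      then have am: "a = mu i0" unfolding a_def by (auto simp: min_def split: if_splits)
      show ?thesis
      proof (cases "\<exists>j\<in>?RA. 0 < t j")
        case True
        then obtain i' j where ij: "i' \<in> A" "j \<in> R i'" "0 < t j" by auto
        have jR: "j \<in> R i0" using t(3)[of j] ij by (cases "j \<in> R i0") auto
        show ?thesis
        proof (rule key)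
          fix j' assume j': "j' \<in> R i0"
          show "nu' j' = 0 \<or> j' \<in> ?RA"
          proof (cases "j' < j")
            case True
            then show ?thesis using t(5)[OF j' jR _ ij(3)] by (simp add: nu'_def)
          next
            case False
            then have "j' \<in> R i'"
              using A ij min by (intro insert.prems(3)[of i0 i' j j', OF _ _ _ jR _ j']) auto
            then show ?thesis using ij by auto
          qed
        qed
      next
        case False
        then have "t j = 0" if "j \<in> ?RA" for j using t(1)[of j] that by force
        then have "sum nu' ?RA = sum nu ?RA" by (intro sum.cong) (auto simp: nu'_def)
        then show ?thesis using insert.prems(6)[of A] A am by (auto simp: eta'_def)
      qed
    qed
  qed
  have "\<exists>g. (\<forall>i j. 0 \<le> g i j) \<and> (\<forall>i j. g i j \<noteq> 0 \<longrightarrow> i \<in> I \<and> j \<in> R i)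
    \<and> (\<forall>i\<in>I. (\<Sum>j\<in>J. g i j) \<le> mu i) \<and> (\<forall>j\<in>J. (\<Sum>i\<in>I. g i j) \<le> nu' j)
    \<and> sum mu I - eta' \<le> (\<Sum>i\<in>I. \<Sum>j\<in>J. g i j)"
  proof (rule insert.IH)
    show "finite J" by (rule insert.prems(1))
    show "R i \<subseteq> J" if "i \<in> I" for i using insert.prems(2) that by auto
    show "j' \<in> R i'" if "i \<in> I" "i' \<in> I" "i < i'" "j \<in> R i" "j \<in> R i'" "j' \<in> R i" "j \<le> j'"
      for i i' j j' using insert.prems(3)[of i i' j j'] that by auto
    show "0 \<le> mu i" for i by (rule insert.prems(4))
    show "0 \<le> nu' j" for j using t(2)[of j] by (simp add: nu'_def)
  qed (rule hall)
  then obtain g where g: "\<forall>i j. 0 \<le> g i j" "\<forall>i j. g i j \<noteq> 0 \<longrightarrow> i \<in> I \<and> j \<in> R i"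
    "\<forall>i\<in>I. (\<Sum>j\<in>J. g i j) \<le> mu i" "\<forall>j\<in>J. (\<Sum>i\<in>I. g i j) \<le> nu' j"
    "sum mu I - eta' \<le> (\<Sum>i\<in>I. \<Sum>j\<in>J. g i j)" by blast
  define h where "h i j = (if i = i0 then t j else g i j)" for i j
  have h0: "(\<Sum>j\<in>J. h i0 j) = a"
  proof -
    have "(\<Sum>j\<in>J. h i0 j) = sum t J" by (simp add: h_def)
    also have "\<dots> = sum t (R i0)"
      using t(3) insert.prems(1,2) by (intro sum.mono_neutral_right) auto
    finally show ?thesis using t(4) by simp
  qed
  have hI: "h i j = g i j" if "i \<in> I" for i j using that i0 by (auto simp: h_def)
  have hcol: "(\<Sum>i\<in>I. h i j) = (\<Sum>i\<in>I. g i j)" for j by (intro sum.cong) (auto simp: hI)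
  have hrow: "(\<Sum>i\<in>I. \<Sum>j\<in>J. h i j) = (\<Sum>i\<in>I. \<Sum>j\<in>J. g i j)" by (intro sum.cong) (auto simp: hI)
  show ?case
  proof (intro exI[of _ h] conjI)
    show "\<forall>i j. 0 \<le> h i j" using g(1) t(1) by (auto simp: h_def)
    show "\<forall>i j. h i j \<noteq> 0 \<longrightarrow> i \<in> insert i0 I \<and> j \<in> R i" using g(2) t(3) by (auto simp: h_def)
    show "\<forall>i\<in>insert i0 I. (\<Sum>j\<in>J. h i j) \<le> mu i" using g(3) h0 a(3) hI by auto
    show "\<forall>j\<in>J. (\<Sum>i\<in>insert i0 I. h i j) \<le> nu j"
      using g(4) i0 finI hcol by (auto simp: h_def[of i0] nu'_def le_diff_eq add.commute)
    show "sum mu (insert i0 I) - eta \<le> (\<Sum>i\<in>insert i0 I. \<Sum>j\<in>J. h i j)"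
      using g(5) i0 finI h0 hrow by (simp add: eta'_def)
  qed
qed

text \<open>The uncovered row masses r and column masses c have the same total 1 - t, so adding the
  product coupling r_i c_j / (1 - t) repairs both marginals.\<close>

lemma sub_coupling_complete:
  fixes g :: "nat \<Rightarrow> nat \<Rightarrow> real"
  assumes "finite I" "finite J" "\<And>i j. 0 \<le> g i j"
    and row: "\<And>i. i \<in> I \<Longrightarrow> (\<Sum>j\<in>J. g i j) \<le> mu i" and col: "\<And>j. j \<in> J \<Longrightarrow> (\<Sum>i\<in>I. g i j) \<le> nu j"
    and mu: "sum mu I = 1" and nu: "sum nu J = 1"
  shows "\<exists>h. (\<forall>i\<in>I. \<forall>j\<in>J. g i j \<le> h i j) \<and> (\<forall>i\<in>I. (\<Sum>j\<in>J. h i j) = mu i)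
    \<and> (\<forall>j\<in>J. (\<Sum>i\<in>I. h i j) = nu j)"
proof -
  define t where "t = (\<Sum>i\<in>I. \<Sum>j\<in>J. g i j)"
  define r where "r i = mu i - (\<Sum>j\<in>J. g i j)" for i
  define c where "c j = nu j - (\<Sum>i\<in>I. g i j)" for j
  have r0: "0 \<le> r i" if "i \<in> I" for i using row[OF that] by (simp add: r_def)
  have c0: "0 \<le> c j" if "j \<in> J" for j using col[OF that] by (simp add: c_def)
  have sr: "sum r I = 1 - t" using mu by (simp add: r_def t_def sum_subtractf)
  have sc: "sum c J = 1 - t" using nu by (simp add: c_def t_def sum_subtractf sum.swap[of _ J])
  have t1: "0 \<le> 1 - t" using sr sum_nonneg[of I r] r0 by simp
  \<comment> \<open>Also valid for t = 1: the quotient is then 0 by convention, and nonnegative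
    leftovers with total 0 vanish.\<close>
  have rz: "r i * (1 - t) / (1 - t) = r i" if "i \<in> I" for i
    using sum_nonneg_eq_0_iff[OF assms(1), of r] r0 sr that by (cases "1 - t = 0") auto
  have cz: "c j * (1 - t) / (1 - t) = c j" if "j \<in> J" for j
    using sum_nonneg_eq_0_iff[OF assms(2), of c] c0 sc that by (cases "1 - t = 0") auto
  define h where "h i j = g i j + r i * c j / (1 - t)" for i j
  have "(\<Sum>j\<in>J. h i j) = mu i" if "i \<in> I" for i
  proof -
    have "(\<Sum>j\<in>J. h i j) = (\<Sum>j\<in>J. g i j) + r i * sum c J / (1 - t)"
      by (simp add: h_def sum.distrib sum_divide_distrib sum_distrib_left)
    then show ?thesis using rz[OF that] by (simp add: sc r_def)
  qed
  moreover have "(\<Sum>i\<in>I. h i j) = nu j" if "j \<in> J" for j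
  proof -
    have "(\<Sum>i\<in>I. h i j) = (\<Sum>i\<in>I. g i j) + c j * sum r I / (1 - t)"
      by (simp add: h_def sum.distrib sum_divide_distrib sum_distrib_left mult.commute)
    then show ?thesis using cz[OF that] by (simp add: sr c_def)
  qed
  moreover have "g i j \<le> h i j" if "i \<in> I" "j \<in> J" for i j
    using r0[OF that(1)] c0[OF that(2)] t1 by (simp add: h_def)
  ultimately show ?thesis by blast
qed

section \<open>From couplings of bin indices to couplings of the measures\<close>

lemma (in prob_space) nn_integral_finite_bins:
  fixes b :: "'a \<Rightarrow> nat" and f :: "nat \<Rightarrow> real"
  assumes b: "b \<in> M \<rightarrow>\<^sub>M count_space UNIV" "\<And>x. b x < K" and f: "\<And>j. 0 \<le> f j"
  shows "(\<integral>\<^sup>+x. ennreal (f (b x)) \<partial>M) = ennreal (\<Sum>j<K. f j * prob {x\<in>space M. b x = j})"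
proof -
  note [measurable] = b(1)
  have "(\<integral>\<^sup>+x. ennreal (f (b x)) \<partial>M)
     = (\<integral>\<^sup>+x. (\<Sum>j<K. ennreal (f j) * indicator {x\<in>space M. b x = j} x) \<partial>M)"
  proof (intro nn_integral_cong)
    fix x assume "x \<in> space M"
    then have "(\<Sum>j<K. ennreal (f j) * indicator {x\<in>space M. b x = j} x)
        = (\<Sum>j<K. if j = b x then ennreal (f j) else 0)"
      by (intro sum.cong) auto
    then show "ennreal (f (b x)) = (\<Sum>j<K. ennreal (f j) * indicator {x\<in>space M. b x = j} x)"
      using b(2)[of x] by simp
  qed
  also have "\<dots> = (\<Sum>j<K. ennreal (f j) * emeasure M {x\<in>space M. b x = j})"
    by (subst nn_integral_sum) (auto intro!: sum.cong nn_integral_cmult_indicator)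
  also have "\<dots> = ennreal (\<Sum>j<K. f j * prob {x\<in>space M. b x = j})"
    by (simp add: emeasure_eq_measure ennreal_mult[symmetric] f sum_ennreal)
  finally show ?thesis .
qed

text \<open>There are countably many bins, so the union of the null ones is null. This restricts the
  marginal computations for the coupling density to bins whose mass may be divided by.\<close>

lemma (in prob_space) AE_bin_pos:
  fixes b :: "'a \<Rightarrow> nat"
  assumes b: "b \<in> M \<rightarrow>\<^sub>M count_space UNIV"
  shows "AE x in M. 0 < prob {y\<in>space M. b y = b x}"
proof -
  note [measurable] = b
  have "AE x in M. \<forall>i. prob {y\<in>space M. b y = i} = 0 \<longrightarrow> b x \<noteq> i"
  proof (rule AE_all_countable[THEN iffD2], intro allI)
    fix i
    show "AE x in M. prob {y\<in>space M. b y = i} = 0 \<longrightarrow> b x \<noteq> i"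
    proof (cases "prob {y\<in>space M. b y = i} = 0")
      case True
      then show ?thesis
        by (intro AE_I[where N="{y\<in>space M. b y = i}"]) (auto simp: emeasure_eq_measure)
    qed auto
  qed
  then show ?thesis by eventually_elim (auto simp: less_le)
qed

text \<open>A coupling of the bin indices is lifted to a coupling of the original measures by a density
  with respect to the product measure that is constant on products of bins.\<close>
lemma coupling_from_bins:
  fixes b1 :: "'x \<Rightarrow> nat" and b2 :: "'y \<Rightarrow> nat" and h :: "nat \<Rightarrow> nat \<Rightarrow> real"
  assumes P: "prob_space P" and V: "prob_space V"
    and b1: "b1 \<in> P \<rightarrow>\<^sub>M count_space UNIV" "\<And>x. b1 x < K"
    and b2: "b2 \<in> V \<rightarrow>\<^sub>M count_space UNIV" "\<And>y. b2 y < K"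
    and h0: "\<And>i j. i < K \<Longrightarrow> j < K \<Longrightarrow> 0 \<le> h i j"
    and row: "\<And>i. i < K \<Longrightarrow> (\<Sum>j<K. h i j) = measure P {x\<in>space P. b1 x = i}"
    and col: "\<And>j. j < K \<Longrightarrow> (\<Sum>i<K. h i j) = measure V {y\<in>space V. b2 y = j}"
  shows "\<exists>Q. prob_space Q \<and> sets Q = sets (P \<Otimes>\<^sub>M V) \<and> distr Q P fst = P \<and> distr Q V snd = V
    \<and> (\<forall>R. measure Q {p\<in>space Q. (b1 (fst p), b2 (snd p)) \<in> R} = (\<Sum>i<K. \<Sum>j<K. if (i, j) \<in> R then h i j else 0))"
proof -
  interpret P: prob_space P by fact
  interpret V: prob_space V by fact
  interpret PV: pair_prob_space P V ..
  note [measurable] = b1(1) b2(1)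
  define mu where "mu i = measure P {x\<in>space P. b1 x = i}" for i
  define nu where "nu j = measure V {y\<in>space V. b2 y = j}" for j
  \<comment> \<open>The density on a product of bins is the coupling mass over the product mass. If
    a bin is null, its row or column of \<open>h\<close> is zero as well, which agrees with division
    by zero giving 0.\<close>
  define q where "q i j = (if i < K \<and> j < K then h i j / (mu i * nu j) else 0)" for i j
  have q0: "0 \<le> q i j" for i j using h0 by (auto simp: q_def mu_def nu_def)
  have hmu: "h i j = 0" if "i < K" "j < K" "mu i = 0" for i j
    using row[OF that(1)] that sum_nonneg_eq_0_iff[of "{..<K}" "h i"] h0 by (auto simp: mu_def)
  have hnu: "h i j = 0" if "i < K" "j < K" "nu j = 0" for i j
    using col[OF that(2)] that sum_nonneg_eq_0_iff[of "{..<K}" "\<lambda>i. h i j"] h0 by (auto simp: nu_def)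
  have qm: "q i j * nu j * mu i = h i j" if "i < K" "j < K" for i j
    using hmu[OF that] hnu[OF that] that by (auto simp: q_def)
  have qrow: "(\<Sum>j<K. q i j * nu j) = 1" if "i < K" "0 < mu i" for i
  proof -
    have "(\<Sum>j<K. q i j * nu j) * mu i = (\<Sum>j<K. h i j)"
      unfolding sum_distrib_right by (intro sum.cong) (auto simp: qm that)
    then show ?thesis using row[OF that(1)] that by (simp add: mu_def)
  qed
  have qcol: "(\<Sum>i<K. q i j * mu i) = 1" if "j < K" "0 < nu j" for j
  proof -
    have "(\<Sum>i<K. q i j * mu i) * nu j = (\<Sum>i<K. h i j)"
      unfolding sum_distrib_right by (intro sum.cong) (auto simp: qm[symmetric] that)
    then show ?thesis using col[OF that(1)] that by (simp add: nu_def)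
  qed
  define w where "w p = ennreal (q (b1 (fst p)) (b2 (snd p)))" for p
  have wm[measurable]: "w \<in> borel_measurable (P \<Otimes>\<^sub>M V)" unfolding w_def[abs_def] by measurable
  define Q where "Q = density (P \<Otimes>\<^sub>M V) w"
  have inner1: "AE x in P. (\<integral>\<^sup>+y. w (x, y) \<partial>V) = 1"
    using P.AE_bin_pos[OF b1(1)]
  proof eventually_elim
    case (elim x)
    have "(\<integral>\<^sup>+y. w (x, y) \<partial>V) = ennreal (\<Sum>j<K. q (b1 x) j * nu j)"
      unfolding w_def nu_def using V.nn_integral_finite_bins[OF b2, of "q (b1 x)"] q0 by simp
    then show ?case using qrow[OF b1(2)] elim by (simp add: mu_def)
  qed
  have inner2: "AE y in V. (\<integral>\<^sup>+x. w (x, y) \<partial>P) = 1"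
    using V.AE_bin_pos[OF b2(1)]
  proof eventually_elim
    case (elim y)
    have "(\<integral>\<^sup>+x. w (x, y) \<partial>P) = ennreal (\<Sum>i<K. q i (b2 y) * mu i)"
      unfolding w_def mu_def using P.nn_integral_finite_bins[OF b1, of "\<lambda>i. q i (b2 y)"] q0 by simp
    then show ?case using qcol[OF b2(2)] elim by (simp add: nu_def)
  qed
  have sQ: "sets Q = sets (P \<Otimes>\<^sub>M V)" "space Q = space (P \<Otimes>\<^sub>M V)" by (auto simp: Q_def)
  have m1[measurable]: "fst \<in> Q \<rightarrow>\<^sub>M P" and m2[measurable]: "snd \<in> Q \<rightarrow>\<^sub>M V"
    by (simp_all add: Q_def)
  have d1: "distr Q P fst = P"
  proof (rule measure_eqI)
    fix A assume "A \<in> sets (distr Q P fst)"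
    then have A[measurable]: "A \<in> sets P" by simp
    have "emeasure (distr Q P fst) A = emeasure Q {p\<in>space (P \<Otimes>\<^sub>M V). fst p \<in> A}"
      by (subst emeasure_distr) (auto simp: sQ intro!: arg_cong[where f="emeasure Q"])
    also have "\<dots> = (\<integral>\<^sup>+p. w p * indicator {p\<in>space (P \<Otimes>\<^sub>M V). fst p \<in> A} p \<partial>(P \<Otimes>\<^sub>M V))"
      unfolding Q_def by (rule emeasure_density) measurable
    also have "\<dots> = (\<integral>\<^sup>+x. \<integral>\<^sup>+y. w (x, y) * indicator {p\<in>space (P \<Otimes>\<^sub>M V). fst p \<in> A} (x, y) \<partial>V \<partial>P)"
      by (rule V.nn_integral_fst[symmetric]) measurable
    also have "\<dots> = (\<integral>\<^sup>+x. \<integral>\<^sup>+y. w (x, y) * indicator A x \<partial>V \<partial>P)"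
      by (intro nn_integral_cong) (auto simp: space_pair_measure indicator_def)
    also have "\<dots> = (\<integral>\<^sup>+x. (\<integral>\<^sup>+y. w (x, y) \<partial>V) * indicator A x \<partial>P)"
      by (intro nn_integral_cong nn_integral_multc) measurable
    also have "\<dots> = (\<integral>\<^sup>+x. indicator A x \<partial>P)"
      by (intro nn_integral_cong_AE) (use inner1 in \<open>eventually_elim, simp\<close>)
    finally show "emeasure (distr Q P fst) A = emeasure P A" by simp
  qed simp
  have d2: "distr Q V snd = V"
  proof (rule measure_eqI)
    fix A assume "A \<in> sets (distr Q V snd)"
    then have A[measurable]: "A \<in> sets V" by simp
    have "emeasure (distr Q V snd) A = emeasure Q {p\<in>space (P \<Otimes>\<^sub>M V). snd p \<in> A}"
      by (subst emeasure_distr) (auto simp: sQ intro!: arg_cong[where f="emeasure Q"])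
    also have "\<dots> = (\<integral>\<^sup>+p. w p * indicator {p\<in>space (P \<Otimes>\<^sub>M V). snd p \<in> A} p \<partial>(P \<Otimes>\<^sub>M V))"
      unfolding Q_def by (rule emeasure_density) measurable
    also have "\<dots> = (\<integral>\<^sup>+y. \<integral>\<^sup>+x. w (x, y) * indicator {p\<in>space (P \<Otimes>\<^sub>M V). snd p \<in> A} (x, y) \<partial>P \<partial>V)"
      by (rule PV.nn_integral_snd[symmetric, unfolded split_beta' prod.collapse]) measurable
    also have "\<dots> = (\<integral>\<^sup>+y. \<integral>\<^sup>+x. w (x, y) * indicator A y \<partial>P \<partial>V)"
      by (intro nn_integral_cong) (auto simp: space_pair_measure indicator_def)
    also have "\<dots> = (\<integral>\<^sup>+y. (\<integral>\<^sup>+x. w (x, y) \<partial>P) * indicator A y \<partial>V)"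
      by (intro nn_integral_cong nn_integral_multc) measurable
    also have "\<dots> = (\<integral>\<^sup>+y. indicator A y \<partial>V)"
      by (intro nn_integral_cong_AE) (use inner2 in \<open>eventually_elim, simp\<close>)
    finally show "emeasure (distr Q V snd) A = emeasure V A" by simp
  qed simp
  have "prob_space (distr Q P fst)" unfolding d1 by fact
  then have Qp: "prob_space Q" by (rule prob_space_distrD[OF m1])
  have R: "measure Q {p\<in>space Q. (b1 (fst p), b2 (snd p)) \<in> R} = (\<Sum>i<K. \<Sum>j<K. if (i, j) \<in> R then h i j else 0)" for R
  proof -
    define f where "f i j = (if (i, j) \<in> R then q i j else 0)" for i j
    have f0: "0 \<le> f i j" for i j using q0 by (simp add: f_def)
    have "emeasure Q {p\<in>space Q. (b1 (fst p), b2 (snd p)) \<in> R}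
       = (\<integral>\<^sup>+p. w p * indicator {p\<in>space (P \<Otimes>\<^sub>M V). (b1 (fst p), b2 (snd p)) \<in> R} p \<partial>(P \<Otimes>\<^sub>M V))"
      unfolding sQ(2) unfolding Q_def by (rule emeasure_density) measurable
    also have "\<dots> = (\<integral>\<^sup>+x. \<integral>\<^sup>+y. w (x, y) * indicator {p\<in>space (P \<Otimes>\<^sub>M V). (b1 (fst p), b2 (snd p)) \<in> R} (x, y) \<partial>V \<partial>P)"
      by (rule V.nn_integral_fst[symmetric]) measurable
    also have "\<dots> = (\<integral>\<^sup>+x. \<integral>\<^sup>+y. ennreal (f (b1 x) (b2 y)) \<partial>V \<partial>P)"
      by (intro nn_integral_cong) (auto simp: space_pair_measure indicator_def w_def f_def)
    also have "\<dots> = (\<integral>\<^sup>+x. ennreal (\<Sum>j<K. f (b1 x) j * nu j) \<partial>P)"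
      unfolding nu_def by (intro nn_integral_cong V.nn_integral_finite_bins b2 f0)
    also have "\<dots> = ennreal (\<Sum>i<K. (\<Sum>j<K. f i j * nu j) * mu i)"
      unfolding mu_def
      by (rule P.nn_integral_finite_bins[OF b1]) (auto intro!: sum_nonneg mult_nonneg_nonneg f0 simp: nu_def)
    also have "(\<Sum>i<K. (\<Sum>j<K. f i j * nu j) * mu i) = (\<Sum>i<K. \<Sum>j<K. if (i, j) \<in> R then h i j else 0)"
      unfolding sum_distrib_right by (intro sum.cong refl) (auto simp: f_def qm)
    finally show ?thesis
      by (subst measure_def) (auto intro!: enn2real_ennreal sum_nonneg simp: h0)
  qed
  show ?thesis using Qp sQ(1) d1 d2 R by (intro exI[of _ Q] conjI allI)
qed

text \<open>The last bin collects the tails, whose mass is absorbed in \<open>eta' - eta\<close>.\<close>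
lemma strassen_bins:
  fixes T :: "'x \<Rightarrow> nat" and S :: "'y \<Rightarrow> nat"
  assumes P: "prob_space P" and V: "prob_space V"
    and T: "T \<in> P \<rightarrow>\<^sub>M count_space UNIV" and S: "S \<in> V \<rightarrow>\<^sub>M count_space UNIV"
    and hyp: "\<And>A. finite A \<Longrightarrow> measure P {x\<in>space P. T x \<in> A}
        \<le> measure V {y\<in>space V. \<exists>i\<in>A. i \<le> S y + c \<and> S y \<le> i + c} + eta"
    and eta': "eta < eta'"
  shows "\<exists>Q. prob_space Q \<and> sets Q = sets (P \<Otimes>\<^sub>M V) \<and> distr Q P fst = P \<and> distr Q V snd = V
    \<and> measure Q {p\<in>space Q. \<not> (T (fst p) \<le> S (snd p) + c \<and> S (snd p) \<le> T (fst p) + c)} \<le> eta'"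
proof -
  interpret P: prob_space P by fact
  interpret V: prob_space V by fact
  note [measurable] = T S
  have "(\<lambda>m. P.prob {x\<in>space P. T x < m}) \<longlonglongrightarrow> P.prob (\<Union>m. {x\<in>space P. T x < m})"
    by (rule P.finite_Lim_measure_incseq) (auto simp: incseq_def)
  moreover have "(\<Union>m. {x\<in>space P. T x < m}) = space P" by (auto intro: lessI)
  ultimately have "(\<lambda>m. P.prob {x\<in>space P. T x < m}) \<longlonglongrightarrow> 1" by (simp add: P.prob_space)
  then have "\<forall>\<^sub>F m in sequentially. 1 - (eta' - eta) < P.prob {x\<in>space P. T x < m}"
    using eta' by (intro order_tendstoD) auto
  then obtain m where m: "1 - (eta' - eta) < P.prob {x\<in>space P. T x < m}"
    by (auto simp: eventually_sequentially)
  \<comment> \<open>Rows below \<open>m\<close> reach columns at most m - 1 + c. Truncating at m + c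
    thus leaves rows below \<open>m\<close> and all their admissible columns unchanged, and collects
    the rest in a bin that these rows never reach.\<close>
  define K where "K = Suc (m + c)"
  define b1 where "b1 x = min (T x) (m + c)" for x
  define b2 where "b2 y = min (S y) (m + c)" for y
  have [measurable]: "b1 \<in> P \<rightarrow>\<^sub>M count_space UNIV" unfolding b1_def[abs_def] by measurable
  have [measurable]: "b2 \<in> V \<rightarrow>\<^sub>M count_space UNIV" unfolding b2_def[abs_def] by measurable
  have bK: "b1 x < K" "b2 y < K" for x y by (auto simp: b1_def b2_def K_def)
  define mu where "mu i = P.prob {x\<in>space P. b1 x = i}" for i
  define nu where "nu j = V.prob {y\<in>space V. b2 y = j}" for j
  define R where "R i = {j. i \<le> j + c \<and> j \<le> i + c}" for i
  have sum1: "sum mu A = P.prob {x\<in>space P. b1 x \<in> A}" if "finite A" for A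
  proof -
    have "P.prob (\<Union>i\<in>A. {x\<in>space P. b1 x = i}) = sum mu A"
      unfolding mu_def by (rule P.finite_measure_finite_Union) (auto simp: that disjoint_family_on_def)
    moreover have "(\<Union>i\<in>A. {x\<in>space P. b1 x = i}) = {x\<in>space P. b1 x \<in> A}" by auto
    ultimately show ?thesis by simp
  qed
  have sum2: "sum nu A = V.prob {x\<in>space V. b2 x \<in> A}" if "finite A" for A
  proof -
    have "V.prob (\<Union>i\<in>A. {x\<in>space V. b2 x = i}) = sum nu A"
      unfolding nu_def by (rule V.finite_measure_finite_Union) (auto simp: that disjoint_family_on_def)
    moreover have "(\<Union>i\<in>A. {x\<in>space V. b2 x = i}) = {x\<in>space V. b2 x \<in> A}" by auto
    ultimately show ?thesis by simp
  qed
  have Rfin: "finite (R i)" for i by (rule finite_subset[of _ "{..i + c}"]) (auto simp: R_def)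
  have "\<exists>g. (\<forall>i j. 0 \<le> g i j) \<and> (\<forall>i j. g i j \<noteq> 0 \<longrightarrow> i \<in> {..<m} \<and> j \<in> R i)
    \<and> (\<forall>i\<in>{..<m}. (\<Sum>j\<in>{..<K}. g i j) \<le> mu i) \<and> (\<forall>j\<in>{..<K}. (\<Sum>i\<in>{..<m}. g i j) \<le> nu j)
    \<and> sum mu {..<m} - eta \<le> (\<Sum>i\<in>{..<m}. \<Sum>j\<in>{..<K}. g i j)"
  proof (rule fractional_hall)
    show "sum mu A \<le> sum nu (\<Union>(R ` A)) + eta" if A: "A \<subseteq> {..<m}" for A
    proof -
      have fA: "finite A" using A finite_subset by auto
      have "{x\<in>space P. b1 x \<in> A} = {x\<in>space P. T x \<in> A}"
        using A by (auto simp: b1_def min_def split: if_splits)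
      then have "sum mu A = P.prob {x\<in>space P. T x \<in> A}" using sum1[OF fA] by simp
      also have "\<dots> \<le> V.prob {y\<in>space V. \<exists>i\<in>A. i \<le> S y + c \<and> S y \<le> i + c} + eta" by (rule hyp[OF fA])
      also have "{y\<in>space V. \<exists>i\<in>A. i \<le> S y + c \<and> S y \<le> i + c} = {y\<in>space V. b2 y \<in> \<Union>(R ` A)}"
      proof -
        have "b2 y \<in> R i \<longleftrightarrow> i \<le> S y + c \<and> S y \<le> i + c" if "i \<in> A" for i y
          using A that by (auto simp: b2_def R_def min_def)
        then show ?thesis by auto
      qed
      also have "V.prob \<dots> = sum nu (\<Union>(R ` A))" using fA Rfin by (subst sum2) auto
      finally show ?thesis .
    qed
  qed (auto simp: R_def K_def mu_def nu_def)
  then obtain g where g': "\<forall>i j. 0 \<le> g i j" "\<forall>i j. g i j \<noteq> 0 \<longrightarrow> i \<in> {..<m} \<and> j \<in> R i"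
    "\<forall>i\<in>{..<m}. (\<Sum>j<K. g i j) \<le> mu i" "\<forall>j\<in>{..<K}. (\<Sum>i<m. g i j) \<le> nu j"
    "sum mu {..<m} - eta \<le> (\<Sum>i<m. \<Sum>j<K. g i j)" by blast
  have g: "0 \<le> g i j" "g i j \<noteq> 0 \<Longrightarrow> i < m \<and> j \<in> R i"
    "i < m \<Longrightarrow> (\<Sum>j<K. g i j) \<le> mu i" "j < K \<Longrightarrow> (\<Sum>i<m. g i j) \<le> nu j" for i j
    using g' by auto
  have gz: "g i j = 0" if "\<not> i < m" for i j using g(2)[of i j] that by auto
  have mK: "(\<Sum>i<K. f i) = (\<Sum>i<m. f i)" if "\<And>i. \<not> i < m \<Longrightarrow> f i = 0" for f :: "nat \<Rightarrow> real"
    using that by (intro sum.mono_neutral_right) (auto simp: K_def)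
  have s1: "sum mu {..<K} = 1" using bK by (subst sum1) (auto simp: P.prob_space)
  have s2: "sum nu {..<K} = 1" using bK by (subst sum2) (auto simp: V.prob_space)
  have "\<exists>h. (\<forall>i\<in>{..<K}. \<forall>j\<in>{..<K}. g i j \<le> h i j) \<and> (\<forall>i\<in>{..<K}. (\<Sum>j\<in>{..<K}. h i j) = mu i)
    \<and> (\<forall>j\<in>{..<K}. (\<Sum>i\<in>{..<K}. h i j) = nu j)"
  proof (rule sub_coupling_complete)
    show "(\<Sum>j<K. g i j) \<le> mu i" for i
      using g(3)[of i] gz by (cases "i < m") (auto simp: mu_def)
    show "(\<Sum>i<K. g i j) \<le> nu j" if "j \<in> {..<K}" for j
      using g(4)[of j] that gz by (subst mK) auto
  qed (use g s1 s2 in auto)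
  then obtain h where h': "\<forall>i\<in>{..<K}. \<forall>j\<in>{..<K}. g i j \<le> h i j"
    "\<forall>i\<in>{..<K}. (\<Sum>j<K. h i j) = mu i" "\<forall>j\<in>{..<K}. (\<Sum>i<K. h i j) = nu j"
    by blast
  have h: "i < K \<Longrightarrow> j < K \<Longrightarrow> g i j \<le> h i j"
    "i < K \<Longrightarrow> (\<Sum>j<K. h i j) = mu i" "j < K \<Longrightarrow> (\<Sum>i<K. h i j) = nu j" for i j
    using h' by auto
  have h0: "0 \<le> h i j" if "i < K" "j < K" for i j using h(1)[OF that] g(1)[of i j] by linarith
  obtain Q where Q: "prob_space Q" "sets Q = sets (P \<Otimes>\<^sub>M V)" "distr Q P fst = P" "distr Q V snd = V"
    "\<And>R. measure Q {p\<in>space Q. (b1 (fst p), b2 (snd p)) \<in> R} = (\<Sum>i<K. \<Sum>j<K. if (i, j) \<in> R then h i j else 0)"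
    using coupling_from_bins[OF P V, of b1 K b2 h] bK h0 h(2,3) unfolding mu_def nu_def by force
  interpret Q: prob_space Q by (rule Q(1))
  have spQ: "space Q = space (P \<Otimes>\<^sub>M V)" using Q(2) by (rule sets_eq_imp_space_eq)
  define bad where "bad = {(i, j). \<not> (i < m \<and> j \<in> R i)}"
  have meas: "{p\<in>space Q. (b1 (fst p), b2 (snd p)) \<in> bad} \<in> sets Q"
    unfolding spQ Q(2) by measurable
  have "Q.prob {p\<in>space Q. \<not> (T (fst p) \<le> S (snd p) + c \<and> S (snd p) \<le> T (fst p) + c)}
     \<le> Q.prob {p\<in>space Q. (b1 (fst p), b2 (snd p)) \<in> bad}"
  proof (rule Q.finite_measure_mono[OF _ meas], rule subsetI)
    fix p assume p: "p \<in> {p\<in>space Q. \<not> (T (fst p) \<le> S (snd p) + c \<and> S (snd p) \<le> T (fst p) + c)}"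
    have "(b1 (fst p), b2 (snd p)) \<in> bad"
    proof (rule ccontr)
      assume "(b1 (fst p), b2 (snd p)) \<notin> bad"
      then have "b1 (fst p) < m" "b1 (fst p) \<le> b2 (snd p) + c" "b2 (snd p) \<le> b1 (fst p) + c"
        by (auto simp: bad_def R_def)
      then have "T (fst p) \<le> S (snd p) + c" "S (snd p) \<le> T (fst p) + c"
        by (auto simp: b1_def b2_def min_def split: if_splits)
      then show False using p by auto
    qed
    then show "p \<in> {p\<in>space Q. (b1 (fst p), b2 (snd p)) \<in> bad}" using p by auto
  qed
  also have "\<dots> = (\<Sum>i<K. \<Sum>j<K. if (i, j) \<in> bad then h i j else 0)" by (rule Q(5))
  \<comment> \<open>\<open>g\<close> vanishes on bad pairs and is dominated by \<open>h\<close>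
    elsewhere, so the bad mass is at most the mass added on completion, 1 minus the mass of
    \<open>g\<close>. That is at most \<open>eta\<close> plus the tail eta' - eta.\<close>
  also have "\<dots> \<le> (\<Sum>i<K. \<Sum>j<K. h i j - g i j)"
  proof (intro sum_mono)
    fix i j assume ij: "i \<in> {..<K}" "j \<in> {..<K}"
    show "(if (i, j) \<in> bad then h i j else 0) \<le> h i j - g i j"
      using h(1)[of i j] g(2)[of i j] ij by (cases "g i j = 0") (auto simp: bad_def)
  qed
  also have "\<dots> = 1 - (\<Sum>i<m. \<Sum>j<K. g i j)"
  proof -
    have "(\<Sum>i<K. \<Sum>j<K. h i j) = 1" using s1 h(2) by simp
    moreover have "(\<Sum>i<K. \<Sum>j<K. g i j) = (\<Sum>i<m. \<Sum>j<K. g i j)" using gz by (intro mK) auto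
    ultimately show ?thesis by (simp add: sum_subtractf)
  qed
  also have "\<dots> \<le> eta'"
  proof -
    have "{x\<in>space P. b1 x \<in> {..<m}} = {x\<in>space P. T x < m}" by (auto simp: b1_def)
    then have "sum mu {..<m} = P.prob {x\<in>space P. T x < m}" using sum1[of "{..<m}"] by simp
    then show ?thesis using g'(5) m by linarith
  qed
  finally show ?thesis using Q(1-4) by blast
qed

text \<open>Both variables are rounded to bins of width \<open>r\<close>. Closeness within 10 r
  becomes a difference of at most 10 bin indices; going back, rounding costs one more width, whence
  11 r.\<close>

lemma coupling_of_comparison:
  fixes T :: "'x \<Rightarrow> real" and S :: "'g \<Rightarrow> real"
  assumes X: "prob_space X" and G: "prob_space G" and r: "0 < r"
    and T: "T \<in> borel_measurable X" "\<And>x. 0 \<le> T x" and S: "S \<in> borel_measurable G" "\<And>g. 0 \<le> S g"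
    and hyp: "\<And>A. {x\<in>space X. T x \<in> A} \<in> sets X \<Longrightarrow>
      {g\<in>space G. \<exists>a\<in>A. \<bar>S g - a\<bar> \<le> 10 * r} \<in> sets G \<Longrightarrow>
      measure X {x\<in>space X. T x \<in> A} \<le> measure G {g\<in>space G. \<exists>a\<in>A. \<bar>S g - a\<bar> \<le> 10 * r} + eta"
    and eta': "eta < eta'"
  defines "V \<equiv> distr G borel S"
  shows "\<exists>Q. prob_space Q \<and> sets Q = sets (X \<Otimes>\<^sub>M V) \<and> distr Q X fst = X \<and> distr Q V snd = V
    \<and> measure Q {p\<in>space Q. 11 * r < \<bar>T (fst p) - snd p\<bar>} \<le> eta'"
proof -
  interpret X: prob_space X by fact
  interpret G: prob_space G by fact
  note [measurable] = T(1) S(1)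
  have V: "prob_space V" unfolding V_def by (rule G.prob_space_distr) measurable
  interpret V: prob_space V by fact
  have sV[simp]: "sets V = sets borel" "space V = UNIV" by (simp_all add: V_def)
  define b where "b t = nat \<lfloor>t / r\<rfloor>" for t
  have bm[measurable]: "b \<in> borel \<rightarrow>\<^sub>M count_space UNIV" unfolding b_def[abs_def] by measurable
  have bT: "(\<lambda>x. b (T x)) \<in> X \<rightarrow>\<^sub>M count_space UNIV" by measurable
  have bV: "b \<in> V \<rightarrow>\<^sub>M count_space UNIV" unfolding V_def using bm by simp
  have bl: "real (b t) \<le> t / r" "t / r < real (b t) + 1" if "0 \<le> t" for t
  proof -
    have "real (b t) = of_int \<lfloor>t / r\<rfloor>" using that r by (simp add: b_def)
    then show "real (b t) \<le> t / r" "t / r < real (b t) + 1" by linarith+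
  qed
  have bin: "X.prob {x\<in>space X. b (T x) \<in> A} \<le> V.prob {s\<in>space V. \<exists>i\<in>A. i \<le> b s + 10 \<and> b s \<le> i + 10} + eta"
    if A: "finite A" for A
  proof -
    \<comment> \<open>The comparison is applied to unions of bins only. Their 10 r-neighbourhoods
      are finite unions of half-open intervals, which settles the measurability premises of
      \<open>hyp\<close>.\<close>
    define A' where "A' = {t. 0 \<le> t \<and> b t \<in> A}"
    have e1: "{x\<in>space X. T x \<in> A'} = {x\<in>space X. b (T x) \<in> A}" using T(2) by (auto simp: A'_def)
    have e2: "{g\<in>space G. \<exists>a\<in>A'. \<bar>S g - a\<bar> \<le> 10 * r}
       = {g\<in>space G. \<exists>i\<in>A. real i * r - 10 * r \<le> S g \<and> S g < (real i + 1) * r + 10 * r}"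
    proof (intro Collect_cong conj_cong refl iffI)
      fix g assume "\<exists>a\<in>A'. \<bar>S g - a\<bar> \<le> 10 * r"
      then obtain a where a: "0 \<le> a" "b a \<in> A" "\<bar>S g - a\<bar> \<le> 10 * r" by (auto simp: A'_def)
      have "real (b a) * r \<le> a" "a < (real (b a) + 1) * r"
        using bl[OF a(1)] r by (simp_all add: le_divide_eq divide_less_eq)
      then show "\<exists>i\<in>A. real i * r - 10 * r \<le> S g \<and> S g < (real i + 1) * r + 10 * r"
        using a by (intro bexI[of _ "b a"]) auto
    next
      fix g assume "\<exists>i\<in>A. real i * r - 10 * r \<le> S g \<and> S g < (real i + 1) * r + 10 * r"
      then obtain i where i: "i \<in> A" "real i * r - 10 * r \<le> S g" "S g < (real i + 1) * r + 10 * r" by auto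
      \<comment> \<open>The left end of bin i, or the leftmost point within 10 r of
        \<open>S g\<close> if that lies further right; the strict upper bound on \<open>S g\<close>
        keeps it inside the half-open bin.\<close>
      define a where "a = max (real i * r) (S g - 10 * r)"
      have ir: "0 \<le> real i * r" using r by simp
      have a0: "0 \<le> a" using ir by (simp add: a_def)
      have "real i * r \<le> a" "a < (real i + 1) * r" using i r by (auto simp: a_def algebra_simps)
      then have "real i \<le> a / r" "a / r < real i + 1" using r by (simp_all add: le_divide_eq divide_less_eq)
      then have "\<lfloor>a / r\<rfloor> = int i" by (intro floor_unique) auto
      then have "b a = i" by (simp add: b_def)
      moreover have "\<bar>S g - a\<bar> \<le> 10 * r" using i r by (auto simp: a_def max_def algebra_simps)
      ultimately show "\<exists>a\<in>A'. \<bar>S g - a\<bar> \<le> 10 * r" using i(1) a0 by (intro bexI[of _ a]) (auto simp: A'_def)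
    qed
    have ms: "{g\<in>space G. \<exists>a\<in>A'. \<bar>S g - a\<bar> \<le> 10 * r} \<in> sets G"
      unfolding e2 using A by measurable
    have "{x\<in>space X. T x \<in> A'} \<in> sets X" unfolding e1 using bT by measurable
    from hyp[OF this ms] have "X.prob {x\<in>space X. b (T x) \<in> A}
        \<le> G.prob {g\<in>space G. \<exists>a\<in>A'. \<bar>S g - a\<bar> \<le> 10 * r} + eta" unfolding e1 .
    also have "G.prob {g\<in>space G. \<exists>a\<in>A'. \<bar>S g - a\<bar> \<le> 10 * r}
        \<le> G.prob {g\<in>space G. \<exists>i\<in>A. i \<le> b (S g) + 10 \<and> b (S g) \<le> i + 10}"
    proof (rule G.finite_measure_mono)
      show "{g\<in>space G. \<exists>a\<in>A'. \<bar>S g - a\<bar> \<le> 10 * r} \<subseteq> {g\<in>space G. \<exists>i\<in>A. i \<le> b (S g) + 10 \<and> b (S g) \<le> i + 10}"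
      proof
        fix g assume "g \<in> {g\<in>space G. \<exists>a\<in>A'. \<bar>S g - a\<bar> \<le> 10 * r}"
        then obtain a where g: "g \<in> space G" and a: "a \<in> A'" "\<bar>S g - a\<bar> \<le> 10 * r" by blast
        have a': "0 \<le> a" "b a \<in> A" using a by (auto simp: A'_def)
        have "\<bar>S g / r - a / r\<bar> \<le> 10" using a(2) r by (simp add: diff_divide_distrib[symmetric] abs_divide divide_le_eq)
        then have "real (b a) < real (b (S g)) + 11" "real (b (S g)) < real (b a) + 11"
          using bl[OF a'(1)] bl[OF S(2)[of g]] by linarith+
        then have "b a \<le> b (S g) + 10" "b (S g) \<le> b a + 10" by linarith+
        then show "g \<in> {g\<in>space G. \<exists>i\<in>A. i \<le> b (S g) + 10 \<and> b (S g) \<le> i + 10}" using g a' by blast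
      qed
      show "{g\<in>space G. \<exists>i\<in>A. i \<le> b (S g) + 10 \<and> b (S g) \<le> i + 10} \<in> sets G" using A by measurable
    qed
    also have "\<dots> = V.prob {s\<in>space V. \<exists>i\<in>A. i \<le> b s + 10 \<and> b s \<le> i + 10}"
    proof -
      have "{s\<in>space V. \<exists>i\<in>A. i \<le> b s + 10 \<and> b s \<le> i + 10} \<in> sets borel"
        using A by simp
      then show ?thesis unfolding V_def
        by (subst measure_distr) (auto intro!: arg_cong[where f=G.prob])
    qed
    finally show ?thesis by simp
  qed
  obtain Q where Q: "prob_space Q" "sets Q = sets (X \<Otimes>\<^sub>M V)" "distr Q X fst = X" "distr Q V snd = V"
    and Qb: "measure Q {p\<in>space Q. \<not> (b (T (fst p)) \<le> b (snd p) + 10 \<and> b (snd p) \<le> b (T (fst p)) + 10)} \<le> eta'"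
    using strassen_bins[OF X V bT bV bin eta'] by blast
  interpret Q: prob_space Q by (rule Q(1))
  have spQ: "space Q = space (X \<Otimes>\<^sub>M V)" using Q(2) by (rule sets_eq_imp_space_eq)
  have [measurable]: "fst \<in> Q \<rightarrow>\<^sub>M X" "snd \<in> Q \<rightarrow>\<^sub>M borel"
    using measurable_fst[of X V] measurable_snd[of X V] Q(2)
    by (auto cong: measurable_cong_sets)
  define B1 where "B1 p = real (b (T (fst p)))" for p :: "'x \<times> real"
  define B2 where "B2 p = real (b (snd p))" for p :: "'x \<times> real"
  have [measurable]: "B1 \<in> borel_measurable Q" "B2 \<in> borel_measurable Q"
    unfolding B1_def[abs_def] B2_def[abs_def]
    using measurable_compose[OF measurable_compose[OF _ bT, of fst Q], of real borel]
      measurable_compose[OF measurable_compose[OF _ bm, of snd Q], of real borel] by auto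
  \<comment> \<open>\<open>b\<close> sends all negative numbers to bin 0, so the rounding estimate
    holds only for nonnegative values; the second coordinate is nonnegative almost surely because
    its law is that of \<open>S\<close>.\<close>
  have "AE s in V. 0 \<le> s" unfolding V_def using S by (subst AE_distr_iff) auto
  then have "AE s in distr Q V snd. 0 \<le> s" unfolding Q(4) .
  then have nn: "AE p in Q. 0 \<le> snd p"
    by (subst (asm) AE_distr_iff) (auto simp: measurable_def[symmetric] cong: measurable_cong_sets)
  have "Q.prob {p\<in>space Q. 11 * r < \<bar>T (fst p) - snd p\<bar>}
     \<le> Q.prob {p\<in>space Q. \<not> (b (T (fst p)) \<le> b (snd p) + 10 \<and> b (snd p) \<le> b (T (fst p)) + 10)}"
  proof (rule Q.finite_measure_mono_AE)
    show "AE p in Q. p \<in> {p\<in>space Q. 11 * r < \<bar>T (fst p) - snd p\<bar>}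
      \<longrightarrow> p \<in> {p\<in>space Q. \<not> (b (T (fst p)) \<le> b (snd p) + 10 \<and> b (snd p) \<le> b (T (fst p)) + 10)}"
      using nn
    proof eventually_elim
      case (elim p)
      have "\<bar>T (fst p) - snd p\<bar> \<le> 11 * r"
        if "b (T (fst p)) \<le> b (snd p) + 10" "b (snd p) \<le> b (T (fst p)) + 10"
      proof -
        have "real (b (T (fst p))) \<le> real (b (snd p)) + 10" "real (b (snd p)) \<le> real (b (T (fst p))) + 10"
          using that by linarith+
        then have "\<bar>T (fst p) / r - snd p / r\<bar> \<le> 11"
          using bl[OF T(2)[of "fst p"]] bl[OF elim] by linarith
        then show ?thesis using r by (simp add: diff_divide_distrib[symmetric] abs_divide divide_le_eq)
      qed
      then show ?case by auto
    qed
    show "{p\<in>space Q. \<not> (b (T (fst p)) \<le> b (snd p) + 10 \<and> b (snd p) \<le> b (T (fst p)) + 10)} \<in> sets Q"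
    proof -
      have "{p\<in>space Q. \<not> (b (T (fst p)) \<le> b (snd p) + 10 \<and> b (snd p) \<le> b (T (fst p)) + 10)}
        = {p\<in>space Q. \<not> (B1 p \<le> B2 p + 10 \<and> B2 p \<le> B1 p + 10)}"
        unfolding B1_def B2_def
        by auto
      also have "\<dots> \<in> sets Q" by measurable
      finally show ?thesis .
    qed
  qed
  with Qb Q show ?thesis by (meson order_trans)
qed

section \<open>The regression model\<close>

definition grid_cell :: "nat \<Rightarrow> ('p \<Rightarrow> nat) \<Rightarrow> (real^'p) set" where
  "grid_cell k f = {y \<in> unit_cube. \<forall>i. cell_index k (y$i) = f i}"

lemma cell_eq_grid_cell: "cell k x = grid_cell k (\<lambda>i. cell_index k (x$i))"
  by (simp add: cell_def grid_cell_def)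

lemma cell_index_less: "1 \<le> k \<Longrightarrow> cell_index k t < k"
  by (auto simp: cell_index_def)

lemma cell_index_eqI:
  assumes "a < k" "real a / real k \<le> t" "t < (real a + 1) / real k"
  shows "cell_index k t = a"
proof -
  have k: "0 < real k" using assms(1) by auto
  have "real a \<le> t * real k" "t * real k < real a + 1"
    using assms(2,3) k by (simp_all add: divide_le_eq less_divide_eq)
  then have "\<lfloor>t * real k\<rfloor> = int a" by (intro floor_unique) auto
  then show ?thesis using assms(1) by (simp add: cell_index_def)
qed

text \<open>Every multi-index below \<open>k\<close> is attained, at the lower corner f / k of its
  cell. This turns the supremum over the cube into a maximum over finitely many cells.\<close>

lemma cell_image_unit_cube:
  assumes k: "1 \<le> k"
  shows "cell k ` (unit_cube :: (real^'p) set) = grid_cell k ` {f. \<forall>i. f i < k}"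
proof (intro equalityI subsetI)
  fix C assume "C \<in> cell k ` (unit_cube :: (real^'p) set)"
  then show "C \<in> grid_cell k ` {f. \<forall>i. f i < k}"
    using cell_index_less[OF k] by (auto simp: cell_eq_grid_cell)
next
  fix C :: "(real^'p) set" assume "C \<in> grid_cell k ` {f. \<forall>i. f i < k}"
  then obtain f where f: "\<And>i. f i < k" "C = grid_cell k f" by auto
  define x :: "real^'p" where "x = (\<chi> i. real (f i) / real k)"
  have "cell_index k (x$i) = f i" for i
    using k f(1)[of i] by (intro cell_index_eqI) (auto simp: x_def divide_strict_right_mono)
  moreover have "x \<in> unit_cube"
    using f(1) k by (auto simp: x_def unit_cube_def divide_le_eq less_imp_le)
  ultimately show "C \<in> cell k ` unit_cube"
    using f(2) by (intro image_eqI[of _ _ x]) (auto simp: cell_eq_grid_cell)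
qed

lemma grid_cell_disjoint: "f \<noteq> g \<Longrightarrow> x \<in> grid_cell k f \<Longrightarrow> x \<notin> grid_cell k g"
  by (auto simp: grid_cell_def)

lemma sets_grid_cell [measurable]: "grid_cell k f \<in> sets (borel :: (real^'p) measure)"
proof -
  have m[measurable]: "cell_index k \<in> borel \<rightarrow>\<^sub>M count_space UNIV"
    unfolding cell_index_def[abs_def] by measurable
  have "{y :: real^'p. \<forall>i. 0 \<le> y$i \<and> y$i \<le> 1 \<and> cell_index k (y$i) = f i} \<in> sets borel"
    by measurable
  moreover have "grid_cell k f = {y :: real^'p. \<forall>i. 0 \<le> y$i \<and> y$i \<le> 1 \<and> cell_index k (y$i) = f i}"
    by (auto simp: grid_cell_def unit_cube_def)
  ultimately show ?thesis by simp
qed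

text \<open>The open box between the two corners lies in the cell however the faces are assigned,
  and it has the full volume k^(-p).\<close>

lemma emeasure_grid_cell_ge:
  fixes f :: "'p::finite \<Rightarrow> nat"
  assumes k: "1 \<le> k" and f: "\<And>i. f i < k"
  shows "ennreal (1 / real (k ^ CARD('p))) \<le> emeasure lborel (grid_cell k f)"
proof -
  define a b :: "real^'p" where "a = (\<chi> i. real (f i) / real k)" and "b = (\<chi> i. (real (f i) + 1) / real k)"
  have k0: "0 < real k" using k by simp
  have ab: "a $ i \<le> b $ i" for i using k0 by (simp add: a_def b_def divide_right_mono)
  have sub: "box a b \<subseteq> grid_cell k f"
  proof
    fix y assume y: "y \<in> box a b"
    have yi: "real (f i) / real k < y $ i" "y $ i < (real (f i) + 1) / real k" for i
      using y by (auto simp: mem_box_cart a_def b_def)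
    have "0 \<le> y $ i" "y $ i \<le> 1" for i
    proof -
      show "0 \<le> y $ i" using yi(1)[of i] k0 by (meson divide_nonneg_nonneg less_imp_le of_nat_0_le_iff order_trans)
      have "real (f i) + 1 \<le> real k" using f[of i] by linarith
      then have "(real (f i) + 1) / real k \<le> 1" using k0 by simp
      then show "y $ i \<le> 1" using yi(2)[of i] by linarith
    qed
    moreover have "cell_index k (y $ i) = f i" for i
      using yi[of i] f[of i] by (intro cell_index_eqI) auto
    ultimately show "y \<in> grid_cell k f" by (auto simp: grid_cell_def unit_cube_def)
  qed
  have ne: "cbox a b \<noteq> {}" using ab by (simp add: interval_ne_empty_cart)
  have "emeasure lborel (box a b) = emeasure lborel (cbox a b)"
    using ab by (simp add: emeasure_lborel_box_eq emeasure_lborel_cbox_eq)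
  also have "\<dots> = ennreal (measure lborel (cbox a b))"
    by (rule emeasure_eq_ennreal_measure) (simp add: emeasure_lborel_cbox_eq)
  also have "measure lborel (cbox a b) = (\<Prod>i\<in>UNIV. b $ i - a $ i)" by (rule content_cbox_cart[OF ne])
  also have "\<dots> = 1 / real (k ^ CARD('p))"
    using k0 by (simp add: a_def b_def add_divide_distrib power_one_over)
  finally have "ennreal (1 / real (k ^ CARD('p))) = emeasure lborel (box a b)" by simp
  also have "\<dots> \<le> emeasure lborel (grid_cell k f)" by (rule emeasure_mono[OF sub]) simp
  finally show ?thesis .
qed

text \<open>Numbering the cells by {..<k^p} identifies them with the coordinates of the normal
  vector in \<open>max_abs_normal_law\<close>.\<close>

lemma ex_grid_enumeration:
  assumes "1 \<le> k"
  obtains e :: "nat \<Rightarrow> 'p::finite \<Rightarrow> nat"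
  where "bij_betw e {..<k ^ CARD('p)} {f. \<forall>i. f i < k}"
proof -
  have eq: "{f :: 'p \<Rightarrow> nat. \<forall>i. f i < k} = Pi\<^sub>E UNIV (\<lambda>_. {..<k})" by (auto simp: PiE_UNIV_domain)
  have "card {f :: 'p \<Rightarrow> nat. \<forall>i. f i < k} = k ^ CARD('p)" unfolding eq by (subst card_PiE) auto
  moreover have "finite {f :: 'p \<Rightarrow> nat. \<forall>i. f i < k}" unfolding eq by (rule finite_PiE) auto
  ultimately show ?thesis using ex_bij_betw_nat_finite that by (metis atLeast0LessThan)
qed

lemma abs_power_le_powr:
  fixes t nu :: real
  assumes "real j \<le> nu"
  shows "\<bar>t\<bar> ^ j \<le> 1 + \<bar>t\<bar> powr nu"
proof (cases "\<bar>t\<bar> \<le> 1")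
  case True
  then have "\<bar>t\<bar> ^ j \<le> 1" by (simp add: power_le_one)
  then show ?thesis by (simp add: add_increasing2)
next
  case False
  then have "\<bar>t\<bar> ^ j = \<bar>t\<bar> powr real j" by (simp add: powr_realpow)
  also have "\<dots> \<le> \<bar>t\<bar> powr nu" using False assms by (intro powr_mono) auto
  finally show ?thesis by simp
qed

lemma measurable_Max_abs:
  fixes f :: "'i \<Rightarrow> 'x \<Rightarrow> real"
  assumes "finite I" "\<And>a. a \<in> I \<Longrightarrow> f a \<in> borel_measurable N"
  shows "(\<lambda>x. Max ((\<lambda>a. \<bar>f a x\<bar>) ` I)) \<in> borel_measurable N"
  using assms by (intro borel_measurable_Max) auto

lemma Max_abs_nonneg:
  fixes f :: "'i \<Rightarrow> real"
  assumes "finite I" "I \<noteq> {}"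
  shows "0 \<le> Max ((\<lambda>a. \<bar>f a\<bar>) ` I)"
  using assms by (subst Max_ge_iff) auto

text \<open>Conditional moments given X are expressed through integrals over the events that X lies
  in B, for all Borel sets B. In this sense \<open>m3\<close> is a version of the conditional third
  absolute moment of \<open>eps\<close>, bounded by \<open>K3\<close> on the cube.\<close>

locale regression_model = prob_space M for M :: "'a measure" +
  fixes X :: "'a \<Rightarrow> real^'p" and eps :: "'a \<Rightarrow> real" and fX sigma2 m3 :: "real^'p \<Rightarrow> real"
    and cX cs Cs K3 nu :: real
  assumes X_meas [measurable]: "X \<in> borel_measurable M"
    and eps_meas [measurable]: "eps \<in> borel_measurable M"
    and X_cube: "AE \<omega> in M. X \<omega> \<in> unit_cube"
    and cond_mean: "\<And>B. B \<in> sets borel \<Longrightarrow> (\<integral>\<omega>. eps \<omega> * indicator B (X \<omega>) \<partial>M) = 0"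
    and density: "distributed M lborel X (\<lambda>x. ennreal (fX x))"
    and cX: "0 < cX" "\<And>x. x \<in> unit_cube \<Longrightarrow> cX \<le> fX x"
    and sigma2_meas [measurable]: "sigma2 \<in> borel_measurable borel"
    and cond_var: "\<And>B. B \<in> sets borel \<Longrightarrow>
      (\<integral>\<omega>. (eps \<omega>)\<^sup>2 * indicator B (X \<omega>) \<partial>M) = (\<integral>\<omega>. sigma2 (X \<omega>) * indicator B (X \<omega>) \<partial>M)"
    and cs: "0 < cs" "\<And>x. x \<in> unit_cube \<Longrightarrow> cs \<le> sigma2 x" "\<And>x. x \<in> unit_cube \<Longrightarrow> sigma2 x \<le> Cs"
    and m3_int: "integrable M (\<lambda>\<omega>. m3 (X \<omega>))"
    and m3_le: "\<And>x. x \<in> unit_cube \<Longrightarrow> m3 x \<le> K3"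
    and third: "\<And>B. B \<in> sets borel \<Longrightarrow>
      (\<integral>\<omega>. \<bar>eps \<omega>\<bar> ^ 3 * indicator B (X \<omega>) \<partial>M) = (\<integral>\<omega>. m3 (X \<omega>) * indicator B (X \<omega>) \<partial>M)"
    and nu: "4 \<le> nu" and nu_int: "integrable M (\<lambda>\<omega>. \<bar>eps \<omega>\<bar> powr nu)"
begin

definition data_law :: "((real^'p) \<times> real) measure" where
  "data_law = distr M borel (\<lambda>\<omega>. (X \<omega>, eps \<omega>))"

text \<open>The enlarged probability space is taken in canonical form: a joint law of the sample
  (first component) and the coupled maximum (second component) with the prescribed
  marginals.\<close>

definition is_coupling :: "nat \<Rightarrow> nat \<Rightarrow> ((nat \<Rightarrow> (real^'p) \<times> real) \<times> real) measure \<Rightarrow> bool" where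
  "is_coupling n k Q \<longleftrightarrow> prob_space Q
    \<and> sets Q = sets (PiM {..<n} (\<lambda>_. (borel :: ((real^'p) \<times> real) measure)) \<Otimes>\<^sub>M (borel :: real measure))
    \<and> distr Q (PiM {..<n} (\<lambda>_. borel)) fst = PiM {..<n} (\<lambda>_. data_law)
    \<and> distr Q borel snd = max_abs_normal_law (k ^ CARD('p))"

definition max_deviation :: "nat \<Rightarrow> nat \<Rightarrow> (nat \<Rightarrow> (real^'p) \<times> real) \<Rightarrow> real" where
  "max_deviation n k d = sqrt (real n) * (SUP x\<in>unit_cube. \<bar>sqrt (tau_delta M X sigma2 k x) *
     m_tilde n (\<lambda>j. fst (d j)) (\<lambda>j. snd (d j)) k (p_delta M X k) x\<bar>)"

lemma data_meas: "(\<lambda>\<omega>. (X \<omega>, eps \<omega>)) \<in> M \<rightarrow>\<^sub>M borel"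
  by measurable

lemma prob_space_data_law: "prob_space data_law"
  unfolding data_law_def by (rule prob_space_distr[OF data_meas])

lemma is_couplingI:
  assumes "prob_space Q" and s: "sets Q = sets (PiM {..<n} (\<lambda>_. data_law) \<Otimes>\<^sub>M max_abs_normal_law (k ^ CARD('p)))"
    and f: "distr Q (PiM {..<n} (\<lambda>_. data_law)) fst = PiM {..<n} (\<lambda>_. data_law)"
    and sn: "distr Q (max_abs_normal_law (k ^ CARD('p))) snd = max_abs_normal_law (k ^ CARD('p))"
  shows "is_coupling n k Q"
proof -
  have s1: "sets (PiM {..<n} (\<lambda>_. borel :: ((real^'p) \<times> real) measure)) = sets (PiM {..<n} (\<lambda>_. data_law))"
    by (rule sets_PiM_cong) (auto simp: data_law_def)
  have s2: "sets (borel :: real measure) = sets (max_abs_normal_law (k ^ CARD('p)))"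
    by (simp add: max_abs_normal_law_def)
  have "distr Q (PiM {..<n} (\<lambda>_. borel)) fst = PiM {..<n} (\<lambda>_. data_law)"
    by (rule trans[OF distr_cong f]) (auto simp: s1)
  moreover have "distr Q borel snd = max_abs_normal_law (k ^ CARD('p))"
    by (rule trans[OF distr_cong sn]) (auto simp: s2)
  moreover have "sets Q = sets (PiM {..<n} (\<lambda>_. (borel :: ((real^'p) \<times> real) measure)) \<Otimes>\<^sub>M (borel :: real measure))"
    unfolding s by (rule sets_pair_measure_cong) (simp_all add: s1 s2)
  ultimately show ?thesis using assms(1) by (simp add: is_coupling_def)
qed

text \<open>The theorem asks for a coupling at every n, the error bound holds only eventually; this
  supplies the remaining indices. With eta = 1 the comparison hypothesis is trivial, so the Strassen
  lemma applies even to the constant statistic 0.\<close>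

lemma ex_coupling:
  assumes k: "1 \<le> k"
  shows "\<exists>Q. is_coupling n k Q"
proof -
  let ?N = "k ^ CARD('p)"
  define G where "G = PiM {..<?N} (\<lambda>_. std_normal)"
  interpret G: prob_space G unfolding G_def by (rule prob_space_PiM) (rule prob_space_std_normal)
  define D where "D = PiM {..<n} (\<lambda>_. data_law)"
  interpret D: prob_space D unfolding D_def by (rule prob_space_PiM) (rule prob_space_data_law)
  have ne: "{..<?N} \<noteq> {}" using k by (simp add: lessThan_empty_iff)
  have "\<exists>Q. prob_space Q \<and> sets Q = sets (D \<Otimes>\<^sub>M distr G borel (\<lambda>z. Max ((\<lambda>j. \<bar>z j\<bar>) ` {..<?N})))
    \<and> distr Q D fst = D
    \<and> distr Q (distr G borel (\<lambda>z. Max ((\<lambda>j. \<bar>z j\<bar>) ` {..<?N}))) snd = distr G borel (\<lambda>z. Max ((\<lambda>j. \<bar>z j\<bar>) ` {..<?N}))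
    \<and> measure Q {p\<in>space Q. 11 * 1 < \<bar>(\<lambda>_. 0) (fst p) - snd p\<bar>} \<le> 2"
  proof (rule coupling_of_comparison[where eta=1])
    show "(\<lambda>z. Max ((\<lambda>j. \<bar>z j\<bar>) ` {..<?N})) \<in> borel_measurable G"
      unfolding G_def by (intro measurable_Max_abs) auto
    show "0 \<le> Max ((\<lambda>j. \<bar>z j\<bar>) ` {..<?N})" for z :: "nat \<Rightarrow> real"
      by (rule Max_abs_nonneg[OF _ ne]) simp
    show "D.prob {x\<in>space D. 0 \<in> A} \<le> G.prob {g\<in>space G. \<exists>a\<in>A. \<bar>Max ((\<lambda>j. \<bar>g j\<bar>) ` {..<?N}) - a\<bar> \<le> 10 * 1} + 1" for A
      using D.prob_le_1[of "{x\<in>space D. 0 \<in> A}"] by (simp add: add_increasing)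
  qed (auto simp: D.prob_space_axioms G.prob_space_axioms)
  then obtain Q where "prob_space Q" "sets Q = sets (D \<Otimes>\<^sub>M max_abs_normal_law ?N)"
    "distr Q D fst = D" "distr Q (max_abs_normal_law ?N) snd = max_abs_normal_law ?N"
    unfolding G_def max_abs_normal_law_def by blast
  then have "is_coupling n k Q" unfolding D_def by (rule is_couplingI)
  then show ?thesis ..
qed

section \<open>Moment bounds on single cells and the coupling for fixed n\<close>

lemma eps_power_int: "j \<le> 4 \<Longrightarrow> integrable M (\<lambda>\<omega>. \<bar>eps \<omega>\<bar> ^ j)"
proof -
  assume j: "j \<le> 4"
  then have jn: "real j \<le> nu" using nu by linarith
  have "integrable M (\<lambda>\<omega>. 1 + \<bar>eps \<omega>\<bar> powr nu)" using nu_int by simp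
  then show ?thesis
  proof (rule Bochner_Integration.integrable_bound)
    show "AE \<omega> in M. norm (\<bar>eps \<omega>\<bar> ^ j) \<le> norm (1 + \<bar>eps \<omega>\<bar> powr nu)"
      using abs_power_le_powr[OF jn] by (auto simp: power_abs abs_of_nonneg add_nonneg_nonneg)
  qed measurable
qed

lemma prob_grid_cell_ge:
  fixes f :: "'p \<Rightarrow> nat"
  assumes k: "1 \<le> k" and f: "\<And>i. f i < k"
  shows "cX / real (k ^ CARD('p)) \<le> prob {\<omega>\<in>space M. X \<omega> \<in> grid_cell k f}"
proof -
  have "ennreal (cX / real (k ^ CARD('p))) = ennreal cX * ennreal (1 / real (k ^ CARD('p)))"
    using cX by (simp add: ennreal_mult[symmetric])
  also have "\<dots> \<le> ennreal cX * emeasure lborel (grid_cell k f)"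
    by (intro mult_left_mono emeasure_grid_cell_ge k f) simp
  also have "\<dots> = (\<integral>\<^sup>+x. ennreal cX * indicator (grid_cell k f) x \<partial>lborel)"
    by (subst nn_integral_cmult_indicator) auto
  also have "\<dots> \<le> (\<integral>\<^sup>+x. ennreal (fX x) * indicator (grid_cell k f) x \<partial>lborel)"
    using cX(2) by (intro nn_integral_mono) (auto simp: indicator_def grid_cell_def intro!: ennreal_leI)
  also have "\<dots> = emeasure M (X -` grid_cell k f \<inter> space M)"
    by (rule distributed_emeasure[OF density, symmetric]) auto
  also have "X -` grid_cell k f \<inter> space M = {\<omega>\<in>space M. X \<omega> \<in> grid_cell k f}" by auto
  finally show ?thesis by (simp add: emeasure_eq_measure)
qed

lemma cell_variance_ge:
  assumes B[measurable]: "B \<in> sets borel"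
  shows "cs * prob {\<omega>\<in>space M. X \<omega> \<in> B} \<le> (\<integral>\<omega>. sigma2 (X \<omega>) * indicator B (X \<omega>) \<partial>M)"
proof -
  have "cs * prob {\<omega>\<in>space M. X \<omega> \<in> B} = (\<integral>\<omega>. cs * indicator {\<omega>\<in>space M. X \<omega> \<in> B} \<omega> \<partial>M)"
    by (simp add: Int_def conj_commute)
  also have "\<dots> \<le> (\<integral>\<omega>. sigma2 (X \<omega>) * indicator B (X \<omega>) \<partial>M)"
  proof (rule integral_mono_AE)
    show "integrable M (\<lambda>\<omega>. cs * indicator {\<omega>\<in>space M. X \<omega> \<in> B} \<omega>)"
      by (intro integrable_mult_right integrable_real_indicator) (auto simp: emeasure_eq_measure)
    show "integrable M (\<lambda>\<omega>. sigma2 (X \<omega>) * indicator B (X \<omega>))"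
    proof (rule integrable_const_bound[where B=Cs])
      show "AE \<omega> in M. norm (sigma2 (X \<omega>) * indicator B (X \<omega>)) \<le> Cs"
        using X_cube
      proof eventually_elim
        case (elim \<omega>)
        then show ?case using cs(1) cs(2)[OF elim] cs(3)[OF elim] by (auto simp: indicator_def)
      qed
    qed measurable
    show "AE \<omega> in M. cs * indicator {\<omega>\<in>space M. X \<omega> \<in> B} \<omega> \<le> sigma2 (X \<omega>) * indicator B (X \<omega>)"
      using X_cube AE_space by eventually_elim (use cs in \<open>auto simp: indicator_def\<close>)
  qed
  finally show ?thesis .
qed

lemma third_moment_le:
  assumes B[measurable]: "B \<in> sets borel"
  shows "(\<integral>\<omega>. \<bar>eps \<omega>\<bar> ^ 3 * indicator B (X \<omega>) \<partial>M) \<le> max 0 K3 * prob {\<omega>\<in>space M. X \<omega> \<in> B}"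
proof -
  have "(\<integral>\<omega>. \<bar>eps \<omega>\<bar> ^ 3 * indicator B (X \<omega>) \<partial>M) = (\<integral>\<omega>. m3 (X \<omega>) * indicator B (X \<omega>) \<partial>M)"
    by (rule third[OF B])
  also have "\<dots> \<le> (\<integral>\<omega>. max 0 K3 * indicator {\<omega>\<in>space M. X \<omega> \<in> B} \<omega> \<partial>M)"
  proof (rule integral_mono_AE)
    show "integrable M (\<lambda>\<omega>. max 0 K3 * indicator {\<omega>\<in>space M. X \<omega> \<in> B} \<omega>)"
      by (intro integrable_mult_right integrable_real_indicator) (auto simp: emeasure_eq_measure)
    have "{\<omega>\<in>space M. X \<omega> \<in> B} \<in> sets M" by measurable
    from integrable_mult_indicator[OF this m3_int]
    show "integrable M (\<lambda>\<omega>. m3 (X \<omega>) * indicator B (X \<omega>))"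
      by (rule Bochner_Integration.integrable_cong[THEN iffD1, rotated 2]) (auto simp: indicator_def)
    show "AE \<omega> in M. m3 (X \<omega>) * indicator B (X \<omega>) \<le> max 0 K3 * indicator {\<omega>\<in>space M. X \<omega> \<in> B} \<omega>"
      using X_cube AE_space
    proof eventually_elim
      case (elim \<omega>)
      then show ?case using m3_le[of "X \<omega>"] by (auto simp: indicator_def max_def)
    qed
  qed
  also have "\<dots> = max 0 K3 * prob {\<omega>\<in>space M. X \<omega> \<in> B}"
    by (simp add: Int_def conj_commute)
  finally show ?thesis .
qed

text \<open>This checks the moment hypotheses of \<open>gaussian_comparison_max\<close> for the
  normalised summands. Everything rests on s_a^2 \<ge> cs p_a and p_a \<ge> cX / N, hence s_a \<ge>
  sqrt (cs cX / N).\<close>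

lemma regression_coupling:
  fixes n k :: nat and r eta' :: real
  defines "N \<equiv> k ^ CARD('p)"
  defines "l \<equiv> ln (2 * real N)"
  defines "\<kappa> \<equiv> l / (r * sqrt (real n))"
  assumes k: "1 \<le> k" and n: "0 < n" and r: "0 < r" and l: "1 \<le> l"
    and eta': "real n * (8 / l) * (20 * (max 0 K3 / (cs * sqrt (cs * cX)) * sqrt (real N) * \<kappa> ^ 3
        + expectation (\<lambda>\<omega>. \<bar>eps \<omega>\<bar> powr nu) * (sqrt (real N) / sqrt (cs * cX)) powr nu * \<kappa> powr nu)
      + 32 * (\<kappa> ^ 3 * sqrt (real N))) < eta'"
  shows "\<exists>Q. is_coupling n k Q \<and>
    measure Q {\<omega>\<in>space Q. 11 * r < \<bar>max_deviation n k (fst \<omega>) - snd \<omega>\<bar>} \<le> eta'"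
proof -
  obtain e :: "nat \<Rightarrow> 'p \<Rightarrow> nat" where e: "bij_betw e {..<N} {f. \<forall>i. f i < k}"
    using ex_grid_enumeration[OF k] unfolding N_def by blast
  have N1: "1 \<le> N" using k by (simp add: N_def)
  have ne: "{..<N} \<noteq> {}" using N1 by (simp add: lessThan_empty_iff)
  have ek: "e a i < k" if "a < N" for a i using e that by (auto simp: bij_betw_def)
  define C where "C a = grid_cell k (e a)" for a
  have Cm[measurable]: "C a \<in> sets borel" for a unfolding C_def by measurable
  have disj: "x \<notin> C b" if "x \<in> C a" "a < N" "b < N" "a \<noteq> b" for x a b
    using grid_cell_disjoint[of "e a" "e b" x k] that e by (auto simp: C_def bij_betw_def inj_on_def)
  define p where "p a = prob {\<omega>\<in>space M. X \<omega> \<in> C a}" for a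
  define v where "v a = (\<integral>\<omega>. sigma2 (X \<omega>) * indicator (C a) (X \<omega>) \<partial>M)" for a
  define s where "s a = sqrt (v a)" for a
  define c where "c = sqrt (cs * cX)"
  have c0: "0 < c" using cs cX by (simp add: c_def)
  have p: "cX / real N \<le> p a" if "a < N" for a
    unfolding p_def C_def N_def by (rule prob_grid_cell_ge[OF k ek[OF that]])
  have p0: "0 < p a" if "a < N" for a
    using p[OF that] cX(1) N1 by (meson divide_pos_pos less_le_trans of_nat_0_less_iff zero_less_one)
  have vp: "cs * p a \<le> v a" for a unfolding p_def v_def by (rule cell_variance_ge) simp
  have v0: "0 < v a" if "a < N" for a
    using vp[of a] p0[OF that] cs(1) by (meson less_le_trans mult_pos_pos)
  have s0: "0 < s a" if "a < N" for a using v0[OF that] by (simp add: s_def)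
  have s2: "s a * s a = v a" if "a < N" for a using v0[OF that] by (simp add: s_def)
  have sc: "c / sqrt (real N) \<le> s a" if "a < N" for a
  proof -
    have "cs * cX / real N \<le> cs * p a" using mult_left_mono[OF p[OF that], of cs] cs by simp
    then have "cs * cX / real N \<le> v a" using vp[of a] by linarith
    then show ?thesis unfolding s_def c_def real_sqrt_divide[symmetric] by (rule real_sqrt_le_mono)
  qed
  \<comment> \<open>One observation's contribution to cell \<open>a\<close>, scaled to unit
    variance; an observation lies in at most one cell, so at most one coordinate is nonzero.\<close>
  define ze where "ze x a = snd x * indicator (C a) (fst x) / s a" for x :: "(real^'p) \<times> real" and a
  have zm0[measurable]: "(\<lambda>x. ze x a) \<in> borel_measurable borel" for a
    unfolding ze_def borel_prod[symmetric] by measurable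
  have zm: "(\<lambda>x. ze x a) \<in> borel_measurable data_law" for a
    unfolding data_law_def using zm0 by simp
  have trans: "integrable data_law f \<longleftrightarrow> integrable M (\<lambda>\<omega>. f (X \<omega>, eps \<omega>))"
    "(\<integral>x. f x \<partial>data_law) = (\<integral>\<omega>. f (X \<omega>, eps \<omega>) \<partial>M)"
    if "f \<in> borel_measurable borel" for f :: "(real^'p) \<times> real \<Rightarrow> real"
    unfolding data_law_def
    using integrable_distr_eq[OF data_meas that] integral_distr[OF data_meas that] by auto
  have intB: "integrable M (\<lambda>\<omega>. f \<omega> * indicator (C a) (X \<omega>))" if "integrable M f" for f :: "'a \<Rightarrow> real" and a
  proof -
    have "{\<omega>\<in>space M. X \<omega> \<in> C a} \<in> sets M" by measurable
    from integrable_mult_indicator[OF this that] show ?thesis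
      by (rule Bochner_Integration.integrable_cong[THEN iffD1, rotated 2]) (auto simp: indicator_def)
  qed
  have eps_int: "integrable M eps" using eps_power_int[of 1] integrable_abs_cancel[of M eps] by simp
  define T where "T x = Max ((\<lambda>a. \<bar>(\<Sum>j<n. ze (x j) a) / sqrt (real n)\<bar>) ` {..<N})" for x
  define S where "S g = Max ((\<lambda>a. \<bar>g a\<bar>) ` {..<N})" for g :: "nat \<Rightarrow> real"
  define D where "D = PiM {..<n} (\<lambda>_. data_law)"
  define G where "G = PiM {..<N} (\<lambda>_. std_normal)"
  have comparison: "measure D {x\<in>space D. T x \<in> A} \<le> measure G {g\<in>space G. \<exists>a\<in>A. \<bar>S g - a\<bar> \<le> 10 * r}
    + real n * (8 / l) * (20 * (max 0 K3 / (cs * sqrt (cs * cX)) * sqrt (real N) * \<kappa> ^ 3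
        + expectation (\<lambda>\<omega>. \<bar>eps \<omega>\<bar> powr nu) * (sqrt (real N) / sqrt (cs * cX)) powr nu * \<kappa> powr nu)
      + 32 * (\<kappa> ^ 3 * sqrt (real N)))"
    if A: "{x\<in>space D. T x \<in> A} \<in> sets D" "{g\<in>space G. \<exists>a\<in>A. \<bar>S g - a\<bar> \<le> 10 * r} \<in> sets G" for A
  proof -
    have "measure D {x\<in>space D. T x \<in> A} \<le> measure G {g\<in>space G. \<exists>a\<in>A. \<bar>S g - a\<bar> \<le> 10 * r}
    + real n * (8 / ln (2 * real (card {..<N}))) * (20 * (max 0 K3 / (cs * sqrt (cs * cX)) * sqrt (real N) * (ln (2 * real (card {..<N})) / (r * sqrt (real n))) ^ 3
        + expectation (\<lambda>\<omega>. \<bar>eps \<omega>\<bar> powr nu) * (sqrt (real N) / sqrt (cs * cX)) powr nu * (ln (2 * real (card {..<N})) / (r * sqrt (real n))) powr nu)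
      + 32 * ((ln (2 * real (card {..<N})) / (r * sqrt (real n))) ^ 3 * sqrt (real (card {..<N}))))"
      using A unfolding D_def G_def T_def S_def
    proof (intro gaussian_comparison_max[where ze=ze])
      show "prob_space data_law" by (rule prob_space_data_law)
      show "(\<lambda>x. ze x a) \<in> borel_measurable data_law" for a by (rule zm)
      show "\<exists>b\<in>{..<N}. \<forall>a\<in>{..<N}. a \<noteq> b \<longrightarrow> ze x a = 0" for x
      proof (cases "\<exists>b<N. fst x \<in> C b")
        case True
        then obtain b where "b < N" "fst x \<in> C b" by blast
        then show ?thesis using disj[of "fst x" b] by (intro bexI[of _ b]) (auto simp: ze_def)
      next
        case False
        then show ?thesis using N1 by (intro bexI[of _ 0]) (auto simp: ze_def)
      qed
      show "integrable data_law (\<lambda>x. ze x a)" for a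
        using intB[OF eps_int, of a] by (subst trans(1)[OF zm0]) (simp add: ze_def)
      show "(\<integral>x. ze x a \<partial>data_law) = 0" for a
        using cond_mean[of "C a"] by (subst trans(2)[OF zm0]) (simp add: ze_def)
      have m2: "(\<lambda>x. (ze x a)\<^sup>2) \<in> borel_measurable borel" and m3: "(\<lambda>x. \<bar>ze x a\<bar> ^ 3) \<in> borel_measurable borel"
        for a by measurable
      have z2: "(ze (x, y) a)\<^sup>2 = y\<^sup>2 * indicator (C a) x / (s a)\<^sup>2" for x y a
        by (simp add: ze_def power_divide power_mult_distrib indicator_def)
      have "integrable M (\<lambda>\<omega>. (eps \<omega>)\<^sup>2)" using eps_power_int[of 2] by simp
      from intB[OF this] show "integrable data_law (\<lambda>x. (ze x a)\<^sup>2)" for a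
        by (subst trans(1)[OF m2]) (simp add: z2)
      show "(\<integral>x. (ze x a)\<^sup>2 \<partial>data_law) = 1" if "a \<in> {..<N}" for a
        using cond_var[of "C a"] v0[of a] s2[of a] that
        by (subst trans(2)[OF m2]) (simp add: z2 v_def[symmetric] s_def)
      have z3: "\<bar>ze (x, y) a\<bar> ^ 3 = \<bar>y\<bar> ^ 3 * indicator (C a) x / (s a) ^ 3" if "a < N" for x y a
        using s0[OF that] by (simp add: ze_def power_divide power_mult_distrib indicator_def abs_divide abs_mult)
      show "integrable data_law (\<lambda>x. \<bar>ze x a\<bar> ^ 3)" if "a \<in> {..<N}" for a
        using intB[OF eps_power_int[of 3], of a] that by (subst trans(1)[OF m3]) (simp add: z3)
      show "(\<integral>x. \<bar>ze x a\<bar> ^ 3 \<partial>data_law) \<le> max 0 K3 / (cs * sqrt (cs * cX)) * sqrt (real N)" if a: "a \<in> {..<N}" for a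
      proof -
        have aN: "a < N" using a by simp
        have "(\<integral>x. \<bar>ze x a\<bar> ^ 3 \<partial>data_law) = (\<integral>\<omega>. \<bar>eps \<omega>\<bar> ^ 3 * indicator (C a) (X \<omega>) \<partial>M) / (s a) ^ 3"
          using aN by (subst trans(2)[OF m3]) (simp add: z3)
        also have "\<dots> \<le> max 0 K3 * p a / (s a) ^ 3"
          using third_moment_le[of "C a"] s0[OF aN] by (intro divide_right_mono) (auto simp: p_def)
        \<comment> \<open>Of the three factors s_a, one is bounded below by c / sqrt N and the other
          two by s_a^2 \<ge> cs p_a. The cell probability then cancels and only sqrt N
          remains.\<close>
        also have "\<dots> \<le> max 0 K3 * p a / (c / sqrt (real N) * (cs * p a))"
        proof (rule divide_left_mono)
          have "(s a) ^ 3 = s a * v a" using s2[OF aN] by (simp add: power3_eq_cube mult.assoc)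
          moreover have "c / sqrt (real N) * (cs * p a) \<le> s a * v a"
            using sc[OF aN] vp[of a] s0[OF aN] cs(1) p0[OF aN] by (intro mult_mono) auto
          ultimately show "c / sqrt (real N) * (cs * p a) \<le> (s a) ^ 3" by simp
          show "0 \<le> max 0 K3 * p a" using p0[OF aN] by simp
          show "0 < (s a) ^ 3 * (c / sqrt (real N) * (cs * p a))"
            using s0[OF aN] c0 cs(1) p0[OF aN] N1 by simp
        qed
        also have "\<dots> = max 0 K3 / (cs * c) * sqrt (real N)"
          using p0[OF aN] c0 cs(1) by (simp add: field_simps)
        finally show ?thesis unfolding c_def .
      qed
      have znu: "\<bar>ze (x, y) a\<bar> powr nu = \<bar>y\<bar> powr nu * indicator (C a) x / (s a) powr nu" if "a < N" for x y a
        using s0[OF that] by (simp add: ze_def indicator_def abs_divide powr_divide)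
      have nm: "(\<lambda>x. \<bar>ze x a\<bar> powr nu) \<in> borel_measurable borel" for a by measurable
      show "integrable data_law (\<lambda>x. \<bar>ze x a\<bar> powr nu)" if "a \<in> {..<N}" for a
        using intB[OF nu_int, of a] that by (subst trans(1)[OF nm]) (simp add: znu)
      show "(\<Sum>a<N. \<integral>x. \<bar>ze x a\<bar> powr nu \<partial>data_law)
         \<le> expectation (\<lambda>\<omega>. \<bar>eps \<omega>\<bar> powr nu) * (sqrt (real N) / sqrt (cs * cX)) powr nu"
      proof -
        define w where "w = (sqrt (real N) / c) powr nu"
        have sw: "1 / (s a) powr nu \<le> w" if "a < N" for a
        proof -
          have "1 / s a \<le> sqrt (real N) / c"
            using sc[OF that] s0[OF that] c0 N1 by (simp add: field_simps)
          then have "(1 / s a) powr nu \<le> w" unfolding w_def using s0[OF that] nu by (intro powr_mono2) auto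
          then show ?thesis using s0[OF that] by (simp add: powr_divide)
        qed
        have "(\<Sum>a<N. \<integral>x. \<bar>ze x a\<bar> powr nu \<partial>data_law)
           = (\<Sum>a<N. (\<integral>\<omega>. \<bar>eps \<omega>\<bar> powr nu * indicator (C a) (X \<omega>) \<partial>M) * (1 / (s a) powr nu))"
          by (intro sum.cong refl) (subst trans(2)[OF nm], simp add: znu)
        \<comment> \<open>After the uniform bound \<open>w\<close> on s_a^(-nu), the cell indicators
          add up to at most one, so the sum over all N cells is no larger than the full moment times
          \<open>w\<close>.\<close>
        also have "\<dots> \<le> (\<Sum>a<N. (\<integral>\<omega>. \<bar>eps \<omega>\<bar> powr nu * indicator (C a) (X \<omega>) \<partial>M) * w)"
          by (intro sum_mono mult_left_mono sw integral_nonneg_AE) auto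
        also have "\<dots> = (\<integral>\<omega>. (\<Sum>a<N. \<bar>eps \<omega>\<bar> powr nu * indicator (C a) (X \<omega>)) \<partial>M) * w"
          unfolding sum_distrib_right[symmetric]
          by (subst Bochner_Integration.integral_sum[OF intB[OF nu_int]]) (rule refl)
        also have "\<dots> \<le> expectation (\<lambda>\<omega>. \<bar>eps \<omega>\<bar> powr nu) * w"
        proof (intro mult_right_mono integral_mono)
          show "0 \<le> w" by (simp add: w_def)
          fix \<omega>
          have "(\<Sum>a<N. indicator (C a) (X \<omega>) :: real) \<le> 1"
          proof (cases "\<exists>b<N. X \<omega> \<in> C b")
            case True
            then obtain b where b: "b < N" "X \<omega> \<in> C b" by blast
            have "(\<Sum>a<N. indicator (C a) (X \<omega>) :: real) = (\<Sum>a\<in>{b}. indicator (C a) (X \<omega>))"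
              using b disj[of "X \<omega>" b] by (intro sum.mono_neutral_right) (auto simp: indicator_def)
            also have "\<dots> \<le> 1" by (subst sum.insert) (auto simp: indicator_def)
            finally show ?thesis .
          next
            case False
            then have "(\<Sum>a<N. indicator (C a) (X \<omega>) :: real) = 0" by (intro sum.neutral) auto
            also have "\<dots> \<le> 1" by simp
            finally show ?thesis .
          qed
          from mult_left_mono[OF this powr_ge_zero, of "\<bar>eps \<omega>\<bar>" nu]
          show "(\<Sum>a<N. \<bar>eps \<omega>\<bar> powr nu * indicator (C a) (X \<omega>)) \<le> \<bar>eps \<omega>\<bar> powr nu"
            unfolding sum_distrib_left mult_1_right .
        next
          show "integrable M (\<lambda>\<omega>. \<Sum>a<N. \<bar>eps \<omega>\<bar> powr nu * indicator (C a) (X \<omega>))"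
            by (intro Bochner_Integration.integrable_sum intB nu_int)
          show "integrable M (\<lambda>\<omega>. \<bar>eps \<omega>\<bar> powr nu)" by (rule nu_int)
        qed
        finally show ?thesis by (simp add: w_def c_def)
      qed
      show "3 \<le> nu" using nu by simp
      show "1 \<le> ln (2 * real (card {..<N}))" using l by (simp add: l_def)
    qed (use ne n r in auto)
    then show ?thesis by (simp add: l_def[symmetric] \<kappa>_def[symmetric])
  qed
  have Tm: "T \<in> borel_measurable D"
  proof -
    have [measurable]: "(\<lambda>x. ze x a) \<in> borel_measurable data_law" for a by (rule zm)
    show ?thesis unfolding T_def[abs_def] D_def by (intro measurable_Max_abs) auto
  qed
  have Sm: "S \<in> borel_measurable G"
    unfolding S_def[abs_def] G_def by (intro measurable_Max_abs) auto
  have T0: "0 \<le> T x" for x unfolding T_def by (rule Max_abs_nonneg[OF _ ne]) simp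
  have S0: "0 \<le> S x" for x unfolding S_def by (rule Max_abs_nonneg[OF _ ne]) simp
  have PD: "prob_space D" unfolding D_def by (rule prob_space_PiM) (rule prob_space_data_law)
  have PG: "prob_space G" unfolding G_def by (rule prob_space_PiM) (rule prob_space_std_normal)
  obtain Q where Q: "prob_space Q" "sets Q = sets (D \<Otimes>\<^sub>M distr G borel S)" "distr Q D fst = D"
    "distr Q (distr G borel S) snd = distr G borel S"
    "measure Q {p\<in>space Q. 11 * r < \<bar>T (fst p) - snd p\<bar>} \<le> eta'"
    using coupling_of_comparison[OF PD PG r Tm T0 Sm S0 comparison eta'] by blast
  have V: "distr G borel S = max_abs_normal_law (k ^ CARD('p))"
    by (simp add: max_abs_normal_law_def G_def S_def[abs_def] N_def)
  have "is_coupling n k Q"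
    by (rule is_couplingI) (use Q in \<open>simp_all add: V D_def\<close>)
  moreover have "T d = max_deviation n k d" for d
  proof -
    \<comment> \<open>The studentised estimator as a function of the cell alone. In Y (C a) the cell
      probability from the square root of tau cancels the one in the estimator, leaving the
      normalised sum of \<open>ze\<close>.\<close>
    define Y where "Y B = \<bar>sqrt ((prob {\<omega>\<in>space M. X \<omega> \<in> B})\<^sup>2 / (\<integral>\<omega>. sigma2 (X \<omega>) * indicator B (X \<omega>) \<partial>M)) *
       ((1 / real n) * (\<Sum>j<n. snd (d j) * inverse (prob {\<omega>\<in>space M. X \<omega> \<in> B}) * indicator B (fst (d j))))\<bar>" for B
    have Ya: "sqrt (real n) * Y (C a) = \<bar>(\<Sum>j<n. ze (d j) a) / sqrt (real n)\<bar>" if a: "a < N" for a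
    proof -
      have "sqrt ((p a)\<^sup>2 / v a) = p a / s a" using p0[OF a] by (simp add: real_sqrt_divide s_def)
      moreover have "(\<Sum>j<n. snd (d j) * inverse (p a) * indicator (C a) (fst (d j)))
          = (\<Sum>j<n. ze (d j) a) * s a / p a"
        unfolding sum_distrib_right sum_divide_distrib using s0[OF a]
        by (intro sum.cong) (auto simp: ze_def field_simps)
      ultimately have "Y (C a) = \<bar>p a / s a * (1 / real n * ((\<Sum>j<n. ze (d j) a) * s a / p a))\<bar>"
        unfolding Y_def p_def[symmetric] v_def[symmetric] by simp
      also have "\<dots> = \<bar>(\<Sum>j<n. ze (d j) a) / real n\<bar>"
        using p0[OF a] s0[OF a] by simp
      finally have "sqrt (real n) * Y (C a) = \<bar>sqrt (real n) * ((\<Sum>j<n. ze (d j) a) / real n)\<bar>"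
        by (simp add: abs_mult)
      also have "sqrt (real n) * ((\<Sum>j<n. ze (d j) a) / real n) = (\<Sum>j<n. ze (d j) a) / sqrt (real n)"
        using n real_div_sqrt[of "real n"] by (simp add: field_simps)
      finally show ?thesis .
    qed
    have "(SUP x\<in>unit_cube. \<bar>sqrt (tau_delta M X sigma2 k x) *
     m_tilde n (\<lambda>j. fst (d j)) (\<lambda>j. snd (d j)) k (p_delta M X k) x\<bar>) = (SUP x\<in>unit_cube. Y (cell k x))"
      by (simp add: Y_def tau_delta_def m_tilde_def p_delta_def)
    also have "\<dots> = Sup (Y ` cell k ` unit_cube)" by (simp add: image_image)
    also have "cell k ` unit_cube = C ` {..<N}"
    proof -
      have "{f. \<forall>i. f i < k} = e ` {..<N}" using e by (simp add: bij_betw_def)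
      then show ?thesis unfolding cell_image_unit_cube[OF k] C_def by (simp only: image_image)
    qed
    also have "Sup (Y ` C ` {..<N}) = Max (Y ` C ` {..<N})" by (rule cSup_eq_Max) (use ne in auto)
    finally have "max_deviation n k d = sqrt (real n) * Max (Y ` C ` {..<N})"
      by (simp add: max_deviation_def)
    also have "\<dots> = Max ((\<lambda>y. sqrt (real n) * y) ` Y ` C ` {..<N})"
      by (rule mono_Max_commute) (use ne in \<open>auto intro!: monoI mult_left_mono\<close>)
    also have "(\<lambda>y. sqrt (real n) * y) ` Y ` C ` {..<N} = (\<lambda>a. \<bar>(\<Sum>j<n. ze (d j) a) / sqrt (real n)\<bar>) ` {..<N}"
      unfolding image_image by (intro image_cong refl) (simp only: Ya lessThan_iff)
    finally show ?thesis by (simp add: T_def)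
  qed
  ultimately show ?thesis using Q(5) by auto
qed

end

text \<open>Each term of the error is matched with one lower bound on \<open>r\<close>: cubing
  \<open>r3\<close> controls n \<kappa>^3 sqrt N / l = l^2 sqrt N / (r^3 sqrt n), and
  \<open>r1\<close> controls the \<open>nu\<close> part. What survives are negative powers of L = ln
  n, coming from the logarithms in the rate.\<close>

lemma coupling_error_bound:
  fixes l L r nu A3 E c :: real and n N :: nat
  assumes n: "0 < n" and N: "0 < N" and L: "0 < L" and l: "1 \<le> l" "l \<le> c0 * L" and nu: "3 \<le> nu"
    and A3: "0 \<le> A3" and E: "0 \<le> E" and c: "0 < c"
    and r1: "L powr (3/2) * sqrt (real N) / real n powr (1/2 - 1/nu) \<le> r"
    and r3: "L * real N powr (1/6) / real n powr (1/6) \<le> r"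
  defines "\<kappa> \<equiv> l / (r * sqrt (real n))"
  shows "real n * (8 / l) * (20 * (A3 * sqrt (real N) * \<kappa> ^ 3 + E * (sqrt (real N) / c) powr nu * \<kappa> powr nu)
      + 32 * (\<kappa> ^ 3 * sqrt (real N)))
    \<le> 8 * (20 * A3 + 32) * c0\<^sup>2 / L + 160 * E * (c0 / (c * sqrt L)) powr nu"
proof -
  have n0: "0 < real n" and N0: "0 < real N" using n N by auto
  have "0 < L * real N powr (1/6) / real n powr (1/6)" using n0 N0 L by simp
  then have r: "0 < r" using r3 by linarith
  have k0: "0 < \<kappa>" using r l n0 by (simp add: \<kappa>_def)
  have c00: "0 < c0" using l L by (metis less_le_trans not_less zero_less_mult_pos2 zero_less_one order_less_le_trans)
  have first: "real n * \<kappa> ^ 3 * sqrt (real N) / l \<le> c0\<^sup>2 / L"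
  proof -
    have e6: "(real m powr (1/6)) ^ 3 = sqrt (real m)" if "0 < real m" for m :: nat
      using that by (simp add: powr_power powr_half_sqrt)
    have "(L * real N powr (1/6) / real n powr (1/6)) ^ 3 \<le> r ^ 3"
      by (rule power_mono[OF r3]) (use L in auto)
    then have r3': "L ^ 3 * sqrt (real N) / sqrt (real n) \<le> r ^ 3"
      by (simp add: power_mult_distrib power_divide e6[OF n0] e6[OF N0])
    have "real n * \<kappa> ^ 3 * sqrt (real N) / l = l\<^sup>2 * (sqrt (real N) / sqrt (real n)) / r ^ 3"
    proof -
      have "sqrt (real n) ^ 3 = real n * sqrt (real n)" using n0 by (simp add: power3_eq_cube)
      then show ?thesis using l r n0
        by (simp add: \<kappa>_def power_divide power_mult_distrib field_simps power2_eq_square power3_eq_cube)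
    qed
    also have "\<dots> \<le> (c0 * L)\<^sup>2 * (sqrt (real N) / sqrt (real n)) / (L ^ 3 * sqrt (real N) / sqrt (real n))"
      by (intro frac_le mult_right_mono power_mono r3') (use l L n0 N0 in auto)
    also have "\<dots> = c0\<^sup>2 / L"
      using L n0 N0 by (simp add: field_simps power2_eq_square power3_eq_cube)
    finally show ?thesis .
  qed
  have second: "real n * ((sqrt (real N) / c) powr nu * \<kappa> powr nu) \<le> (c0 / (c * sqrt L)) powr nu"
  proof -
    define q where "q = L powr (3/2) * sqrt (real N) / real n powr (1/2 - 1/nu)"
    have q0: "0 < q" using L n0 N0 by (simp add: q_def)
    have L32: "L powr (3/2) = L * sqrt L"
      using L powr_add[of L 1 "1/2"] by (simp add: powr_half_sqrt)
    have nn: "real n powr (1/2 - 1/nu) = sqrt (real n) / real n powr (1/nu)"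
      using n0 by (simp add: powr_diff powr_half_sqrt)
    \<comment> \<open>Of L^(3/2) in the rate, one power is used against l \<le> c0 L and the
      remaining sqrt L gives the decay. The factor n^(-1/nu), raised to the power \<open>nu\<close>,
      cancels the number n of exchanges.\<close>
    have "\<kappa> \<le> c0 * L / (q * sqrt (real n))"
      unfolding \<kappa>_def using l L c00 q0 n0 r1[folded q_def] by (intro frac_le mult_right_mono) auto
    also have "\<dots> = c0 / (sqrt L * sqrt (real N) * real n powr (1/nu))"
      using L n0 N0 by (simp add: q_def L32 nn)
    finally have "sqrt (real N) / c * \<kappa> \<le> sqrt (real N) / c * (c0 / (sqrt L * sqrt (real N) * real n powr (1/nu)))"
      by (intro mult_left_mono) (use c in auto)
    also have "\<dots> = c0 / (c * sqrt L) / real n powr (1/nu)" using N0 by simp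
    finally have le: "sqrt (real N) / c * \<kappa> \<le> c0 / (c * sqrt L) / real n powr (1/nu)" .
    have "(sqrt (real N) / c) powr nu * \<kappa> powr nu = (sqrt (real N) / c * \<kappa>) powr nu"
      using k0 c by (subst powr_mult) auto
    also have "\<dots> \<le> (c0 / (c * sqrt L) / real n powr (1/nu)) powr nu"
      by (rule powr_mono2) (use nu k0 c le in auto)
    also have "\<dots> = (c0 / (c * sqrt L)) powr nu / real n"
      using c00 c L n0 nu by (subst powr_divide) (auto simp: powr_powr)
    finally show ?thesis using n0 by (simp add: field_simps)
  qed
  have "real n * (8 / l) * (20 * (A3 * sqrt (real N) * \<kappa> ^ 3 + E * (sqrt (real N) / c) powr nu * \<kappa> powr nu)
      + 32 * (\<kappa> ^ 3 * sqrt (real N)))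
    = 8 * (20 * A3 + 32) * (real n * \<kappa> ^ 3 * sqrt (real N) / l)
      + 160 * E * (real n * ((sqrt (real N) / c) powr nu * \<kappa> powr nu)) / l"
    using l by (simp add: field_simps)
  also have "\<dots> \<le> 8 * (20 * A3 + 32) * (c0\<^sup>2 / L) + 160 * E * (c0 / (c * sqrt L)) powr nu / 1"
    by (intro add_mono mult_left_mono frac_le first second) (use A3 E l in auto)
  finally show ?thesis by simp
qed

text \<open>The edge length is 1 / k n, so powers of \<open>k n\<close> stand for negative powers of
  delta. \<open>Q n\<close> is the joint law of the first n observations and the coupled
  maximum.\<close>

theorem theorem2:
  fixes M :: "'a measure" and X :: "'a \<Rightarrow> real^'p" and eps :: "'a \<Rightarrow> real"
    and fX :: "real^'p \<Rightarrow> real" and sigma2 :: "real^'p \<Rightarrow> real"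
    and cX CX cs Cs nu :: real and k :: "nat \<Rightarrow> nat"
  assumes M: "prob_space M"
    and X_meas: "X \<in> borel_measurable M" and eps_meas: "eps \<in> borel_measurable M"
    and X_cube: "AE \<omega> in M. X \<omega> \<in> unit_cube"
    and cond_mean: "\<forall>B \<in> sets borel. (\<integral>\<omega>. eps \<omega> * indicator B (X \<omega>) \<partial>M) = 0"
    and density: "fX \<in> borel_measurable borel"
      "distributed M lborel X (\<lambda>x. ennreal (fX x))"
    and density_bounds: "0 < cX" "\<forall>x \<in> unit_cube. cX \<le> fX x \<and> fX x \<le> CX"
    and sigma2_meas: "sigma2 \<in> borel_measurable borel"
    and cond_var: "\<forall>B \<in> sets borel.
          (\<integral>\<omega>. (eps \<omega>)\<^sup>2 * indicator B (X \<omega>) \<partial>M)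
          = (\<integral>\<omega>. sigma2 (X \<omega>) * indicator B (X \<omega>) \<partial>M)"
    and sigma2_bounds: "0 < cs" "\<forall>x \<in> unit_cube. cs \<le> sigma2 x \<and> sigma2 x \<le> Cs"
    and k_pos: "\<forall>n. 1 \<le> k n"
    and delta_to_0: "filterlim k at_top sequentially"
    and log_delta: "(\<lambda>n. ln (real (k n))) \<in> O(\<lambda>n. ln (real n))"
    and third_moment: "\<exists>m3 K. m3 \<in> borel_measurable borel
          \<and> integrable M (\<lambda>\<omega>. m3 (X \<omega>))
          \<and> (\<forall>x \<in> unit_cube. m3 x \<le> K)
          \<and> (\<forall>B \<in> sets borel.
               (\<integral>\<omega>. \<bar>eps \<omega>\<bar> ^ 3 * indicator B (X \<omega>) \<partial>M)
               = (\<integral>\<omega>. m3 (X \<omega>) * indicator B (X \<omega>) \<partial>M))"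
    and nu: "4 \<le> nu" and nu_moment: "integrable M (\<lambda>\<omega>. \<bar>eps \<omega>\<bar> powr nu)"
  shows "\<exists>Q :: nat \<Rightarrow> ((nat \<Rightarrow> (real^'p) \<times> real) \<times> real) measure.
     (\<forall>n. prob_space (Q n)
        \<and> sets (Q n) = sets (PiM {..<n} (\<lambda>_. (borel :: ((real^'p) \<times> real) measure))
                              \<Otimes>\<^sub>M (borel :: real measure))
        \<and> distr (Q n) (PiM {..<n} (\<lambda>_. borel)) fst
            = PiM {..<n} (\<lambda>_. distr M borel (\<lambda>\<omega>. (X \<omega>, eps \<omega>)))
        \<and> distr (Q n) borel snd = max_abs_normal_law (k n ^ CARD('p)))
   \<and> bigO_P Q
       (\<lambda>n \<omega>. \<bar>sqrt (real n) *
              (SUP x\<in>unit_cube. \<bar>sqrt (tau_delta M X sigma2 (k n) x) *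
                 m_tilde n (\<lambda>j. fst (fst \<omega> j)) (\<lambda>j. snd (fst \<omega> j)) (k n)
                   (p_delta M X (k n)) x\<bar>)
              - snd \<omega>\<bar>)
       (\<lambda>n. ln (real n) powr (3/2) * real (k n) powr (real CARD('p) / 2)
               / real n powr (1/2 - 1/nu)
            + ln (real n) powr (5/4) * real (k n) powr (real CARD('p) / 4) / real n powr (1/4)
            + ln (real n) * real (k n) powr (real CARD('p) / 6) / real n powr (1/6))"
proof -
  obtain m3 K3 where m3: "integrable M (\<lambda>\<omega>. m3 (X \<omega>))" "\<forall>x\<in>unit_cube. m3 x \<le> K3"
    "\<forall>B \<in> sets borel. (\<integral>\<omega>. \<bar>eps \<omega>\<bar> ^ 3 * indicator B (X \<omega>) \<partial>M)
       = (\<integral>\<omega>. m3 (X \<omega>) * indicator B (X \<omega>) \<partial>M)"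
    using third_moment by blast
  interpret M: prob_space M by (rule M)
  interpret regression_model M X eps fX sigma2 m3 cX cs Cs K3 nu
    by unfold_locales
      (use X_meas eps_meas X_cube cond_mean density(2) density_bounds sigma2_meas cond_var
         sigma2_bounds m3 nu nu_moment in blast)+
  define N where "N n = k n ^ CARD('p)" for n
  define L where "L n = ln (real n)" for n :: nat
  define r where "r n = ln (real n) powr (3/2) * real (k n) powr (real CARD('p) / 2)
               / real n powr (1/2 - 1/nu)
            + ln (real n) powr (5/4) * real (k n) powr (real CARD('p) / 4) / real n powr (1/4)
            + ln (real n) * real (k n) powr (real CARD('p) / 6) / real n powr (1/6)" for n
  obtain c1 where c1: "0 < c1" and c1L: "\<forall>\<^sub>F n in sequentially. norm (ln (real (k n))) \<le> c1 * norm (ln (real n))"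
    using log_delta by (rule landau_o.bigE)
  \<comment> \<open>Chosen so that l = ln 2 + p ln k \<le> c0 ln n: the 1 absorbs ln 2 for n \<ge>
    2, and p c1 absorbs the logarithm of the number of cells.\<close>
  define c0 where "c0 = 1 + real CARD('p) * c1"
  define A3 where "A3 = max 0 K3 / (cs * sqrt (cs * cX))"
  define E where "E = (\<integral>\<omega>. \<bar>eps \<omega>\<bar> powr nu \<partial>M)"
  define c where "c = sqrt (cs * cX)"
  \<comment> \<open>The bound of \<open>coupling_error_bound\<close> plus 1 / L n, which provides
    the strict inequality that \<open>regression_coupling\<close> asks for and still tends to
    0.\<close>
  define eta where "eta n = 8 * (20 * A3 + 32) * c0\<^sup>2 / L n
    + 160 * E * (c0 / (c * sqrt (L n))) powr nu + 1 / L n" for n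
  define good where "good n Q \<longleftrightarrow>
    measure Q {\<omega>\<in>space Q. 11 * r n < \<bar>max_deviation n (k n) (fst \<omega>) - snd \<omega>\<bar>} \<le> eta n" for n Q
  have c0p: "0 < c0" using c1 by (simp add: c0_def add_pos_nonneg)
  have cp: "0 < c" using sigma2_bounds(1) density_bounds(1) by (simp add: c_def)
  have A30: "0 \<le> A3" using sigma2_bounds(1) density_bounds(1) by (simp add: A3_def)
  have E0: "0 \<le> E" by (simp add: E_def)
  have Linf: "filterlim L at_top sequentially"
    unfolding L_def by (rule filterlim_compose[OF ln_at_top filterlim_real_sequentially])
  have ev: "\<forall>\<^sub>F n in sequentially. \<exists>Q. is_coupling n (k n) Q \<and> good n Q"
    using c1L eventually_ge_at_top[of 2] filterlim_at_top[THEN iffD1, OF delta_to_0, rule_format, of 2]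
  proof eventually_elim
    case (elim n)
    have n: "0 < n" "2 \<le> real n" and k2: "2 \<le> k n" using elim by auto
    have L0: "0 < L n" using n by (simp add: L_def)
    have Npos: "0 < N n" using k2 by (simp add: N_def)
    have kN: "real (k n) powr (real CARD('p) / q) = real (N n) powr (1 / q)" for q
      using k2 by (simp add: N_def powr_realpow[symmetric] powr_powr)
    define l where "l = ln (2 * real (N n))"
    have l1: "1 \<le> l"
    proof -
      have "k n \<le> N n" unfolding N_def using k2 by (intro self_le_power) auto
      then have "3 \<le> 2 * real (N n)" using k2 by linarith
      then have "exp 1 \<le> 2 * real (N n)" using exp_le by linarith
      then show ?thesis unfolding l_def using Npos by (subst ln_ge_iff) auto
    qed
    have lL: "l \<le> c0 * L n"
    proof -
      have "l = ln 2 + real CARD('p) * ln (real (k n))"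
        using k2 by (simp add: l_def N_def ln_mult ln_realpow)
      moreover have "ln 2 \<le> L n" unfolding L_def using n by (intro ln_mono) auto
      moreover have "real CARD('p) * ln (real (k n)) \<le> real CARD('p) * (c1 * L n)"
        by (rule mult_left_mono) (use elim(1) k2 L0 in \<open>auto simp: L_def\<close>)
      moreover have "c0 * L n = L n + real CARD('p) * (c1 * L n)" by (simp add: c0_def algebra_simps)
      ultimately show ?thesis by linarith
    qed
    let ?t1 = "L n powr (3/2) * sqrt (real (N n)) / real n powr (1/2 - 1/nu)"
    let ?t3 = "L n * real (N n) powr (1/6) / real n powr (1/6)"
    have t: "0 \<le> ?t1" "0 < ?t3" using L0 n Npos by auto
    have "r n = ?t1 + L n powr (5/4) * real (N n) powr (1/4) / real n powr (1/4) + ?t3"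
      unfolding r_def kN by (simp add: L_def powr_half_sqrt)
    moreover have "0 \<le> L n powr (5/4) * real (N n) powr (1/4) / real n powr (1/4)" by simp
    ultimately have r1: "?t1 \<le> r n" and r3: "?t3 \<le> r n" and r0: "0 < r n" using t by linarith+
    have "real n * (8 / l) * (20 * (A3 * sqrt (real (N n)) * (l / (r n * sqrt (real n))) ^ 3
        + E * (sqrt (real (N n)) / c) powr nu * (l / (r n * sqrt (real n))) powr nu)
      + 32 * ((l / (r n * sqrt (real n))) ^ 3 * sqrt (real (N n))))
      \<le> 8 * (20 * A3 + 32) * c0\<^sup>2 / L n + 160 * E * (c0 / (c * sqrt (L n))) powr nu"
      by (rule coupling_error_bound[OF n(1) Npos L0 l1 lL _ A30 E0 cp r1 r3]) (use nu in simp)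
    also have "\<dots> < eta n" using L0 by (simp add: eta_def)
    finally show ?case
      using regression_coupling[of "k n" n "r n" "eta n"] k2 n(1) r0 l1
      unfolding good_def l_def N_def A3_def E_def c_def by simp
  qed
  \<comment> \<open>A coupling is chosen for every n, and a good one whenever some good one exists;
    by \<open>ev\<close> this is the case for all large n.\<close>
  have "\<forall>n. \<exists>Q. is_coupling n (k n) Q \<and> ((\<exists>Q'. is_coupling n (k n) Q' \<and> good n Q') \<longrightarrow> good n Q)"
    using ex_coupling k_pos by blast
  then obtain Q where Q: "\<And>n. is_coupling n (k n) (Q n)"
    "\<And>n. (\<exists>Q'. is_coupling n (k n) Q' \<and> good n Q') \<Longrightarrow> good n (Q n)"
    by metis
  have eta0: "eta \<longlonglongrightarrow> 0"
  proof -
    have i: "(\<lambda>n. a / L n) \<longlonglongrightarrow> 0" for a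
      by (rule tendsto_divide_0[OF tendsto_const filterlim_at_top_imp_at_infinity[OF Linf]])
    have "filterlim (\<lambda>n. sqrt (L n)) at_top sequentially"
      by (rule filterlim_compose[OF sqrt_at_top Linf])
    then have "(\<lambda>n. (c0 / c) / sqrt (L n)) \<longlonglongrightarrow> 0"
      by (intro tendsto_divide_0[OF tendsto_const] filterlim_at_top_imp_at_infinity)
    then have q: "(\<lambda>n. c0 / (c * sqrt (L n))) \<longlonglongrightarrow> 0" by simp
    have "(\<lambda>n. (c0 / (c * sqrt (L n))) powr nu) \<longlonglongrightarrow> 0"
    proof (rule tendsto_zero_powrI[OF q tendsto_const])
      show "\<forall>\<^sub>F n in sequentially. 0 \<le> c0 / (c * sqrt (L n))"
        using filterlim_at_top[THEN iffD1, OF Linf, rule_format, of 0]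
        by eventually_elim (use c0p cp in simp)
      show "0 < nu" using nu by simp
    qed
    from tendsto_add[OF tendsto_add[OF i[of "8 * (20 * A3 + 32) * c0\<^sup>2"] tendsto_mult_right_zero[OF this, of "160 * E"]] i[of 1]]
    show ?thesis by (simp add: eta_def[abs_def])
  qed
  have bigO: "bigO_P Q (\<lambda>n \<omega>. \<bar>max_deviation n (k n) (fst \<omega>) - snd \<omega>\<bar>) r"
    unfolding bigO_P_def
  proof (intro allI impI)
    fix \<eta> :: real assume "0 < \<eta>"
    then have "\<forall>\<^sub>F n in sequentially. eta n < \<eta>" using eta0 by (rule order_tendstoD(2)[rotated])
    \<comment> \<open>One constant, 11, serves every \<eta>: the exceptional probability
      \<open>eta n\<close> itself tends to 0.\<close>
    with ev have "\<forall>\<^sub>F n in sequentially.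
        measure (Q n) {\<omega> \<in> space (Q n). 11 * r n < \<bar>\<bar>max_deviation n (k n) (fst \<omega>) - snd \<omega>\<bar>\<bar>} < \<eta>"
    proof eventually_elim
      case (elim n)
      then have "good n (Q n)" using Q(2) by blast
      then show ?case using elim(2) by (simp add: good_def)
    qed
    then show "\<exists>K N. \<forall>n\<ge>N.
        measure (Q n) {\<omega> \<in> space (Q n). K * r n < \<bar>\<bar>max_deviation n (k n) (fst \<omega>) - snd \<omega>\<bar>\<bar>} < \<eta>"
      unfolding eventually_sequentially by blast
  qed
  show ?thesis
  proof (intro exI[of _ Q] conjI[rotated] allI)
    show "bigO_P Q
       (\<lambda>n \<omega>. \<bar>sqrt (real n) *
              (SUP x\<in>unit_cube. \<bar>sqrt (tau_delta M X sigma2 (k n) x) *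
                 m_tilde n (\<lambda>j. fst (fst \<omega> j)) (\<lambda>j. snd (fst \<omega> j)) (k n)
                   (p_delta M X (k n)) x\<bar>)
              - snd \<omega>\<bar>)
       (\<lambda>n. ln (real n) powr (3/2) * real (k n) powr (real CARD('p) / 2)
               / real n powr (1/2 - 1/nu)
            + ln (real n) powr (5/4) * real (k n) powr (real CARD('p) / 4) / real n powr (1/4)
            + ln (real n) * real (k n) powr (real CARD('p) / 6) / real n powr (1/6))"
      using bigO unfolding max_deviation_def r_def[abs_def] .
  qed (use Q(1) in \<open>simp_all add: is_coupling_def data_law_def\<close>)
qed

end
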